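(* Let $\mathcal I=\{f_i=r_iR_{\theta_i}\cdot+a_i\}_{i=1}^m$ be an IFS on $\mathbb R^2$ with dense rotations satisfying the open set condition, with attractor $K$, and with $s=\dim_H K>1$, where $s$ is given by $\sum_{i=1}^mr_i^s=1$. Then there is a set $E\subset[0,\pi)$ with $\dim_H E=0$ such that for all $\beta\in[0,\pi)\setminus E$ and all $\epsilon\in(0,s-1)$, $$\mathcal L^1\big\{x\in\pi_\beta(K):\ \dim_H\big(K\cap\pi_\beta^{-1}(x)\big)\ge s-1-\epsilon\big\}>0.$$
   Context: $0<r_i<1$, $R_{\theta_i}$ is rotation by angle $\theta_i$, $a_i\in\mathbb R^2$, $m\ge2$. The attractor is the unique nonempty compact $K$ with $K=\bigcup_if_i(K)$. Open set condition: there is a nonempty open $U$ with $\bigcup_i f_i(U)\subset U$, the union disjoint. Dense rotations: the group generated by $R_{\theta_1},\dots,R_{\theta_m}$ is dense in $SO(2,\mathbb R)$. $\pi_\beta$ is orthogonal projection onto the line through the origin at angle $\beta$ to the $x$-axis, $\mathcal L^1$ is Lebesgue measure on that line, $\dim_H\emptyset=-\infty$. *)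

theory Defs
  imports "HOL-Analysis.Analysis"
begin

definition hs_term :: "real \<Rightarrow> 'a::metric_space set \<Rightarrow> ennreal" where
  "hs_term s U = (if U = {} then 0 else if s = 0 then 1 else ennreal (diameter U powr s))"

definition hausdorff_approx :: "real \<Rightarrow> real \<Rightarrow> 'a::metric_space set \<Rightarrow> ennreal" where
  "hausdorff_approx s \<delta> A =
     Inf {(\<Sum>i. hs_term s (U i)) | U :: nat \<Rightarrow> 'a set.
            A \<subseteq> (\<Union>i. U i) \<and> (\<forall>i. bounded (U i) \<and> diameter (U i) \<le> \<delta>)}"

definition hausdorff_measure :: "real \<Rightarrow> 'a::metric_space set \<Rightarrow> ennreal" where
  "hausdorff_measure s A = (SUP \<delta>\<in>{0<..}. hausdorff_approx s \<delta> A)"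

definition hausdorff_dim :: "'a::metric_space set \<Rightarrow> ereal" where
  "hausdorff_dim A = (if A = {} then -\<infinity>
      else Inf {ereal s | s. s > 0 \<and> hausdorff_measure s A = 0})"

text \<open>R^2 is identified with the complex plane. The similitude r R_theta z + a.\<close>
definition simil :: "real \<Rightarrow> real \<Rightarrow> complex \<Rightarrow> complex \<Rightarrow> complex" where
  "simil r \<theta> a z = complex_of_real r * cis \<theta> * z + a"

text \<open>Orthogonal projection onto the line through 0 at angle beta, with the line identified
  isometrically with R via the unit vector (cos beta, sin beta).\<close>
definition proj :: "real \<Rightarrow> complex \<Rightarrow> real" where
  "proj \<beta> z = Re z * cos \<beta> + Im z * sin \<beta>"

end

theory Submission
  imports Defs "HOL-Probability.Characteristic_Functions"
begin

text \<open>
  Words with equal letter counts have the same linear part, so for every \<open>\<tau> < s - 1\<close> the system contains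
  a homogeneous subsystem with irrational rotation, whose natural measure is a convolution \<open>\<eta> * \<nu>\<close>:
  the factor \<open>\<eta>\<close> (digit set \<open>D\<close>) still has dimension greater than 1, and \<open>\<nu>\<close> is generated by two
  digits \<open>0, \<Delta>\<close>.

  The correlation sums of the projections of \<open>\<eta>\<close> form a submultiplicative cocycle over the rotation;
  since their average over all directions is controlled by the Riesz energy, every projection of
  \<open>\<eta>\<close> has correlation dimension 1, uniformly in the direction (as in Nazarov--Peres--Shmerkin).
  By the Erdos--Kahane argument the projections of \<open>\<nu>\<close> have power Fourier decay outside a set of
  directions of dimension 0 (as in Shmerkin--Solomyak). Multiplying the two Fourier
  transforms bounds the correlations of \<open>\<eta> * \<nu>\<close> at the scale \<open>\<rho>\<^sup>m\<close> by \<open>C b\<^sup>j \<rho>\<^sup>m\<close> at the \<open>j\<close>-th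
  rotated direction, for every \<open>b > 1\<close>. Summing over the common prefixes of pairs of words gives a bound
  for the \<open>\<tau>\<close>-energy restricted to pairs with nearby projections.

  If almost all slices had small \<open>\<tau>\<close>-content, a grid at a fine scale and the Cauchy--Schwarz inequality
  would contradict this energy bound. All measures are replaced by their finite approximations, that is, by
  counting words of length \<open>n\<close>.
\<close>

section \<open>Hausdorff content\<close>

text \<open>Averaging over all directions yields only almost every direction; an exceptional set of
  dimension 0 requires estimates along the orbit \<open>\<omega> ^ j * cis \<beta>\<close> of one
  single direction. Correlation dimension 1 of the projections of \<eta> still allows a loss
  \<open>\<rho> powr (- \<epsilon> * m)\<close> at scale \<open>\<rho> ^ m\<close>, while positive
  Lebesgue measure tolerates a constant loss only. Any power decay of the other factor, however
  slow, pays for this; hence two digits suffice for \<nu>, and almost all of the dimension can be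
  left to \<eta>. The j-th rotated direction sees the cosine factors of \<beta> without the first j
  of them. This delays the decay and costs a factor exponential in j, whose base comes as close to 1
  as desired because \<epsilon> may be small compared with the decay rate. The cost is absorbed
  because pairs of words that nearly agree for j letters carry a weight exponentially small in j,
  with room to spare since \<tau> is strictly below s - 1. Each \<tau> has its own subsystem and its
  own exceptional set; a sequence tending to s - 1 and a countable union give one set for all
  \<epsilon>.\<close>

definition hcontent :: "real \<Rightarrow> 'a::metric_space set \<Rightarrow> ennreal" where
  "hcontent s A = Inf {(\<Sum>i. hs_term s (U i)) | U :: nat \<Rightarrow> 'a set.
            A \<subseteq> (\<Union>i. U i) \<and> (\<forall>i. bounded (U i))}"

lemma hs_term_powr: "s > 0 \<Longrightarrow> hs_term s U = ennreal (diameter U powr s)"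
  by (auto simp: hs_term_def)

lemma hcontent_le_approx: "hcontent s A \<le> hausdorff_approx s \<delta> A"
  unfolding hcontent_def hausdorff_approx_def by (rule Inf_superset_mono) auto

text \<open>For null sets the mesh bound is automatic: each term is at most the total, so a cover
  whose sum is below \<open>\<delta> powr s\<close> has all diameters at most
  \<open>\<delta>\<close>. Dimension only sees null sets, so the content, which has no mesh limit,
  can replace the measure.\<close>

lemma hausdorff_measure_0_iff:
  fixes A :: "'a::metric_space set"
  assumes s: "s > 0"
  shows "hausdorff_measure s A = 0 \<longleftrightarrow> hcontent s A = 0"
proof
  assume h: "hausdorff_measure s A = 0"
  have "hausdorff_approx s 1 A \<le> hausdorff_measure s A"
    unfolding hausdorff_measure_def by (rule SUP_upper) auto
  thus "hcontent s A = 0" using hcontent_le_approx[of s A 1] h by simp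
next
  assume h: "hcontent s A = 0"
  have "hausdorff_approx s \<delta> A = 0" if d: "\<delta> > 0" for \<delta> :: real
  proof -
    have "hausdorff_approx s \<delta> A \<le> ennreal e" if e: "e > 0" for e
    proof -
      define e' where "e' = min e (\<delta> powr s)"
      have e': "e' > 0" "e' \<le> e" "e' \<le> \<delta> powr s" using e d by (auto simp: e'_def)
      have "hcontent s A < ennreal e'" using h e' by simp
      then obtain U :: "nat \<Rightarrow> 'a set" where U: "A \<subseteq> (\<Union>i. U i)" "\<And>i. bounded (U i)"
        "(\<Sum>i. hs_term s (U i)) < ennreal e'"
        unfolding hcontent_def Inf_less_iff by blast
      have "diameter (U i) \<le> \<delta>" for i
      proof -
        have "hs_term s (U i) \<le> (\<Sum>i. hs_term s (U i))"
          using sum_le_suminf[of "\<lambda>i. hs_term s (U i)" "{i}"] by simp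
        hence "ennreal (diameter (U i) powr s) < ennreal e'"
          using U(3) s by (simp add: hs_term_powr)
        hence "diameter (U i) powr s < \<delta> powr s" using e'
          by (simp add: ennreal_less_iff)
        hence "\<not> diameter (U i) > \<delta>" using s d powr_less_mono2[of s \<delta> "diameter (U i)"] by auto
        thus ?thesis by simp
      qed
      hence "hausdorff_approx s \<delta> A \<le> (\<Sum>i. hs_term s (U i))"
        unfolding hausdorff_approx_def using U by (intro Inf_lower) auto
      also have "\<dots> \<le> ennreal e" using U(3) e'(2)
        by (meson ennreal_leI less_imp_le order_trans)
      finally show ?thesis .
    qed
    thus ?thesis
      by (metis ennreal_le_epsilon ennreal_0 add_0 le_zero_eq)
  qed
  thus "hausdorff_measure s A = 0"
    unfolding hausdorff_measure_def by (simp add: SUP_eq_iff)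
qed

lemma hcontent_le_double:
  fixes A :: "'a::metric_space set" and U :: "nat \<Rightarrow> nat \<Rightarrow> 'a set"
  assumes "A \<subseteq> (\<Union>i j. U i j)" "\<And>i j. bounded (U i j)"
  shows "hcontent s A \<le> (\<Sum>i j. hs_term s (U i j))"
proof -
  define V where "V k = (case prod_decode k of (i,j) \<Rightarrow> U i j)" for k
  have "A \<subseteq> (\<Union>k. V k)"
  proof
    fix x assume "x \<in> A"
    then obtain i j where "x \<in> U i j" using assms by blast
    hence "x \<in> V (prod_encode (i,j))" by (simp add: V_def)
    thus "x \<in> (\<Union>k. V k)" by blast
  qed
  moreover have "bounded (V k)" for k using assms(2) by (simp add: V_def split: prod.splits)
  ultimately have "hcontent s A \<le> (\<Sum>k. hs_term s (V k))"
    unfolding hcontent_def by (intro Inf_lower) auto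
  also have "\<dots> = (\<Sum>k. (\<lambda>(i,j). hs_term s (U i j)) (prod_decode k))"
    by (simp add: V_def case_prod_beta)
  also have "\<dots> = (\<Sum>i j. hs_term s (U i j))"
    by (rule suminf_ennreal_2dimen) (simp add: case_prod_beta)
  finally show ?thesis .
qed

lemma hcontent_mono: "A \<subseteq> B \<Longrightarrow> hcontent s A \<le> hcontent s B"
  unfolding hcontent_def by (rule Inf_superset_mono) auto

lemma hcontent_0_UN:
  fixes A :: "nat \<Rightarrow> 'a::metric_space set"
  assumes "\<And>n. hcontent s (A n) = 0"
  shows "hcontent s (\<Union>n. A n) = 0"
proof -
  have "hcontent s (\<Union>n. A n) \<le> ennreal e" if e: "e > 0" for e
  proof -
    have "\<exists>U :: nat \<Rightarrow> 'a set. A n \<subseteq> (\<Union>i. U i) \<and> (\<forall>i. bounded (U i)) \<and>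
        (\<Sum>i. hs_term s (U i)) < ennreal (e * (1/2)^Suc n)" for n
    proof -
      have "hcontent s (A n) < ennreal (e * (1/2)^Suc n)" using assms e by simp
      thus ?thesis unfolding hcontent_def Inf_less_iff by blast
    qed
    then obtain U :: "nat \<Rightarrow> nat \<Rightarrow> 'a set" where U: "\<And>n. A n \<subseteq> (\<Union>i. U n i)" "\<And>n i. bounded (U n i)"
        "\<And>n. (\<Sum>i. hs_term s (U n i)) < ennreal (e * (1/2)^Suc n)" by metis
    have "hcontent s (\<Union>n. A n) \<le> (\<Sum>n i. hs_term s (U n i))"
    proof (rule hcontent_le_double)
      show "(\<Union>n. A n) \<subseteq> (\<Union>n i. U n i)" using U(1) by (rule UN_mono[OF subset_refl])
    qed (rule U(2))
    also have "\<dots> \<le> (\<Sum>n. ennreal (e * (1/2)^Suc n))"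
      using U(3) by (intro suminf_le) (auto intro: less_imp_le)
    also have "\<dots> = ennreal e"
      using sums_mult[OF power_half_series, of e] e
      by (intro suminf_ennreal_eq) auto
    finally show ?thesis .
  qed
  thus ?thesis by (metis ennreal_le_epsilon ennreal_0 add_0 le_zero_eq)
qed

lemma hcontent_singleton: "s > 0 \<Longrightarrow> hcontent s {x} = 0"
proof -
  assume s: "s > 0"
  have "hcontent s {x} \<le> (\<Sum>i::nat. hs_term s {x})"
    unfolding hcontent_def by (intro Inf_lower) auto
  thus ?thesis using s by (simp add: hs_term_powr)
qed

lemma hausdorff_dim_eq_0:
  fixes A :: "'a::metric_space set"
  assumes "A \<noteq> {}" "\<And>s. s > 0 \<Longrightarrow> hcontent s A = 0"
  shows "hausdorff_dim A = 0"
proof -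
  have "{ereal s |s. s > 0 \<and> hausdorff_measure s A = 0} = {ereal s |s. s > 0}"
    using assms(2) hausdorff_measure_0_iff by blast
  moreover have "Inf {ereal s |s. s > 0} = 0"
  proof (rule antisym)
    show "Inf {ereal s |s. s > 0} \<le> 0"
    proof (rule ereal_le_epsilon2)
      fix e :: real assume "e > 0"
      thus "Inf {ereal s |s. s > 0} \<le> 0 + ereal e" by (intro Inf_lower2[of "ereal e"]) auto
    qed
    show "0 \<le> Inf {ereal s |s. s > 0}" by (rule Inf_greatest) auto
  qed
  ultimately show ?thesis using assms(1) by (simp add: hausdorff_dim_def)
qed

text \<open>The convergence half of Borel-Cantelli, with content in place of probability: each point
  is covered at infinitely many levels, so the levels from \<open>M0\<close> on already cover
  \<open>A\<close>, and their total cost is a tail of a convergent series.\<close>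

lemma hcontent_0_limsup:
  fixes A :: "'a::metric_space set" and S :: "nat \<Rightarrow> 'c \<Rightarrow> 'a set"
  assumes s: "s > 0"
    and fin: "\<And>M. finite (F M)"
    and cov: "\<And>x M0. x \<in> A \<Longrightarrow> \<exists>M\<ge>M0. \<exists>c\<in>F M. x \<in> S M c"
    and bdd: "\<And>M c. bounded (S M c)"
    and diam: "\<And>M c. c \<in> F M \<Longrightarrow> diameter (S M c) \<le> D M"
    and summ: "summable (\<lambda>M. real (card (F M)) * D M powr s)"
  shows "hcontent s A = 0"
proof -
  obtain g where g: "\<And>M. bij_betw (g M) {0..<card (F M)} (F M)"
    using ex_bij_betw_nat_finite[OF fin] by metis
  define U where "U M i = (if i < card (F M) then S M (g M i) else {})" for M i
  have hcM: "hcontent s A \<le> (\<Sum>M. ennreal (real (card (F (M + M0))) * D (M + M0) powr s))" for M0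
  proof -
    have "A \<subseteq> (\<Union>M i. U (M + M0) i)"
    proof
      fix x assume "x \<in> A"
      then obtain M c where M: "M \<ge> M0" "c \<in> F M" "x \<in> S M c" using cov by blast
      then obtain i where "i < card (F M)" "g M i = c"
        using g[of M] unfolding bij_betw_def by (metis atLeastLessThan_iff imageE)
      hence "x \<in> U (M - M0 + M0) i" using M by (simp add: U_def)
      thus "x \<in> (\<Union>M i. U (M + M0) i)" by blast
    qed
    hence "hcontent s A \<le> (\<Sum>M i. hs_term s (U (M + M0) i))"
      by (rule hcontent_le_double) (simp add: U_def bdd)
    also have "\<dots> \<le> (\<Sum>M. ennreal (real (card (F (M + M0))) * D (M + M0) powr s))"
    proof (intro suminf_le)
      fix M
      let ?M = "M + M0"
      have "(\<Sum>i. hs_term s (U ?M i)) = (\<Sum>i<card (F ?M). hs_term s (U ?M i))"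
        by (rule suminf_finite) (auto simp: U_def hs_term_def)
      also have "\<dots> \<le> (\<Sum>i<card (F ?M). ennreal (D ?M powr s))"
      proof (rule sum_mono)
        fix i assume i: "i \<in> {..<card (F ?M)}"
        hence "g ?M i \<in> F ?M" using g[of ?M] unfolding bij_betw_def by auto
        hence "diameter (U ?M i) \<le> D ?M" using i diam by (simp add: U_def)
        moreover have "diameter (U ?M i) \<ge> 0" by (intro diameter_ge_0) (simp add: U_def bdd)
        ultimately show "hs_term s (U ?M i) \<le> ennreal (D ?M powr s)"
          using s by (auto simp: hs_term_powr intro!: ennreal_leI powr_mono2)
      qed
      also have "\<dots> = ennreal (real (card (F ?M)) * D ?M powr s)"
        by (simp add: ennreal_mult ennreal_of_nat_eq_real_of_nat)
      finally show "(\<Sum>i. hs_term s (U ?M i)) \<le> ennreal (real (card (F ?M)) * D ?M powr s)" .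
    qed auto
    finally show ?thesis .
  qed
  have "(\<lambda>M0. \<Sum>M. real (card (F (M + M0))) * D (M + M0) powr s) \<longlonglongrightarrow> 0"
    by (rule suminf_exist_split2[OF summ])
  have "hcontent s A \<le> ennreal e" if e: "e > 0" for e
  proof -
    obtain M0 where M0: "norm (\<Sum>M. real (card (F (M + M0))) * D (M + M0) powr s) < e"
      using suminf_exist_split[OF e summ] by blast
    have "(\<Sum>M. ennreal (real (card (F (M + M0))) * D (M + M0) powr s))
        = ennreal (\<Sum>M. real (card (F (M + M0))) * D (M + M0) powr s)"
      using summ summable_iff_shift[of "\<lambda>M. real (card (F M)) * D M powr s" M0]
      by (intro suminf_ennreal2) auto
    also have "\<dots> \<le> ennreal e" using M0 by (intro ennreal_leI) auto
    finally show ?thesis using hcM[of M0] by simp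
  qed
  thus ?thesis by (metis ennreal_le_epsilon ennreal_0 add_0 le_zero_eq)
qed

section \<open>Words and pair counts\<close>

definition words :: "'a set \<Rightarrow> nat \<Rightarrow> 'a list set" where
  "words A n = {xs. set xs \<subseteq> A \<and> length xs = n}"

lemma finite_words [simp]: "finite A \<Longrightarrow> finite (words A n)"
  unfolding words_def by (rule finite_lists_length_eq)

lemma card_words: "finite A \<Longrightarrow> card (words A n) = card A ^ n"
  unfolding words_def by (rule card_lists_length_eq)

lemma words_0 [simp]: "words A 0 = {[]}"
  by (auto simp: words_def)

lemma words_Suc: "words A (Suc n) = (\<lambda>(a, u). a # u) ` (A \<times> words A n)"
  by (auto simp: words_def length_Suc_conv image_iff)

lemma sum_words_Suc:
  "(\<Sum>u\<in>words A (Suc n). f u) = (\<Sum>a\<in>A. \<Sum>u\<in>words A n. f (a # u))"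
proof -
  have "(\<Sum>u\<in>words A (Suc n). f u) = (\<Sum>p\<in>A \<times> words A n. f (fst p # snd p))"
    unfolding words_Suc by (subst sum.reindex) (auto simp: inj_on_def case_prod_beta)
  thus ?thesis by (simp add: sum.cartesian_product case_prod_beta)
qed

lemma words_add: "words A (n + k) = (\<lambda>(u, v). u @ v) ` (words A n \<times> words A k)"
proof
  show "words A (n + k) \<subseteq> (\<lambda>(u, v). u @ v) ` (words A n \<times> words A k)"
  proof
    fix x assume x: "x \<in> words A (n + k)"
    have "x = (\<lambda>(u, v). u @ v) (take n x, drop n x)" by simp
    moreover have "(take n x, drop n x) \<in> words A n \<times> words A k"
      using x by (auto simp: words_def dest: in_set_takeD in_set_dropD)
    ultimately show "x \<in> (\<lambda>(u, v). u @ v) ` (words A n \<times> words A k)" by (rule image_eqI)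
  qed
qed (auto simp: words_def)

lemma inj_on_append_words: "inj_on (\<lambda>(u, v). u @ v) (words A n \<times> words A k)"
  by (auto simp: inj_on_def words_def)

lemma length_words: "u \<in> words A n \<Longrightarrow> length u = n"
  by (simp add: words_def)

text \<open>Horner form of the sum of \<open>\<mu> ^ i\<close> times the i-th digit, that is, the
  image of 0 under the maps z to d + \<mu> z composed along the word. Concatenation of words is
  composition.\<close>

primrec val :: "complex \<Rightarrow> complex list \<Rightarrow> complex" where
  "val \<mu> [] = 0"
| "val \<mu> (d # u) = d + \<mu> * val \<mu> u"

lemma val_append: "val \<mu> (u @ v) = val \<mu> u + \<mu> ^ length u * val \<mu> v"
  by (induction u) (auto simp: algebra_simps)

lemma norm_val_le:
  assumes "\<And>d. d \<in> set u \<Longrightarrow> norm d \<le> B" "norm \<mu> < 1" "B \<ge> 0"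
  shows "norm (val \<mu> u) \<le> B / (1 - norm \<mu>)"
  using assms(1)
proof (induction u)
  case Nil
  then show ?case using assms by simp
next
  case (Cons d u)
  have "norm (val \<mu> (d # u)) \<le> norm d + norm \<mu> * norm (val \<mu> u)"
    by (metis norm_mult norm_triangle_ineq val.simps(2))
  also have "\<dots> \<le> B + norm \<mu> * (B / (1 - norm \<mu>))"
    using Cons by (intro add_mono mult_left_mono) auto
  also have "\<dots> = B / (1 - norm \<mu>)" using assms(2) by (simp add: field_simps)
  finally show ?case .
qed

lemma card_pairs_Sigma:
  assumes "finite P" "finite Q"
  shows "card {p \<in> P \<times> Q. R (fst p) (snd p)} = (\<Sum>u\<in>P. card {v \<in> Q. R u v})"
proof -
  have "{p \<in> P \<times> Q. R (fst p) (snd p)} = Sigma P (\<lambda>u. {v \<in> Q. R u v})" by auto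
  thus ?thesis using assms by simp
qed

text \<open>With \<open>N j\<close> points in cell j, the left side is the sum of
  \<open>N j * N (j - k)\<close>, an autocorrelation; by xy \<le> (x^2 + y^2) / 2 it is largest at k
  = 0.\<close>

lemma card_shift_int:
  fixes g :: "'a \<Rightarrow> int"
  assumes P: "finite P"
  shows "card {p \<in> P \<times> P. g (fst p) = g (snd p) + k} \<le> card {p \<in> P \<times> P. g (fst p) = g (snd p)}"
proof -
  define N where "N j = real (card {v \<in> P. g v = j})" for j
  have N0: "N j = 0" if "j \<notin> g ` P" for j
  proof -
    have "{v \<in> P. g v = j} = {}" using that by auto
    thus ?thesis by (simp only: N_def) simp
  qed
  have grp: "(\<Sum>u\<in>P. F (g u)) = (\<Sum>j\<in>g ` P. N j * F j)" for F :: "int \<Rightarrow> real"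
    unfolding sum.image_gen[OF P, of "\<lambda>u. F (g u)" g] N_def by (intro sum.cong) auto
  have c: "real (card {p \<in> P \<times> P. g (fst p) = g (snd p) + k}) = (\<Sum>j\<in>g ` P. N j * N (j - k))" for k
  proof -
    have "real (card {p \<in> P \<times> P. g (fst p) = g (snd p) + k}) = (\<Sum>u\<in>P. N (g u - k))"
      unfolding card_pairs_Sigma[OF P P, of "\<lambda>a b. g a = g b + k"] of_nat_sum N_def
      by (intro sum.cong arg_cong[where f=real] arg_cong[where f=card]) auto
    thus ?thesis using grp[of "\<lambda>j. N (j - k)"] by simp
  qed
  have "(\<Sum>j\<in>g ` P. (N (j - k))\<^sup>2) = (\<Sum>i\<in>(\<lambda>j. j - k) ` g ` P. (N i)\<^sup>2)"
    by (subst sum.reindex) (auto simp: inj_on_def)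
  also have "\<dots> = (\<Sum>i\<in>(\<lambda>j. j - k) ` g ` P \<inter> g ` P. (N i)\<^sup>2)"
    using P N0 by (intro sum.mono_neutral_right) auto
  also have "\<dots> \<le> (\<Sum>i\<in>g ` P. (N i)\<^sup>2)" using P by (intro sum_mono2) auto
  finally have sq: "(\<Sum>j\<in>g ` P. (N (j - k))\<^sup>2) \<le> (\<Sum>i\<in>g ` P. (N i)\<^sup>2)" .
  have "(\<Sum>j\<in>g ` P. N j * N (j - k)) \<le> (\<Sum>j\<in>g ` P. ((N j)\<^sup>2 + (N (j - k))\<^sup>2) / 2)"
  proof (rule sum_mono)
    fix j show "N j * N (j - k) \<le> ((N j)\<^sup>2 + (N (j - k))\<^sup>2) / 2"
      using sum_squares_bound[of "N j" "N (j - k)"] by simp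
  qed
  also have "\<dots> = ((\<Sum>j\<in>g ` P. (N j)\<^sup>2) + (\<Sum>j\<in>g ` P. (N (j - k))\<^sup>2)) / 2"
    by (simp add: sum.distrib flip: sum_divide_distrib)
  also have "\<dots> \<le> (\<Sum>j\<in>g ` P. (N j)\<^sup>2)" using sq by simp
  finally have "real (card {p \<in> P \<times> P. g (fst p) = g (snd p) + k}) \<le> card {p \<in> P \<times> P. g (fst p) = g (snd p) + 0}"
    unfolding c by (simp add: power2_eq_square)
  thus ?thesis by simp
qed

definition close_pairs :: "'a set \<Rightarrow> ('a \<Rightarrow> real) \<Rightarrow> real \<Rightarrow> nat" where
  "close_pairs P f h = card {p \<in> P \<times> P. \<bar>f (fst p) - f (snd p)\<bar> \<le> h}"

text \<open>By \<open>card_shift_int\<close>, the number of pairs of points whose grid cells differ by a prescribed amount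
  is largest for amount zero.\<close>

lemma close_pairs_shift:
  fixes f :: "'a \<Rightarrow> real"
  assumes P: "finite P" and h: "h > 0" and K: "K \<ge> 0"
  shows "real (card {p \<in> P \<times> P. \<bar>f (fst p) - f (snd p) - c\<bar> \<le> K * h}) \<le> (2 * K + 3) * close_pairs P f h"
proof -
  define g where "g u = \<lfloor>f u / h\<rfloor>" for u
  \<comment> \<open>Taking floors moves a difference by less than 1, whence the margin 1 on both
    sides of K; at most 2K + 3 integers remain.\<close>
  define I where "I = {\<lceil>c / h - K - 1\<rceil>..\<lfloor>c / h + K + 1\<rfloor>}"
  have "{p \<in> P \<times> P. \<bar>f (fst p) - f (snd p) - c\<bar> \<le> K * h} \<subseteq> (\<Union>k\<in>I. {p \<in> P \<times> P. g (fst p) = g (snd p) + k})"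
  proof
    fix p assume p: "p \<in> {p \<in> P \<times> P. \<bar>f (fst p) - f (snd p) - c\<bar> \<le> K * h}"
    obtain u v where uv: "p = (u, v)" by force
    have "\<bar>f u / h - f v / h - c / h\<bar> = \<bar>f u - f v - c\<bar> / h" using h by (simp flip: diff_divide_distrib)
    also have "\<dots> \<le> K" using p uv h by (simp add: field_simps)
    finally have "\<bar>f u / h - f v / h - c / h\<bar> \<le> K" .
    moreover have "of_int (g u) \<le> f u / h" "f u / h < of_int (g u) + 1"
      "of_int (g v) \<le> f v / h" "f v / h < of_int (g v) + 1" unfolding g_def by linarith+
    ultimately have "g u - g v \<in> I" unfolding I_def
      by (simp add: ceiling_le_iff le_floor_iff) linarith
    thus "p \<in> (\<Union>k\<in>I. {p \<in> P \<times> P. g (fst p) = g (snd p) + k})" using p uv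
      by (auto intro!: bexI[of _ "g u - g v"])
  qed
  hence "card {p \<in> P \<times> P. \<bar>f (fst p) - f (snd p) - c\<bar> \<le> K * h} \<le> card (\<Union>k\<in>I. {p \<in> P \<times> P. g (fst p) = g (snd p) + k})"
    using P by (intro card_mono) (auto simp: I_def)
  also have "\<dots> \<le> (\<Sum>k\<in>I. card {p \<in> P \<times> P. g (fst p) = g (snd p) + k})"
    by (rule card_UN_le) (simp add: I_def)
  also have "\<dots> \<le> (\<Sum>k\<in>I. card {p \<in> P \<times> P. g (fst p) = g (snd p)})"
    by (intro sum_mono card_shift_int P)
  also have "\<dots> \<le> (\<Sum>k\<in>I. close_pairs P f h)"
  proof (rule sum_mono)
    fix k
    have "\<bar>f u - f v\<bar> \<le> h" if "g u = g v" for u v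
    proof -
      have "\<bar>f u / h - f v / h\<bar> \<le> 1" using that unfolding g_def by linarith
      hence "\<bar>f u - f v\<bar> / h \<le> 1" using h by (simp flip: diff_divide_distrib)
      thus ?thesis using h by (simp add: field_simps)
    qed
    thus "card {p \<in> P \<times> P. g (fst p) = g (snd p)} \<le> close_pairs P f h"
      unfolding close_pairs_def using P by (intro card_mono) auto
  qed
  also have "\<dots> = card I * close_pairs P f h" by simp
  finally have "real (card {p \<in> P \<times> P. \<bar>f (fst p) - f (snd p) - c\<bar> \<le> K * h}) \<le> real (card I * close_pairs P f h)"
    by (simp only: of_nat_le_iff)
  hence "real (card {p \<in> P \<times> P. \<bar>f (fst p) - f (snd p) - c\<bar> \<le> K * h}) \<le> real (card I) * close_pairs P f h"
    by simp
  moreover have "real (card I) \<le> 2 * K + 3"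
  proof -
    have "real_of_int (\<lfloor>c / h + K + 1\<rfloor> - \<lceil>c / h - K - 1\<rceil> + 1) \<le> 2 * K + 3" by linarith
    moreover have "card I = nat (\<lfloor>c / h + K + 1\<rfloor> - \<lceil>c / h - K - 1\<rceil> + 1)" by (simp add: I_def)
    ultimately show ?thesis using K by linarith
  qed
  ultimately show ?thesis by (elim order_trans) (intro mult_right_mono, auto)
qed

section \<open>Frequencies along an irrational rotation\<close>

text \<open>Consecutive terms have ratio (2n+1)/(2n+2), and (2n+1)(2n+3) \<le> (2n+2)^2, so each
  step loses at least as much as the square root bound does.\<close>

lemma central_binomial_upper: "real ((2 * n) choose n) / 4 ^ n \<le> 1 / sqrt (2 * real n + 1)"
proof (induction n)
  case (Suc n)
  have "(2 * Suc n choose Suc n) * Suc n = 2 * (2 * n + 1) * (2 * n choose n)"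
  proof -
    have "Suc n * (2 * Suc n choose Suc n) = 2 * Suc n * (Suc (2 * n) choose n)"
      using Suc_times_binomial_eq[of "Suc (2*n)" n] by (simp add: algebra_simps)
    moreover have "Suc n * (Suc (2 * n) choose n) = Suc (2 * n) * (2 * n choose n)"
      using Suc_times_binomial_eq[of "2*n" n] binomial_symmetric[of n "Suc (2*n)"]
      by (simp add: algebra_simps)
    ultimately show ?thesis by (simp add: algebra_simps)
  qed
  hence "real (2 * Suc n choose Suc n) * real (Suc n) = 2 * (2 * real n + 1) * real (2 * n choose n)"
    by (metis (no_types, lifting) of_nat_1 of_nat_add of_nat_mult of_nat_numeral)
  hence e: "real (2 * Suc n choose Suc n) / 4 ^ Suc n = (2 * real n + 1) / (2 * (real n + 1)) * (real (2 * n choose n) / 4 ^ n)"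
  proof -
    have *: "A / 4 ^ Suc n = (2 * x + 1) / (2 * (x + 1)) * (B / 4 ^ n)"
      if "A * (x + 1) = 2 * (2 * x + 1) * B" "x \<ge> 0" for A B x :: real
    proof -
      have "A = 2 * (2 * x + 1) * B / (x + 1)" using that by (simp add: eq_divide_eq)
      hence "A / 4 ^ Suc n = 2 * (2 * x + 1) * B / ((x + 1) * (4 * 4 ^ n))" by simp
      also have "\<dots> = (2 * (2 * x + 1) * B) / (2 * (2 * (x + 1) * 4 ^ n))" by (simp add: mult_ac)
      also have "\<dots> = ((2 * x + 1) * B) / (2 * (x + 1) * 4 ^ n)" by (metis (no_types, opaque_lifting) mult.assoc mult_divide_mult_cancel_left zero_neq_numeral)
      finally show ?thesis by simp
    qed
    show ?thesis by (rule *) (use \<open>_ = 2 * (2 * real n + 1) * _\<close> in \<open>simp_all add: add.commute\<close>)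
  qed
  also have "\<dots> \<le> (2 * real n + 1) / (2 * (real n + 1)) * (1 / sqrt (2 * real n + 1))"
    by (intro mult_left_mono Suc.IH) auto
  also have "\<dots> = sqrt (2 * real n + 1) / (2 * (real n + 1))"
  proof -
    have "a / b * (1 / s) = a / s / b" for a b s :: real by (simp add: mult.commute)
    thus ?thesis by (simp only: real_div_sqrt)
  qed
  also have "\<dots> \<le> 1 / sqrt (2 * real (Suc n) + 1)"
  proof -
    have "sqrt (2 * real n + 1) * sqrt (2 * real (Suc n) + 1) = sqrt ((2 * real n + 1) * (2 * real (Suc n) + 1))"
      by (simp add: real_sqrt_mult)
    also have "\<dots> \<le> 2 * (real n + 1)"
      by (rule real_le_lsqrt) (auto simp: power2_eq_square algebra_simps)
    finally show ?thesis by (simp add: field_simps)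
  qed
  finally show ?case .
qed simp

lemma sum_powers_unit_bound:
  fixes z :: complex
  assumes "norm z = 1" "z \<noteq> 1"
  shows "norm (\<Sum>i<n. z ^ i) \<le> 2 / norm (1 - z)"
proof -
  have "(\<Sum>i<n. z ^ i) = (1 - z ^ n) / (1 - z)" using assms by (simp add: sum_gp_strict)
  hence "norm (\<Sum>i<n. z ^ i) = norm (1 - z ^ n) / norm (1 - z)" by (simp add: norm_divide)
  also have "\<dots> \<le> 2 / norm (1 - z)"
  proof (rule divide_right_mono)
    show "norm (1 - z ^ n) \<le> 2" using norm_triangle_ineq4[of 1 "z ^ n"] assms by (simp add: norm_power)
  qed auto
  finally show ?thesis .
qed

text \<open>On the unit circle |1 - z|^2 equals - cnj z (1 - z)^2. An even power is therefore a
  trigonometric polynomial with binomial coefficients, and its constant term, at k = T, is the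
  central one.\<close>

lemma norm_one_minus_power_expand:
  fixes z :: complex
  assumes z: "norm z = 1"
  shows "complex_of_real (norm (1 - z) ^ (2 * T)) = (\<Sum>k\<le>2*T. (-1) ^ (k + T) * of_nat (2 * T choose k) * (z ^ k * cnj z ^ T))"
proof -
  have zz: "z * cnj z = 1" using z by (simp add: complex_norm_square[symmetric])
  have "(1 - z) * cnj (1 - z) = complex_of_real ((norm (1 - z))\<^sup>2)"
    by (rule complex_norm_square[symmetric])
  hence "complex_of_real (norm (1 - z) ^ (2 * T)) = ((1 - z) * cnj (1 - z)) ^ T"
    by (simp only: power_mult of_real_power)
  also have "(1 - z) * cnj (1 - z) = - (cnj z) * (1 - z)\<^sup>2"
    using zz by (simp add: power2_eq_square algebra_simps)
  also have "(- cnj z * (1 - z)\<^sup>2) ^ T = (- cnj z) ^ T * ((- z) + 1) ^ (2 * T)"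
    unfolding power_mult_distrib power_mult by simp
  also have "\<dots> = (\<Sum>k\<le>2*T. (-1) ^ (k + T) * of_nat (2 * T choose k) * (z ^ k * cnj z ^ T))"
    unfolding binomial_ring sum_distrib_left
    by (intro sum.cong refl) (simp add: power_minus[of z] power_minus[of "cnj z"] power_add algebra_simps)
  finally show ?thesis .
qed

text \<open>Quantitative equidistribution. Averaging over the orbit keeps the constant Fourier
  coefficient; every other frequency gives a geometric sum with ratio \<open>\<beta> k\<close>,
  bounded because this ratio is not 1. The constant depends on \<open>\<alpha>\<close> and
  \<open>T\<close> only, hence is uniform in the starting point.\<close>

lemma orbit_average_moment:
  fixes \<alpha> :: complex
  assumes a: "norm \<alpha> = 1" and irr: "\<And>k. k > 0 \<Longrightarrow> \<alpha> ^ k \<noteq> 1"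
  shows "\<exists>C. \<forall>j z. norm z = 1 \<longrightarrow> (\<Sum>i<j. norm (1 - \<alpha> ^ i * z) ^ (2 * T)) \<le> real (2 * T choose T) * j + C"
proof -
  have aa: "\<alpha> * cnj \<alpha> = 1" using a by (simp add: complex_norm_square[symmetric])
  define \<beta> where "\<beta> k = \<alpha> ^ k * cnj \<alpha> ^ T" for k
  have nb: "norm (\<beta> k) = 1" for k using a by (simp add: \<beta>_def norm_mult norm_power)
  have b1: "\<beta> k \<noteq> 1" if "k \<noteq> T" for k
  proof
    assume h: "\<beta> k = 1"
    have "\<alpha> ^ T * \<beta> k = \<alpha> ^ k" unfolding \<beta>_def using aa
      by (metis mult.assoc mult.commute mult_1 power_mult_distrib power_one)
    hence e: "\<alpha> ^ T = \<alpha> ^ k" using h by simp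
    have "\<alpha> \<noteq> 0" using a by auto
    show False
    proof (cases "k < T")
      case True
      hence "\<alpha> ^ k * \<alpha> ^ (T - k) = \<alpha> ^ k" using e by (simp flip: power_add)
      thus False using \<open>\<alpha> \<noteq> 0\<close> irr[of "T - k"] True by simp
    next
      case False
      hence "\<alpha> ^ T * \<alpha> ^ (k - T) = \<alpha> ^ k" by (simp flip: power_add)
      hence "\<alpha> ^ T * \<alpha> ^ (k - T) = \<alpha> ^ T" using e by simp
      thus False using \<open>\<alpha> \<noteq> 0\<close> irr[of "k - T"] False that by simp
    qed
  qed
  define C where "C = (\<Sum>k\<in>{..2*T} - {T}. real (2 * T choose k) * (2 / norm (1 - \<beta> k)))"
  have "(\<Sum>i<j. norm (1 - \<alpha> ^ i * z) ^ (2 * T)) \<le> real (2 * T choose T) * j + C" if z: "norm z = 1" for j z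
  proof -
    define c where "c k = (-1) ^ (k + T) * of_nat (2 * T choose k) * (z ^ k * cnj z ^ T)" for k
    have nc: "norm (c k) = real (2 * T choose k)" for k
      using z by (simp add: c_def norm_mult norm_power)
    have "complex_of_real (\<Sum>i<j. norm (1 - \<alpha> ^ i * z) ^ (2 * T)) =
      (\<Sum>i<j. \<Sum>k\<le>2*T. (-1) ^ (k + T) * of_nat (2 * T choose k) * ((\<alpha> ^ i * z) ^ k * cnj (\<alpha> ^ i * z) ^ T))"
      unfolding of_real_sum using a z
      by (intro sum.cong refl norm_one_minus_power_expand) (simp add: norm_mult norm_power)
    also have "\<dots> = (\<Sum>i<j. \<Sum>k\<le>2*T. c k * \<beta> k ^ i)"
      by (intro sum.cong refl)
        (simp add: c_def \<beta>_def power_mult_distrib mult_ac flip: power_mult)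
    also have "\<dots> = (\<Sum>k\<le>2*T. c k * (\<Sum>i<j. \<beta> k ^ i))"
      by (subst sum.swap) (simp add: sum_distrib_left)
    finally have e: "complex_of_real (\<Sum>i<j. norm (1 - \<alpha> ^ i * z) ^ (2 * T)) = (\<Sum>k\<le>2*T. c k * (\<Sum>i<j. \<beta> k ^ i))" .
    have "(\<Sum>i<j. norm (1 - \<alpha> ^ i * z) ^ (2 * T)) = norm (complex_of_real (\<Sum>i<j. norm (1 - \<alpha> ^ i * z) ^ (2 * T)))"
      unfolding norm_of_real by (simp add: sum_nonneg)
    also have "\<dots> \<le> (\<Sum>k\<le>2*T. real (2 * T choose k) * norm (\<Sum>i<j. \<beta> k ^ i))"
      unfolding e by (rule sum_norm_le) (simp add: norm_mult nc)
    also have "\<dots> = real (2 * T choose T) * norm (\<Sum>i<j. \<beta> T ^ i) + (\<Sum>k\<in>{..2*T} - {T}. real (2 * T choose k) * norm (\<Sum>i<j. \<beta> k ^ i))"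
      by (subst sum.remove[of _ T]) auto
    also have "\<dots> \<le> real (2 * T choose T) * j + C"
    proof (rule add_mono)
      have "norm (\<Sum>i<j. \<beta> T ^ i) \<le> (\<Sum>i<j. norm (\<beta> T ^ i))" by (rule norm_sum)
      thus "real (2 * T choose T) * norm (\<Sum>i<j. \<beta> T ^ i) \<le> real (2 * T choose T) * j"
        by (intro mult_left_mono) (auto simp: norm_power nb)
      show "(\<Sum>k\<in>{..2*T} - {T}. real (2 * T choose k) * norm (\<Sum>i<j. \<beta> k ^ i)) \<le> C"
        unfolding C_def by (intro sum_mono mult_left_mono sum_powers_unit_bound nb b1) auto
    qed
    finally show ?thesis .
  qed
  thus ?thesis by blast
qed

text \<open>On the unit circle the indicator of the strip is majorized by a multiple of \<open>(Im x)\<^sup>2\<^sup>T\<close> with \<open>T \<approx> 1/(2w\<^sup>2)\<close>,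
  a trigonometric polynomial whose mean is a central binomial coefficient over \<open>4\<^sup>T\<close>, of order \<open>w\<close>.\<close>

lemma orbit_strip_frequency:
  fixes \<alpha> :: complex
  assumes a: "norm \<alpha> = 1" and irr: "\<And>k. k > 0 \<Longrightarrow> \<alpha> ^ (2 * k) \<noteq> 1"
    and w: "0 < w" "w \<le> 1/2"
  shows "\<exists>j0. \<forall>j\<ge>j0. \<forall>x. norm x = 1 \<longrightarrow> real (card {i. i < j \<and> \<bar>Re (\<alpha> ^ i * x)\<bar> \<le> w}) \<le> 6 * w * j"
proof -
  define T where "T = nat \<lfloor>1 / (2 * w\<^sup>2)\<rfloor>"
  have w2: "w\<^sup>2 \<le> 1/4" using w power_mono[of w "1/2" 2] by (simp add: power2_eq_square)
  have w2p: "w\<^sup>2 > 0" using w by simp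
  have "1 / (2 * w\<^sup>2) \<ge> 1" using w2 w2p by (simp add: field_simps)
  hence T: "real T \<le> 1 / (2 * w\<^sup>2)" "real T > 1 / (2 * w\<^sup>2) - 1"
    unfolding T_def by linarith+
  have low: "(1 - w\<^sup>2) ^ T \<ge> 1/2"
  proof -
    have "1 + real T * (- w\<^sup>2) \<le> (1 + (- w\<^sup>2)) ^ T" by (rule Bernoulli_inequality) (use w2 in auto)
    moreover have "real T * w\<^sup>2 \<le> 1/2" using T(1) w2p by (simp add: field_simps)
    ultimately show ?thesis by simp
  qed
  have up: "real (2 * T choose T) / 4 ^ T \<le> 2 * w"
  proof -
    have "real (2 * T choose T) / 4 ^ T \<le> 1 / sqrt (2 * real T + 1)" by (rule central_binomial_upper)
    also have "\<dots> \<le> 2 * w"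
    proof -
      have "2 * real T + 1 \<ge> 1 / w\<^sup>2 - 1" using T(2) by (simp add: field_simps)
      moreover have "1 / w\<^sup>2 - 1 \<ge> (1 / (2 * w))\<^sup>2" using w2 w2p by (simp add: field_simps power2_eq_square)
      ultimately have "sqrt (2 * real T + 1) \<ge> 1 / (2 * w)" by (intro real_le_rsqrt) auto
      thus ?thesis using w by (simp add: field_simps)
    qed
    finally show ?thesis .
  qed
  \<comment> \<open>The strip is symmetric under a change of sign, so it can be tested on squares:
    on the orbit of x^2 under \<alpha>^2, where |1 - y^2| = 2 |Im y|.\<close>
  have sq: "norm (\<alpha>\<^sup>2) = 1" using a by (simp add: norm_power)
  have irr2: "(\<alpha>\<^sup>2) ^ k \<noteq> 1" if "k > 0" for k using irr[OF that] by (simp add: power_mult)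
  obtain C where C: "\<And>j z. norm z = 1 \<Longrightarrow> (\<Sum>i<j. norm (1 - (\<alpha>\<^sup>2) ^ i * z) ^ (2 * T)) \<le> real (2 * T choose T) * j + C"
    using orbit_average_moment[OF sq irr2] by blast
  \<comment> \<open>Beyond \<open>j0\<close> the bounded error contributes at most
    \<open>2 * w * j\<close>, the main term \<open>4 * w * j\<close>; hence the factor 6.\<close>
  obtain j0 :: nat where j0: "real j0 \<ge> C / (4 ^ T * w)" using real_arch_simple by blast
  have "real (card {i. i < j \<and> \<bar>Re (\<alpha> ^ i * x)\<bar> \<le> w}) \<le> 6 * w * j" if j: "j \<ge> j0" and x: "norm x = 1" for j x
  proof -
    have pt: "of_bool (\<bar>Re (\<alpha> ^ i * x)\<bar> \<le> w) \<le> 2 * norm (1 - (\<alpha>\<^sup>2) ^ i * x\<^sup>2) ^ (2 * T) / 4 ^ T" for i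
    proof (cases "\<bar>Re (\<alpha> ^ i * x)\<bar> \<le> w")
      case True
      define y where "y = \<alpha> ^ i * x"
      have ny: "norm y = 1" using a x by (simp add: y_def norm_mult norm_power)
      have y2: "(Re y)\<^sup>2 + (Im y)\<^sup>2 = 1" using ny cmod_power2[of y] by simp
      have "(Re y)\<^sup>2 \<le> w\<^sup>2" using True by (simp add: y_def abs_le_square_iff[symmetric] w)
      hence im: "(Im y)\<^sup>2 \<ge> 1 - w\<^sup>2" using y2 by simp
      have "1 - y\<^sup>2 = - 2 * \<i> * of_real (Im y) * y"
      proof -
        have "cnj y * y = 1" using ny by (simp add: complex_norm_square[symmetric] mult.commute)
        hence "1 - y\<^sup>2 = (cnj y - y) * y" by (simp add: power2_eq_square algebra_simps)
        also have "cnj y - y = - 2 * \<i> * of_real (Im y)" by (simp add: complex_eq_iff)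
        finally show ?thesis .
      qed
      hence "norm (1 - y\<^sup>2) = 2 * \<bar>Im y\<bar>" using ny by (simp add: norm_mult)
      hence "norm (1 - y\<^sup>2) ^ (2 * T) / 4 ^ T = ((Im y)\<^sup>2) ^ T" by (simp add: power_mult power_mult_distrib)
      also have "\<dots> \<ge> (1 - w\<^sup>2) ^ T" using im w2 by (intro power_mono) auto
      finally have "2 * (norm (1 - y\<^sup>2) ^ (2 * T) / 4 ^ T) \<ge> 1" using low by linarith
      moreover have "y\<^sup>2 = (\<alpha>\<^sup>2) ^ i * x\<^sup>2" by (simp add: y_def power_mult_distrib flip: power_mult) (simp add: mult.commute)
      ultimately show ?thesis using True by simp
    qed auto
    have "real (card {i. i < j \<and> \<bar>Re (\<alpha> ^ i * x)\<bar> \<le> w}) = (\<Sum>i<j. of_bool (\<bar>Re (\<alpha> ^ i * x)\<bar> \<le> w))"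
      by (simp add: sum_of_bool_eq) (simp add: Collect_conj_eq lessThan_def)
    also have "\<dots> \<le> (\<Sum>i<j. 2 * norm (1 - (\<alpha>\<^sup>2) ^ i * x\<^sup>2) ^ (2 * T) / 4 ^ T)"
      by (intro sum_mono pt)
    also have "\<dots> = 2 / 4 ^ T * (\<Sum>i<j. norm (1 - (\<alpha>\<^sup>2) ^ i * x\<^sup>2) ^ (2 * T))"
      by (simp add: sum_distrib_left)
    also have "\<dots> \<le> 2 / 4 ^ T * (real (2 * T choose T) * j + C)"
      using x by (intro mult_left_mono C) (auto simp: norm_power)
    also have "\<dots> = 2 * (real (2 * T choose T) / 4 ^ T) * j + 2 * (C / 4 ^ T)" by (simp add: field_simps)
    also have "\<dots> \<le> 2 * (2 * w) * j + 2 * (w * j)"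
    proof (intro add_mono mult_left_mono mult_right_mono up)
      have "C / (4 ^ T * w) \<le> real j" using j0 j by linarith
      thus "C / 4 ^ T \<le> w * j" using w by (simp add: field_simps)
    qed auto
    finally show ?thesis by simp
  qed
  thus ?thesis by blast
qed

section \<open>Homogeneous systems\<close>

text \<open>Half-open squares of side s/2 have diameter below s, so each of them contains at most
  one point, and about 2Y/s of them lie on either side of \<open>z\<close> in each
  coordinate.\<close>

lemma card_separated:
  fixes f :: "'a \<Rightarrow> complex"
  assumes s: "s > 0" and Y: "Y \<ge> 0"
    and sep: "\<And>p q. p \<in> Q \<Longrightarrow> q \<in> Q \<Longrightarrow> p \<noteq> q \<Longrightarrow> s \<le> norm (f p - f q)"
    and near: "\<And>q. q \<in> Q \<Longrightarrow> norm (f q - z) \<le> Y"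
  shows "real (card Q) \<le> (4 * Y / s + 5)\<^sup>2"
proof -
  define K where "K = \<lceil>2 * Y / s\<rceil> + 1"
  define g where "g q = (\<lfloor>Re (f q - z) / (s/2)\<rfloor>, \<lfloor>Im (f q - z) / (s/2)\<rfloor>)" for q
  have fl: "\<lfloor>t / (s/2)\<rfloor> \<in> {-K..K}" if "\<bar>t\<bar> \<le> Y" for t
  proof -
    have "\<bar>t / (s/2)\<bar> \<le> 2 * Y / s" using that s by (simp add: field_simps)
    thus ?thesis unfolding K_def atLeastAtMost_iff by linarith
  qed
  have "g ` Q \<subseteq> {-K..K} \<times> {-K..K}"
  proof
    fix y assume "y \<in> g ` Q"
    then obtain q where q: "q \<in> Q" "y = g q" by blast
    have "\<bar>Re (f q - z)\<bar> \<le> Y" "\<bar>Im (f q - z)\<bar> \<le> Y"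
      using near[OF q(1)] abs_Re_le_cmod[of "f q - z"] abs_Im_le_cmod[of "f q - z"] by linarith+
    thus "y \<in> {-K..K} \<times> {-K..K}" unfolding q(2) g_def using fl by blast
  qed
  moreover have "inj_on g Q"
  proof (rule inj_onI, rule ccontr)
    fix p q assume pq: "p \<in> Q" "q \<in> Q" "g p = g q" "p \<noteq> q"
    have d: "\<bar>a - b\<bar> < s/2" if "\<lfloor>a / (s/2)\<rfloor> = \<lfloor>b / (s/2)\<rfloor>" for a b
    proof -
      have "\<bar>a / (s/2) - b / (s/2)\<bar> < 1" using that by linarith
      hence "\<bar>(a - b) / (s/2)\<bar> < 1" by (simp only: diff_divide_distrib)
      thus ?thesis using s by (simp only: abs_divide) (simp add: pos_divide_less_eq)
    qed
    have "\<bar>Re (f p - f q)\<bar> < s/2" "\<bar>Im (f p - f q)\<bar> < s/2"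
      using d[of "Re (f p - z)" "Re (f q - z)"] d[of "Im (f p - z)" "Im (f q - z)"] pq(3)
      by (auto simp: g_def)
    hence "norm (f p - f q) < s" using cmod_le[of "f p - f q"] by linarith
    thus False using sep[OF pq(1,2,4)] by simp
  qed
  ultimately have "card Q \<le> card ({-K..K} \<times> {-K..K})"
    by (intro card_inj_on_le[of g]) auto
  hence "real (card Q) \<le> real (card ({-K..K} \<times> {-K..K}))" by (simp only: of_nat_le_iff)
  also have "\<dots> = (real (nat (2 * K + 1)))\<^sup>2" by (simp add: card_cartesian_product power2_eq_square)
  also have "\<dots> \<le> (4 * Y / s + 5)\<^sup>2"
  proof (rule power_mono)
    have "0 \<le> 2 * Y / s" using Y s by simp
    hence K0: "K \<ge> 0" unfolding K_def by linarith
    have "real_of_int K \<le> 2 * Y / s + 2" unfolding K_def by linarith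
    thus "real (nat (2 * K + 1)) \<le> 4 * Y / s + 5" using K0 by simp
  qed simp
  finally show ?thesis .
qed

lemma exists_scale:
  fixes t X \<rho> :: real
  assumes "0 < \<rho>" "\<rho> < 1" "t \<le> X"
  shows "\<exists>j\<le>n. t \<le> X * \<rho> ^ j \<and> (j = n \<or> X * \<rho> ^ Suc j < t)"
proof (induction n)
  case (Suc n)
  then obtain j where j: "j \<le> n" "t \<le> X * \<rho> ^ j" "j = n \<or> X * \<rho> ^ Suc j < t" by blast
  show ?case
  proof (cases "X * \<rho> ^ Suc j < t")
    case True thus ?thesis using j by (intro exI[of _ j]) auto
  next
    case False thus ?thesis using j by (intro exI[of _ "Suc n"]) auto
  qed
qed (use assms in auto)

text \<open>Discrete layer cake: an element is charged to the last scale j \<le> n with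
  \<open>t x \<le> X * \<rho> ^ j\<close>, and then generously counted at all scales with this
  property.\<close>

lemma sum_by_scale:
  fixes t h :: "'a \<Rightarrow> real" and X \<rho> :: real
  assumes r: "0 < \<rho>" "\<rho> < 1" and S: "finite S" and t: "\<And>x. x \<in> S \<Longrightarrow> t x \<le> X"
    and c: "\<And>j. j \<le> n \<Longrightarrow> c j \<ge> 0"
    and h: "\<And>x j. x \<in> S \<Longrightarrow> j \<le> n \<Longrightarrow> j = n \<or> X * \<rho> ^ Suc j < t x \<Longrightarrow> h x \<le> c j"
  shows "(\<Sum>x\<in>S. h x) \<le> (\<Sum>j\<le>n. c j * real (card {x \<in> S. t x \<le> X * \<rho> ^ j}))"
proof -
  have "(\<Sum>x\<in>S. h x) \<le> (\<Sum>x\<in>S. \<Sum>j\<le>n. c j * of_bool (t x \<le> X * \<rho> ^ j))"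
  proof (rule sum_mono)
    fix x assume x: "x \<in> S"
    obtain j where j: "j \<le> n" "t x \<le> X * \<rho> ^ j" "j = n \<or> X * \<rho> ^ Suc j < t x"
      using exists_scale[OF r t[OF x]] by blast
    have "h x \<le> c j * of_bool (t x \<le> X * \<rho> ^ j)" using h[OF x j(1,3)] j by simp
    also have "\<dots> \<le> (\<Sum>j\<le>n. c j * of_bool (t x \<le> X * \<rho> ^ j))"
      by (rule member_le_sum) (use j c in auto)
    finally show "h x \<le> (\<Sum>j\<le>n. c j * of_bool (t x \<le> X * \<rho> ^ j))" .
  qed
  also have "\<dots> = (\<Sum>j\<le>n. c j * (\<Sum>x\<in>S. of_bool (t x \<le> X * \<rho> ^ j)))"
    by (subst sum.swap) (simp add: sum_distrib_left)
  also have "\<dots> = (\<Sum>j\<le>n. c j * real (card {x \<in> S. t x \<le> X * \<rho> ^ j}))"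
    using S by (intro sum.cong refl arg_cong2[where f="(*)"]) (simp add: Int_def conj_commute)
  finally show ?thesis .
qed

text \<open>A pair of words encodes one point of a sumset: the first word carries the digits from
  \<open>D\<close>, the second those of the two-digit factor. Keeping them apart lets exponential
  sums factorise.\<close>

definition pt :: "complex \<Rightarrow> complex list \<times> complex list \<Rightarrow> complex" where
  "pt \<mu> p = val \<mu> (fst p) + val \<mu> (snd p)"

definition app :: "'a list \<times> 'b list \<Rightarrow> 'a list \<times> 'b list \<Rightarrow> 'a list \<times> 'b list" where
  "app p q = (fst p @ fst q, snd p @ snd q)"

text \<open>\<open>sep\<close> is the finite-level trace of the open set condition.
  \<open>irr\<close> says that the argument of \<open>\<mu>\<close> is an irrational multiple of pi.
  \<open>size\<close> says that the similarity dimension log (card D) / log (1 / \<rho>) of the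
  \<open>D\<close>-factor by itself exceeds 1 + \<tau>.\<close>

locale hom_sys =
  fixes D :: "complex set" and \<Delta> \<mu> :: complex and r0 \<tau> :: real
  assumes finD: "finite D" and \<Delta>: "\<Delta> \<noteq> 0"
    and mu_pos: "0 < norm \<mu>" and mu_less: "norm \<mu> < 1"
    and irr: "\<And>k. k > 0 \<Longrightarrow> Im (\<mu> ^ k) \<noteq> 0"
    and r0: "r0 > 0"
    and sep: "\<And>n p q. p \<in> words D n \<times> words {0, \<Delta>} n \<Longrightarrow> q \<in> words D n \<times> words {0, \<Delta>} n \<Longrightarrow>
               p \<noteq> q \<Longrightarrow> r0 * norm \<mu> ^ n \<le> norm (pt \<mu> p - pt \<mu> q)"
    and tau: "\<tau> > 0" and size: "real (card D) * norm \<mu> powr (1 + \<tau>) > 1"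
begin

abbreviation \<rho> :: real where "\<rho> \<equiv> norm \<mu>"

text \<open>Unit part of the adjoint of multiplication by \<open>\<mu>\<close>: testing
  \<open>\<mu> ^ n * z\<close> against \<open>e\<close> amounts to testing \<open>z\<close> against
  \<open>\<omega> ^ n * e\<close>, scaled by \<open>\<rho> ^ n\<close>. Passing to suffixes
  therefore rotates the direction.\<close>

definition \<omega> :: complex where "\<omega> = cnj \<mu> / of_real \<rho>"

text \<open>\<open>Z\<close> will be \<open>{0}\<close> or \<open>{0, \<Delta>}\<close>. With
  \<open>{0}\<close> the second word is forced and only the \<open>D\<close>-factor remains, so the
  same lemmas serve one factor and the convolution.\<close>

definition P :: "complex set \<Rightarrow> nat \<Rightarrow> (complex list \<times> complex list) set" where
  "P Z n = words D n \<times> words Z n"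

definition N :: "complex set \<Rightarrow> real" where "N Z = real (card D * card Z)"

text \<open>A radius for all \<open>pt\<close>: the factor 2 stands for the two words, the
  denominator for the geometric series, and the summand 1 makes it at least 1.\<close>

definition R :: real where "R = 2 * (1 + norm \<Delta> + (\<Sum>d\<in>D. norm d)) / (1 - \<rho>)"

lemma R_ge_1: "R \<ge> 1"
proof -
  have "2 * (1 + norm \<Delta> + (\<Sum>d\<in>D. norm d)) \<ge> 1 * (1 - \<rho>)"
  proof -
    have "1 * (1 - r) \<le> 2 * (1 + x + y)" if "r \<ge> 0" "x \<ge> 0" "y \<ge> 0" for r x y :: real
      using that by simp
    thus ?thesis by (simp only: norm_ge_zero sum_nonneg)
  qed
  thus ?thesis unfolding R_def using mu_less by (simp add: le_divide_eq)
qed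

lemma norm_omega [simp]: "norm \<omega> = 1"
  using mu_pos by (simp add: \<omega>_def norm_divide)

lemma inner_mu: "inner e (\<mu> ^ n * z) = \<rho> ^ n * inner (\<omega> ^ n * e) z"
proof -
  have i: "inner a b = Re (cnj a * b)" for a b :: complex by (simp add: inner_complex_def)
  have "cnj \<omega> * of_real \<rho> = \<mu>" using mu_pos by (simp add: \<omega>_def)
  hence "\<mu> ^ n = of_real (\<rho> ^ n) * cnj \<omega> ^ n" by (metis mult.commute of_real_power power_mult_distrib)
  hence "cnj e * (\<mu> ^ n * z) = of_real (\<rho> ^ n) * (cnj (\<omega> ^ n * e) * z)" by simp
  thus ?thesis unfolding i by (metis Re_complex_of_real Im_complex_of_real mult_zero_left diff_zero times_complex.sel(1))
qed

lemma card_D: "card D > 0"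
  using size by (cases "card D = 0") auto

lemma card_D_rho: "real (card D) * \<rho> > 1"
proof -
  have "\<rho> powr (1 + \<tau>) \<le> \<rho> powr 1" using mu_pos mu_less tau by (intro powr_mono') auto
  hence "real (card D) * \<rho> powr (1 + \<tau>) \<le> real (card D) * \<rho>"
    using mu_pos by (intro mult_left_mono) auto
  thus ?thesis using size by simp
qed

context
  fixes Z :: "complex set"
  assumes Z: "Z \<subseteq> {0, \<Delta>}" "0 \<in> Z"
begin

lemma finZ: "finite Z" using Z finite_subset by blast

lemma finP [simp]: "finite (P Z n)"
  by (simp add: P_def finD finZ)

lemma cardP: "real (card (P Z n)) = N Z ^ n"
  by (simp add: P_def N_def card_cartesian_product card_words finD finZ power_mult_distrib)

lemma N_ge: "N Z \<ge> real (card D)"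
proof -
  have "card Z \<ge> 1" using Z finZ by (metis One_nat_def Suc_leI card_gt_0_iff empty_iff)
  hence "card D * 1 \<le> card D * card Z" by (intro mult_le_mono) auto
  thus ?thesis unfolding N_def by (simp only: of_nat_le_iff mult_1_right)
qed

lemma N_pos: "N Z > 0" using N_ge card_D by linarith

lemma P_add: "P Z (n + k) = (\<lambda>x. app (fst x) (snd x)) ` (P Z n \<times> P Z k)"
proof
  show "P Z (n + k) \<subseteq> (\<lambda>x. app (fst x) (snd x)) ` (P Z n \<times> P Z k)"
  proof
    fix x assume "x \<in> P Z (n + k)"
    then obtain u u' w w' where "x = (u @ u', w @ w')" "u \<in> words D n" "u' \<in> words D k"
      "w \<in> words Z n" "w' \<in> words Z k" by (auto simp: P_def words_add)
    thus "x \<in> (\<lambda>x. app (fst x) (snd x)) ` (P Z n \<times> P Z k)"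
      by (intro image_eqI[of _ _ "((u, w), (u', w'))"]) (auto simp: app_def P_def)
  qed
qed (auto simp: app_def P_def words_def)

lemma pt_app: "p \<in> P Z n \<Longrightarrow> pt \<mu> (app p q) = pt \<mu> p + \<mu> ^ n * pt \<mu> q"
  by (auto simp: pt_def app_def P_def words_def val_append algebra_simps)

lemma norm_pt: "p \<in> P Z n \<Longrightarrow> norm (pt \<mu> p) \<le> R"
proof -
  assume p: "p \<in> P Z n"
  define B where "B = 1 + norm \<Delta> + (\<Sum>d\<in>D. norm d)"
  have B0: "B \<ge> 0" by (simp add: B_def sum_nonneg add_nonneg_nonneg)
  have "norm (val \<mu> (fst p)) \<le> B / (1 - \<rho>)"
  proof (rule norm_val_le[OF _ mu_less B0])
    fix d assume "d \<in> set (fst p)"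
    hence "d \<in> D" using p by (auto simp: P_def words_def)
    hence "norm d \<le> (\<Sum>d\<in>D. norm d)" by (intro member_le_sum) (use finD in auto)
    thus "norm d \<le> B" unfolding B_def using norm_ge_zero[of \<Delta>] by linarith
  qed
  moreover have "norm (val \<mu> (snd p)) \<le> B / (1 - \<rho>)"
  proof (rule norm_val_le[OF _ mu_less B0])
    fix d assume "d \<in> set (snd p)"
    hence "d = 0 \<or> d = \<Delta>" using p Z by (auto simp: P_def words_def)
    moreover have "0 \<le> (\<Sum>d\<in>D. norm d)" by (simp add: sum_nonneg)
    ultimately show "norm d \<le> B" using B0 by (auto simp: B_def)
  qed
  ultimately have "norm (pt \<mu> p) \<le> B / (1 - \<rho>) + B / (1 - \<rho>)"
    unfolding pt_def using norm_triangle_mono by blast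
  thus ?thesis by (simp add: R_def B_def)
qed

text \<open>Finite form of self-similarity: a pair of long words is a pair of prefixes, which must
  satisfy \<open>A\<close>, followed by a pair of suffixes, of which at most \<open>m\<close> are
  admissible for given prefixes. All recursions over scales rest on this.\<close>

lemma pairs_split:
  assumes A: "\<And>p p' q q'. p \<in> P Z n \<Longrightarrow> q \<in> P Z n \<Longrightarrow> p' \<in> P Z k \<Longrightarrow> q' \<in> P Z k \<Longrightarrow>
      Rel (app p p') (app q q') \<Longrightarrow> A p q"
    and m: "\<And>p q. p \<in> P Z n \<Longrightarrow> q \<in> P Z n \<Longrightarrow> A p q \<Longrightarrow>
      real (card {x \<in> P Z k \<times> P Z k. Rel (app p (fst x)) (app q (snd x))}) \<le> m"
  shows "real (card {x \<in> P Z (n + k) \<times> P Z (n + k). Rel (fst x) (snd x)})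
     \<le> m * real (card {x \<in> P Z n \<times> P Z n. A (fst x) (snd x)})"
proof -
  define T where "T = {x \<in> P Z n \<times> P Z n. A (fst x) (snd x)}"
  define F where "F x = (\<lambda>y. (app (fst x) (fst y), app (snd x) (snd y))) `
      {y \<in> P Z k \<times> P Z k. Rel (app (fst x) (fst y)) (app (snd x) (snd y))}" for x
  have fT: "finite T" by (simp add: T_def)
  have fF: "finite (F x)" for x by (simp add: F_def)
  have "{x \<in> P Z (n + k) \<times> P Z (n + k). Rel (fst x) (snd x)} \<subseteq> (\<Union>x\<in>T. F x)"
  proof
    fix x assume x: "x \<in> {x \<in> P Z (n + k) \<times> P Z (n + k). Rel (fst x) (snd x)}"
    then obtain p p' q q' where pq: "p \<in> P Z n" "q \<in> P Z n" "p' \<in> P Z k" "q' \<in> P Z k"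
      "fst x = app p p'" "snd x = app q q'" unfolding P_add by fastforce
    have "(p, q) \<in> T" unfolding T_def using pq x A[OF pq(1-4)] by auto
    moreover have "x \<in> F (p, q)" unfolding F_def
      by (rule image_eqI[of _ _ "(p', q')"]) (use pq x in \<open>auto simp: prod_eq_iff\<close>)
    ultimately show "x \<in> (\<Union>x\<in>T. F x)" by blast
  qed
  hence "card {x \<in> P Z (n + k) \<times> P Z (n + k). Rel (fst x) (snd x)} \<le> card (\<Union>x\<in>T. F x)"
    using fT fF by (intro card_mono) auto
  also have "\<dots> \<le> (\<Sum>x\<in>T. card (F x))" by (rule card_UN_le[OF fT])
  finally have "real (card {x \<in> P Z (n + k) \<times> P Z (n + k). Rel (fst x) (snd x)}) \<le> (\<Sum>x\<in>T. real (card (F x)))"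
    by (simp flip: of_nat_sum)
  also have "\<dots> \<le> (\<Sum>x\<in>T. m)"
  proof (rule sum_mono)
    fix x assume "x \<in> T"
    hence "real (card {y \<in> P Z k \<times> P Z k. Rel (app (fst x) (fst y)) (app (snd x) (snd y))}) \<le> m"
      unfolding T_def by (intro m) auto
    moreover have "card (F x) \<le> card {y \<in> P Z k \<times> P Z k. Rel (app (fst x) (fst y)) (app (snd x) (snd y))}"
      unfolding F_def by (intro card_image_le) simp
    ultimately show "real (card (F x)) \<le> m" by linarith
  qed
  finally show ?thesis by (simp add: T_def mult.commute)
qed

text \<open>For fixed \<open>p\<close> the separation leaves boundedly many \<open>q\<close>. Of the
  \<open>N Z ^ (2 * j)\<close> pairs only a fraction of order \<open>1 / N Z ^ j\<close> is thus
  close at scale \<open>\<rho> ^ j\<close>.\<close>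

lemma card_near:
  assumes X: "X \<ge> 0"
  shows "real (card {x \<in> P Z j \<times> P Z j. norm (pt \<mu> (fst x) - pt \<mu> (snd x)) \<le> X * \<rho> ^ j})
    \<le> (4 * X / r0 + 5)\<^sup>2 * N Z ^ j"
proof -
  have "real (card {x \<in> P Z j \<times> P Z j. norm (pt \<mu> (fst x) - pt \<mu> (snd x)) \<le> X * \<rho> ^ j}) =
    (\<Sum>p\<in>P Z j. real (card {q \<in> P Z j. norm (pt \<mu> p - pt \<mu> q) \<le> X * \<rho> ^ j}))"
    by (subst card_pairs_Sigma[of _ _ "\<lambda>a b. norm (pt \<mu> a - pt \<mu> b) \<le> X * \<rho> ^ j"]) auto
  also have "\<dots> \<le> (\<Sum>p\<in>P Z j. (4 * X / r0 + 5)\<^sup>2)"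
  proof (rule sum_mono)
    fix p assume "p \<in> P Z j"
    have PZ: "x \<in> words D j \<times> words {0, \<Delta>} j" if "x \<in> P Z j" for x
      using that Z by (auto simp: P_def words_def)
    have "real (card {q \<in> P Z j. norm (pt \<mu> p - pt \<mu> q) \<le> X * \<rho> ^ j}) \<le> (4 * (X * \<rho> ^ j) / (r0 * \<rho> ^ j) + 5)\<^sup>2"
    proof (rule card_separated[where f="pt \<mu>" and z="pt \<mu> p"])
      show "0 < r0 * \<rho> ^ j" "0 \<le> X * \<rho> ^ j" using r0 mu_pos X by simp_all
    qed (use PZ in \<open>auto intro: sep simp: norm_minus_commute\<close>)
    thus "real (card {q \<in> P Z j. norm (pt \<mu> p - pt \<mu> q) \<le> X * \<rho> ^ j}) \<le> (4 * X / r0 + 5)\<^sup>2"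
      using mu_pos by simp
  qed
  also have "\<dots> = (4 * X / r0 + 5)\<^sup>2 * N Z ^ j" by (simp add: cardP mult.commute)
  finally show ?thesis .
qed

definition corr :: "nat \<Rightarrow> complex \<Rightarrow> real" where
  "corr n e = real (close_pairs (P Z n) (\<lambda>p. inner e (pt \<mu> p)) (\<rho> ^ n))"

lemma corr_le: "corr n e \<le> N Z ^ (2 * n)"
proof -
  have "close_pairs (P Z n) (\<lambda>p. inner e (pt \<mu> p)) (\<rho> ^ n) \<le> card (P Z n \<times> P Z n)"
    unfolding close_pairs_def by (intro card_mono) auto
  hence "corr n e \<le> real (card (P Z n \<times> P Z n))" unfolding corr_def by (simp only: of_nat_le_iff)
  thus ?thesis by (simp add: card_cartesian_product cardP mult_2 power_add)
qed

lemma corr_nonneg: "corr n e \<ge> 0" by (simp add: corr_def)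

text \<open>Fixed prefixes merely shift the window by \<open>c\<close>, and the suffixes are
  compared at scale \<open>\<rho> ^ k\<close> in the direction rotated by
  \<open>\<omega> ^ n\<close>. The constant 5 is 2K + 3 with K = 1.\<close>

lemma corr_inner:
  assumes "p \<in> P Z n" "q \<in> P Z n"
  shows "real (card {x \<in> P Z k \<times> P Z k. \<bar>inner e (pt \<mu> (app p (fst x))) - inner e (pt \<mu> (app q (snd x)))\<bar> \<le> \<rho> ^ (n + k)})
     \<le> 5 * corr k (\<omega> ^ n * e)"
proof -
  define c where "c = - (inner e (pt \<mu> p) - inner e (pt \<mu> q)) / \<rho> ^ n"
  let ?f = "\<lambda>p. inner (\<omega> ^ n * e) (pt \<mu> p)"
  have "\<bar>inner e (pt \<mu> (app p a)) - inner e (pt \<mu> (app q b))\<bar> \<le> \<rho> ^ (n + k) \<longleftrightarrow> \<bar>?f a - ?f b - c\<bar> \<le> 1 * \<rho> ^ k" for a b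
  proof -
    have rp: "\<rho> ^ n > 0" using mu_pos by simp
    have "inner e (pt \<mu> (app p a)) - inner e (pt \<mu> (app q b)) = \<rho> ^ n * (?f a - ?f b - c)"
    proof -
      have "inner e (pt \<mu> (app p a)) = inner e (pt \<mu> p) + \<rho> ^ n * ?f a"
        "inner e (pt \<mu> (app q b)) = inner e (pt \<mu> q) + \<rho> ^ n * ?f b"
        by (simp_all only: pt_app[OF assms(1)] pt_app[OF assms(2)] inner_add_right inner_mu)
      moreover have "\<rho> ^ n * c = - (inner e (pt \<mu> p) - inner e (pt \<mu> q))" using mu_pos by (simp add: c_def)
      ultimately show ?thesis by (simp only: right_diff_distrib)
    qed
    hence "\<bar>inner e (pt \<mu> (app p a)) - inner e (pt \<mu> (app q b))\<bar> = \<rho> ^ n * \<bar>?f a - ?f b - c\<bar>"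
      using rp by (simp add: abs_mult)
    thus ?thesis using rp by (simp add: power_add)
  qed
  hence "{x \<in> P Z k \<times> P Z k. \<bar>inner e (pt \<mu> (app p (fst x))) - inner e (pt \<mu> (app q (snd x)))\<bar> \<le> \<rho> ^ (n + k)}
    = {x \<in> P Z k \<times> P Z k. \<bar>?f (fst x) - ?f (snd x) - c\<bar> \<le> 1 * \<rho> ^ k}" by simp
  thus ?thesis using close_pairs_shift[of "P Z k" "\<rho> ^ k" 1 ?f c] mu_pos by (simp add: corr_def)
qed

lemma norm_pt_diff_app:
  assumes "p \<in> P Z n" "q \<in> P Z n" "p' \<in> P Z k" "q' \<in> P Z k"
  shows "norm ((pt \<mu> (app p p') - pt \<mu> (app q q')) - (pt \<mu> p - pt \<mu> q)) \<le> 2 * R * \<rho> ^ n"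
proof -
  have "(pt \<mu> (app p p') - pt \<mu> (app q q')) - (pt \<mu> p - pt \<mu> q) = \<mu> ^ n * (pt \<mu> p' - pt \<mu> q')"
    by (simp add: pt_app[OF assms(1)] pt_app[OF assms(2)] algebra_simps)
  moreover have "norm (pt \<mu> p' - pt \<mu> q') \<le> 2 * R"
    using norm_pt[OF assms(3)] norm_pt[OF assms(4)] norm_triangle_ineq4[of "pt \<mu> p'" "pt \<mu> q'"] by linarith
  ultimately show ?thesis using mu_pos by (simp add: norm_mult norm_power mult.commute)
qed

text \<open>Suffixes move a difference of points by at most \<open>2 * R * \<rho> ^ j\<close>, so
  the prefixes of length j are close as well, which leaves of the order of \<open>N Z ^ j\<close>
  pairs. The suffixes must still agree in projection: a correlation of n - j letters in the
  direction \<open>\<omega> ^ j * e\<close>.\<close>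

lemma near_dir:
  assumes X: "X \<ge> 0" and j: "j \<le> n"
  shows "real (card {x \<in> P Z n \<times> P Z n. norm (pt \<mu> (fst x) - pt \<mu> (snd x)) \<le> X * \<rho> ^ j \<and>
      \<bar>inner e (pt \<mu> (fst x)) - inner e (pt \<mu> (snd x))\<bar> \<le> \<rho> ^ n})
    \<le> 5 * (4 * (X + 2 * R) / r0 + 5)\<^sup>2 * N Z ^ j * corr (n - j) (\<omega> ^ j * e)"
proof -
  define k where "k = n - j"
  have n: "n = j + k" using j by (simp add: k_def)
  let ?Rel = "\<lambda>a b. norm (pt \<mu> a - pt \<mu> b) \<le> X * \<rho> ^ j \<and> \<bar>inner e (pt \<mu> a) - inner e (pt \<mu> b)\<bar> \<le> \<rho> ^ n"
  have "real (card {x \<in> P Z (j + k) \<times> P Z (j + k). ?Rel (fst x) (snd x)})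
      \<le> (5 * corr k (\<omega> ^ j * e)) * real (card {x \<in> P Z j \<times> P Z j. norm (pt \<mu> (fst x) - pt \<mu> (snd x)) \<le> (X + 2 * R) * \<rho> ^ j})"
  proof (rule pairs_split[of j k ?Rel "\<lambda>p q. norm (pt \<mu> p - pt \<mu> q) \<le> (X + 2 * R) * \<rho> ^ j"])
    fix p p' q q' assume pq: "p \<in> P Z j" "q \<in> P Z j" "p' \<in> P Z k" "q' \<in> P Z k" "?Rel (app p p') (app q q')"
    show "norm (pt \<mu> p - pt \<mu> q) \<le> (X + 2 * R) * \<rho> ^ j"
      using norm_pt_diff_app[OF pq(1-4)] pq(5)
        norm_triangle_ineq4[of "pt \<mu> (app p p') - pt \<mu> (app q q')" "(pt \<mu> (app p p') - pt \<mu> (app q q')) - (pt \<mu> p - pt \<mu> q)"]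
      by (simp add: algebra_simps)
  next
    fix p q assume pq: "p \<in> P Z j" "q \<in> P Z j"
    have "card {x \<in> P Z k \<times> P Z k. ?Rel (app p (fst x)) (app q (snd x))} \<le>
      card {x \<in> P Z k \<times> P Z k. \<bar>inner e (pt \<mu> (app p (fst x))) - inner e (pt \<mu> (app q (snd x)))\<bar> \<le> \<rho> ^ (j + k)}"
      by (intro card_mono) (auto simp: n)
    thus "real (card {x \<in> P Z k \<times> P Z k. ?Rel (app p (fst x)) (app q (snd x))}) \<le> 5 * corr k (\<omega> ^ j * e)"
      using corr_inner[OF pq, of k e] by linarith
  qed
  also have "\<dots> \<le> (5 * corr k (\<omega> ^ j * e)) * ((4 * (X + 2 * R) / r0 + 5)\<^sup>2 * N Z ^ j)"
    using X R_ge_1 corr_nonneg by (intro mult_left_mono card_near) auto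
  finally show ?thesis by (simp add: n mult_ac)
qed

lemma near_pairs:
  assumes X: "X \<ge> 0" and j: "j \<le> n"
  shows "real (card {x \<in> P Z n \<times> P Z n. norm (pt \<mu> (fst x) - pt \<mu> (snd x)) \<le> X * \<rho> ^ j})
    \<le> (4 * (X + 2 * R) / r0 + 5)\<^sup>2 * N Z ^ (2 * n) / N Z ^ j"
proof -
  define k where "k = n - j"
  have n: "n = j + k" using j by (simp add: k_def)
  let ?Rel = "\<lambda>a b. norm (pt \<mu> a - pt \<mu> b) \<le> X * \<rho> ^ j"
  have "real (card {x \<in> P Z (j + k) \<times> P Z (j + k). ?Rel (fst x) (snd x)})
      \<le> (N Z ^ (2 * k)) * real (card {x \<in> P Z j \<times> P Z j. norm (pt \<mu> (fst x) - pt \<mu> (snd x)) \<le> (X + 2 * R) * \<rho> ^ j})"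
  proof (rule pairs_split[of j k ?Rel "\<lambda>p q. norm (pt \<mu> p - pt \<mu> q) \<le> (X + 2 * R) * \<rho> ^ j"])
    fix p p' q q' assume pq: "p \<in> P Z j" "q \<in> P Z j" "p' \<in> P Z k" "q' \<in> P Z k" "?Rel (app p p') (app q q')"
    show "norm (pt \<mu> p - pt \<mu> q) \<le> (X + 2 * R) * \<rho> ^ j"
      using norm_pt_diff_app[OF pq(1-4)] pq(5)
        norm_triangle_ineq4[of "pt \<mu> (app p p') - pt \<mu> (app q q')" "(pt \<mu> (app p p') - pt \<mu> (app q q')) - (pt \<mu> p - pt \<mu> q)"]
      by (simp add: algebra_simps)
  next
    fix p q assume pq: "p \<in> P Z j" "q \<in> P Z j"
    have "card {x \<in> P Z k \<times> P Z k. ?Rel (app p (fst x)) (app q (snd x))} \<le> card (P Z k \<times> P Z k)"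
      by (intro card_mono) auto
    hence "real (card {x \<in> P Z k \<times> P Z k. ?Rel (app p (fst x)) (app q (snd x))}) \<le> real (card (P Z k \<times> P Z k))"
      by (simp only: of_nat_le_iff)
    thus "real (card {x \<in> P Z k \<times> P Z k. ?Rel (app p (fst x)) (app q (snd x))}) \<le> N Z ^ (2 * k)"
      by (simp add: card_cartesian_product cardP mult_2 power_add)
  qed
  also have "\<dots> \<le> (N Z ^ (2 * k)) * ((4 * (X + 2 * R) / r0 + 5)\<^sup>2 * N Z ^ j)"
    using X R_ge_1 N_pos by (intro mult_left_mono card_near) auto
  also have "\<dots> = (4 * (X + 2 * R) / r0 + 5)\<^sup>2 * N Z ^ (2 * n) / N Z ^ j"
  proof -
    have "N Z ^ (2 * n) = N Z ^ (2 * k) * N Z ^ j * N Z ^ j" by (simp add: n mult_2 algebra_simps flip: power_add)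
    thus ?thesis using N_pos by simp
  qed
  finally show ?thesis by (simp add: n)
qed

text \<open>The factor 5 comes from the suffixes by \<open>corr_inner\<close>, the other factor is
  2K + 3 for the prefixes, whose projections lie within K = 1 + 2R times
  \<open>\<rho> ^ n\<close>.\<close>

definition C0 :: real where "C0 = 5 * (2 * (1 + 2 * R) + 3)"

lemma C0_ge_1: "C0 \<ge> 1" using R_ge_1 by (simp add: C0_def)

lemma corr_submult:
  assumes e: "norm e = 1"
  shows "corr (n + k) e \<le> C0 * corr n e * corr k (\<omega> ^ n * e)"
proof -
  let ?Rel = "\<lambda>a b. \<bar>inner e (pt \<mu> a) - inner e (pt \<mu> b)\<bar> \<le> \<rho> ^ (n + k)"
  have "real (card {x \<in> P Z (n + k) \<times> P Z (n + k). ?Rel (fst x) (snd x)})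
      \<le> (5 * corr k (\<omega> ^ n * e)) * real (card {x \<in> P Z n \<times> P Z n. \<bar>inner e (pt \<mu> (fst x)) - inner e (pt \<mu> (snd x)) - 0\<bar> \<le> (1 + 2 * R) * \<rho> ^ n})"
  proof (rule pairs_split[of n k ?Rel "\<lambda>p q. \<bar>inner e (pt \<mu> p) - inner e (pt \<mu> q) - 0\<bar> \<le> (1 + 2 * R) * \<rho> ^ n"])
    fix p p' q q' assume pq: "p \<in> P Z n" "q \<in> P Z n" "p' \<in> P Z k" "q' \<in> P Z k" "?Rel (app p p') (app q q')"
    have "\<bar>inner e ((pt \<mu> (app p p') - pt \<mu> (app q q')) - (pt \<mu> p - pt \<mu> q))\<bar> \<le> 2 * R * \<rho> ^ n"
      using Cauchy_Schwarz_ineq2[of e "(pt \<mu> (app p p') - pt \<mu> (app q q')) - (pt \<mu> p - pt \<mu> q)"]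
        norm_pt_diff_app[OF pq(1-4)] e by simp
    moreover have "\<rho> ^ (n + k) \<le> \<rho> ^ n" using mu_pos mu_less by (intro power_decreasing) auto
    ultimately show "\<bar>inner e (pt \<mu> p) - inner e (pt \<mu> q) - 0\<bar> \<le> (1 + 2 * R) * \<rho> ^ n"
      using pq(5) by (simp add: inner_diff_right algebra_simps)
  qed (intro corr_inner)
  also have "\<dots> \<le> (5 * corr k (\<omega> ^ n * e)) * ((2 * (1 + 2 * R) + 3) * corr n e)"
    unfolding corr_def using mu_pos R_ge_1
    by (intro mult_left_mono close_pairs_shift) auto
  also have "\<dots> = C0 * corr n e * corr k (\<omega> ^ n * e)" by (simp only: C0_def mult_ac)
  finally show ?thesis by (simp only: corr_def close_pairs_def)
qed

end

end

section \<open>Uniform correlation dimension of projections\<close>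

lemma prod_le_mean_power:
  fixes y :: "nat \<Rightarrow> real" and B :: real
  assumes "j > 0" "\<And>i. i < j \<Longrightarrow> y i \<ge> 0" "(\<Sum>i<j. y i) \<le> B * j"
  shows "(\<Prod>i<j. y i) \<le> B ^ j"
proof -
  define p where "p = (\<Prod>i<j. y i)"
  have p0: "p \<ge> 0" unfolding p_def using assms(2) by (intro prod_nonneg) auto
  have "p powr (1 / real j) \<le> (\<Sum>i<j. y i / real j)"
    using arith_geom_mean[of "{..<j}" y] assms by (auto simp: p_def lessThan_empty_iff)
  also have "\<dots> \<le> B" using assms(1,3) by (simp add: field_simps flip: sum_divide_distrib)
  finally have "(p powr (1 / real j)) ^ j \<le> B ^ j" by (intro power_mono) auto
  moreover have "(p powr (1 / real j)) ^ j = p"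
    using assms(1) p0 by (cases "p = 0") (auto simp: powr_power)
  ultimately show ?thesis by (simp add: p_def)
qed

context hom_sys
begin

lemma Z0: "{0} \<subseteq> {0, \<Delta>}" "0 \<in> {0::complex}" and Z2: "{0, \<Delta>} \<subseteq> {0, \<Delta>}" "0 \<in> {0, \<Delta>}"
  by auto

lemma N_Z0: "N {0} = real (card D)" and N_Z2: "N {0, \<Delta>} = 2 * real (card D)"
  using \<Delta> by (auto simp: N_def)

lemma sum_rho_bound:
  fixes b :: real
  assumes "0 \<le> b" "b < 1"
  shows "(\<Sum>j\<le>n. b ^ j) \<le> 1 / (1 - b)"
  using assms by (subst sum_gp0) (auto simp: divide_simps)

text \<open>The summand is, up to a constant, the proportion of directions that do not separate the
  pair at scale \<open>\<rho> ^ n\<close>. Pairs at distance about \<open>\<rho> ^ j\<close>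
  contribute the j-th power of b = 1 / (card D \<rho>), and b < 1 because the
  \<open>D\<close>-factor has dimension greater than 1.\<close>

lemma energy_1:
  "\<exists>C. \<forall>n. (\<Sum>x\<in>P {0} n \<times> P {0} n. \<rho> ^ n / max (norm (pt \<mu> (fst x) - pt \<mu> (snd x))) (\<rho> ^ n))
     \<le> C * \<rho> ^ n * N {0} ^ (2 * n)"
proof -
  define X where "X = 2 * R"
  have X: "X \<ge> 1" using R_ge_1 by (simp add: X_def)
  define CX where "CX = (4 * (X + 2 * R) / r0 + 5)\<^sup>2"
  define b where "b = 1 / (N {0} * \<rho>)"
  have Nr: "N {0} * \<rho> > 1" using card_D_rho by (simp add: N_Z0)
  have b: "0 \<le> b" "b < 1" using Nr by (auto simp: b_def)
  have N0: "N {0} > 0" using N_pos[OF Z0] .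
  have "(\<Sum>x\<in>P {0} n \<times> P {0} n. \<rho> ^ n / max (norm (pt \<mu> (fst x) - pt \<mu> (snd x))) (\<rho> ^ n))
     \<le> (CX / \<rho> / (1 - b)) * \<rho> ^ n * N {0} ^ (2 * n)" for n
  proof -
    have rp: "\<rho> ^ k > 0" for k using mu_pos by simp
    have "(\<Sum>x\<in>P {0} n \<times> P {0} n. \<rho> ^ n / max (norm (pt \<mu> (fst x) - pt \<mu> (snd x))) (\<rho> ^ n))
      \<le> (\<Sum>j\<le>n. \<rho> ^ n / \<rho> ^ Suc j * real (card {x \<in> P {0} n \<times> P {0} n. norm (pt \<mu> (fst x) - pt \<mu> (snd x)) \<le> X * \<rho> ^ j}))"
    proof (rule sum_by_scale[OF mu_pos mu_less])
      show "finite (P {0} n \<times> P {0} n)" by (simp add: finP[OF Z0])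
      show "0 \<le> \<rho> ^ n / \<rho> ^ Suc j" for j by simp
      fix x assume x: "x \<in> P {0} n \<times> P {0} n"
      show "norm (pt \<mu> (fst x) - pt \<mu> (snd x)) \<le> X"
        using norm_pt[OF Z0, of "fst x" n] norm_pt[OF Z0, of "snd x" n] x
          norm_triangle_ineq4[of "pt \<mu> (fst x)" "pt \<mu> (snd x)"] by (auto simp: X_def)
      fix j assume j: "j \<le> n" "j = n \<or> X * \<rho> ^ Suc j < norm (pt \<mu> (fst x) - pt \<mu> (snd x))"
      have "\<rho> ^ Suc j \<le> max (norm (pt \<mu> (fst x) - pt \<mu> (snd x))) (\<rho> ^ n)"
      proof (cases "j = n")
        case True
        have "\<rho> ^ Suc n \<le> \<rho> ^ n" using mu_pos mu_less by (intro power_decreasing) auto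
        thus ?thesis using True by simp
      next
        case False
        have "1 * \<rho> ^ Suc j \<le> X * \<rho> ^ Suc j" using X rp by (intro mult_right_mono) auto
        thus ?thesis using j False by auto
      qed
      thus "\<rho> ^ n / max (norm (pt \<mu> (fst x) - pt \<mu> (snd x))) (\<rho> ^ n) \<le> \<rho> ^ n / \<rho> ^ Suc j"
        using rp[of "Suc j"] rp[of n] by (intro divide_left_mono mult_pos_pos) (auto simp: less_max_iff_disj)
    qed
    also have "\<dots> \<le> (\<Sum>j\<le>n. \<rho> ^ n / \<rho> ^ Suc j * (CX * N {0} ^ (2 * n) / N {0} ^ j))"
      unfolding CX_def using X by (intro sum_mono mult_left_mono near_pairs[OF Z0]) auto
    also have "\<dots> = (\<Sum>j\<le>n. (CX / \<rho> * \<rho> ^ n * N {0} ^ (2 * n)) * b ^ j)"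
      by (intro sum.cong refl) (simp add: b_def power_divide power_mult_distrib mult_ac)
    also have "\<dots> = (CX / \<rho> * \<rho> ^ n * N {0} ^ (2 * n)) * (\<Sum>j\<le>n. b ^ j)"
      by (simp add: sum_distrib_left)
    also have "\<dots> \<le> (CX / \<rho> * \<rho> ^ n * N {0} ^ (2 * n)) * (1 / (1 - b))"
      using N0 by (intro mult_left_mono sum_rho_bound b) (auto simp: CX_def)
    finally show ?thesis by (simp add: field_simps)
  qed
  thus ?thesis by blast
qed

lemma omega_pow_ne: "k > 0 \<Longrightarrow> \<omega> ^ (2 * k) \<noteq> 1"
proof
  assume k: "k > 0" "\<omega> ^ (2 * k) = 1"
  have "\<omega> ^ k * \<omega> ^ k = 1" using k by (simp add: mult_2 power_add)
  hence "(\<omega> ^ k - 1) * (\<omega> ^ k + 1) = 0" by (simp add: algebra_simps)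
  hence "\<omega> ^ k = 1 \<or> \<omega> ^ k = -1" by (auto simp: eq_neg_iff_add_eq_0)
  hence "Im (\<omega> ^ k) = 0" by auto
  moreover have "\<mu> ^ k = of_real (\<rho> ^ k) * cnj (\<omega> ^ k)"
    using mu_pos by (simp add: \<omega>_def power_divide)
  moreover have "Im (of_real x * cnj y) = - (x * Im y)" for x y by simp
  ultimately have "Im (\<mu> ^ k) = 0" by (simp only: mult_zero_right minus_zero)
  thus False using irr[OF k(1)] by simp
qed

text \<open>Time averages along a single orbit replace averages over all directions: the strip in
  question has relative width \<open>\<rho> ^ n / norm z\<close>. Vectors of length at most twice
  the window are treated trivially, as \<open>orbit_strip_frequency\<close> asks for w \<le>
  1/2.\<close>

lemma orbit_pair_frequency:
  assumes n: "n > 0"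
  shows "\<exists>j0. \<forall>j\<ge>j0. \<forall>e. norm e = 1 \<longrightarrow>
    real (card {i. i < j \<and> \<bar>inner (\<omega> ^ (n * i) * e) z\<bar> \<le> \<rho> ^ n}) \<le> 6 * (\<rho> ^ n / max (norm z) (\<rho> ^ n)) * j"
proof (cases "norm z \<le> 2 * \<rho> ^ n")
  case True
  have rp: "\<rho> ^ n > 0" using mu_pos by simp
  have "real (card {i. i < j \<and> \<bar>inner (\<omega> ^ (n * i) * e) z\<bar> \<le> \<rho> ^ n}) \<le> 6 * (\<rho> ^ n / max (norm z) (\<rho> ^ n)) * j" for j e
  proof -
    have "card {i. i < j \<and> \<bar>inner (\<omega> ^ (n * i) * e) z\<bar> \<le> \<rho> ^ n} \<le> card {..<j}" by (intro card_mono) auto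
    hence "real (card {i. i < j \<and> \<bar>inner (\<omega> ^ (n * i) * e) z\<bar> \<le> \<rho> ^ n}) \<le> 1 * real j" by simp
    also have "\<dots> \<le> 6 * (\<rho> ^ n / max (norm z) (\<rho> ^ n)) * real j"
    proof (rule mult_right_mono)
      have "1/2 \<le> r / M" if "0 < M" "M \<le> 2 * r" for r M :: real using that by (simp add: field_simps)
      from this[of "max (norm z) (\<rho> ^ n)" "\<rho> ^ n"] have "1/2 \<le> \<rho> ^ n / max (norm z) (\<rho> ^ n)"
        using True rp by auto
      thus "1 \<le> 6 * (\<rho> ^ n / max (norm z) (\<rho> ^ n))" by simp
    qed simp
    finally show ?thesis .
  qed
  thus ?thesis by blast
next
  case False
  have rp: "\<rho> ^ n > 0" using mu_pos by simp
  have z: "norm z > 0" using False rp by linarith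
  define w where "w = \<rho> ^ n / norm z"
  have w: "0 < w" "w \<le> 1/2" using z rp False by (auto simp: w_def divide_simps)
  define \<alpha> where "\<alpha> = cnj \<omega> ^ n"
  have a: "norm \<alpha> = 1" by (simp add: \<alpha>_def norm_power)
  have ai: "\<alpha> ^ (2 * k) \<noteq> 1" if "k > 0" for k
  proof
    assume "\<alpha> ^ (2 * k) = 1"
    hence "cnj (\<omega> ^ (2 * (n * k))) = 1" by (simp add: \<alpha>_def mult_ac flip: power_mult)
    hence "\<omega> ^ (2 * (n * k)) = 1" by (metis complex_cnj_cnj complex_cnj_one)
    thus False using omega_pow_ne[of "n * k"] n that by simp
  qed
  obtain j0 where j0: "\<And>j x. j \<ge> j0 \<Longrightarrow> norm x = 1 \<Longrightarrow> real (card {i. i < j \<and> \<bar>Re (\<alpha> ^ i * x)\<bar> \<le> w}) \<le> 6 * w * j"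
    using orbit_strip_frequency[OF a ai w] by blast
  have "real (card {i. i < j \<and> \<bar>inner (\<omega> ^ (n * i) * e) z\<bar> \<le> \<rho> ^ n}) \<le> 6 * (\<rho> ^ n / max (norm z) (\<rho> ^ n)) * j"
    if "j \<ge> j0" "norm e = 1" for j e
  proof -
    define x where "x = cnj e * z / of_real (norm z)"
    have x: "norm x = 1" using that z by (simp add: x_def norm_mult norm_divide)
    have "inner (\<omega> ^ (n * i) * e) z = norm z * Re (\<alpha> ^ i * x)" for i
    proof -
      have "inner a b = Re (cnj a * b)" for a b :: complex by (simp add: inner_complex_def)
      hence "inner (\<omega> ^ (n * i) * e) z = Re (cnj (\<omega> ^ (n * i) * e) * z)" .
      also have "cnj (\<omega> ^ (n * i) * e) * z = of_real (norm z) * (\<alpha> ^ i * x)"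
        using z by (simp add: \<alpha>_def x_def power_mult)
      finally show ?thesis by simp
    qed
    hence "\<bar>inner (\<omega> ^ (n * i) * e) z\<bar> \<le> \<rho> ^ n \<longleftrightarrow> \<bar>Re (\<alpha> ^ i * x)\<bar> \<le> w" for i
      using z by (simp only: abs_mult w_def) (simp add: pos_le_divide_eq mult.commute)
    moreover have "max (norm z) (\<rho> ^ n) = norm z" using False rp by simp
    ultimately show ?thesis using j0[OF that(1) x] by (simp add: w_def)
  qed
  thus ?thesis by blast
qed

text \<open>Double counting over pairs and times reduces this to \<open>energy_1\<close>. The
  constant does not depend on n, which the later choice of a block length relies on; only the
  waiting time \<open>j0\<close> does.\<close>

lemma corr_orbit_average:
  "\<exists>C. \<forall>n>0. \<exists>j0. \<forall>j\<ge>j0. \<forall>e. norm e = 1 \<longrightarrow>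
     (\<Sum>i<j. corr {0} n (\<omega> ^ (n * i) * e) / N {0} ^ (2 * n)) \<le> C * \<rho> ^ n * j"
proof -
  obtain C where C: "\<And>n. (\<Sum>x\<in>P {0} n \<times> P {0} n. \<rho> ^ n / max (norm (pt \<mu> (fst x) - pt \<mu> (snd x))) (\<rho> ^ n))
     \<le> C * \<rho> ^ n * N {0} ^ (2 * n)" using energy_1 by blast
  have N0: "N {0} > 0" using N_pos[OF Z0] .
  have "\<exists>j0. \<forall>j\<ge>j0. \<forall>e. norm e = 1 \<longrightarrow>
     (\<Sum>i<j. corr {0} n (\<omega> ^ (n * i) * e) / N {0} ^ (2 * n)) \<le> (6 * C) * \<rho> ^ n * j" if n: "n > 0" for n
  proof -
    let ?S = "P {0} n \<times> P {0} n"
    let ?z = "\<lambda>x. pt \<mu> (fst x) - pt \<mu> (snd x)"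
    have fS: "finite ?S" by (simp add: finP[OF Z0])
    have "\<forall>z. \<exists>j0. \<forall>j\<ge>j0. \<forall>e. norm e = 1 \<longrightarrow>
      real (card {i. i < j \<and> \<bar>inner (\<omega> ^ (n * i) * e) z\<bar> \<le> \<rho> ^ n}) \<le> 6 * (\<rho> ^ n / max (norm z) (\<rho> ^ n)) * j"
      using orbit_pair_frequency[OF n] by simp
    from choice[OF this] obtain J where J: "\<And>z j e. j \<ge> J z \<Longrightarrow> norm e = 1 \<Longrightarrow>
      real (card {i. i < j \<and> \<bar>inner (\<omega> ^ (n * i) * e) z\<bar> \<le> \<rho> ^ n}) \<le> 6 * (\<rho> ^ n / max (norm z) (\<rho> ^ n)) * j"
      by blast
    \<comment> \<open>A maximum over finitely many pairs: one waiting time has to serve all pairs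
      and all directions at once.\<close>
    define j0 where "j0 = Max ((\<lambda>x. J (?z x)) ` ?S \<union> {0})"
    have j0: "J (?z x) \<le> j0" if "x \<in> ?S" for x
      unfolding j0_def using fS that by (intro Max_ge) auto
    have "(\<Sum>i<j. corr {0} n (\<omega> ^ (n * i) * e) / N {0} ^ (2 * n)) \<le> (6 * C) * \<rho> ^ n * j"
      if j: "j \<ge> j0" and e: "norm e = 1" for j e
    proof -
      have "(\<Sum>i<j. corr {0} n (\<omega> ^ (n * i) * e)) = (\<Sum>i<j. \<Sum>x\<in>?S. of_bool (\<bar>inner (\<omega> ^ (n * i) * e) (?z x)\<bar> \<le> \<rho> ^ n))"
        using fS by (intro sum.cong refl) (simp add: corr_def[OF Z0] close_pairs_def inner_diff_right Int_def)
      also have "\<dots> = (\<Sum>x\<in>?S. \<Sum>i<j. of_bool (\<bar>inner (\<omega> ^ (n * i) * e) (?z x)\<bar> \<le> \<rho> ^ n))"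
        by (rule sum.swap)
      also have "\<dots> \<le> (\<Sum>x\<in>?S. 6 * (\<rho> ^ n / max (norm (?z x)) (\<rho> ^ n)) * j)"
      proof (rule sum_mono)
        fix x assume x: "x \<in> ?S"
        have "(\<Sum>i<j. of_bool (\<bar>inner (\<omega> ^ (n * i) * e) (?z x)\<bar> \<le> \<rho> ^ n)) =
            real (card {i. i < j \<and> \<bar>inner (\<omega> ^ (n * i) * e) (?z x)\<bar> \<le> \<rho> ^ n})"
          by (simp add: lessThan_def Collect_conj_eq)
        also have "\<dots> \<le> 6 * (\<rho> ^ n / max (norm (?z x)) (\<rho> ^ n)) * j"
          using J[OF _ e, of "?z x" j] j0[OF x] j by simp
        finally show "(\<Sum>i<j. of_bool (\<bar>inner (\<omega> ^ (n * i) * e) (?z x)\<bar> \<le> \<rho> ^ n)) \<le> 6 * (\<rho> ^ n / max (norm (?z x)) (\<rho> ^ n)) * j" .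
      qed
      also have "\<dots> = 6 * j * (\<Sum>x\<in>?S. \<rho> ^ n / max (norm (?z x)) (\<rho> ^ n))"
        by (simp add: sum_distrib_left mult_ac)
      also have "\<dots> \<le> 6 * j * (C * \<rho> ^ n * N {0} ^ (2 * n))"
        by (intro mult_left_mono C) auto
      finally have "(\<Sum>i<j. corr {0} n (\<omega> ^ (n * i) * e)) \<le> (6 * C) * \<rho> ^ n * j * N {0} ^ (2 * n)"
        by (simp add: mult_ac)
      thus ?thesis using N0 by (simp add: pos_divide_le_eq flip: sum_divide_distrib)
    qed
    thus ?thesis by blast
  qed
  thus ?thesis by blast
qed

definition q :: "nat \<Rightarrow> complex \<Rightarrow> real" where "q n e = corr {0} n e / N {0} ^ (2 * n)"

lemma q_bounds: "0 \<le> q n e" "q n e \<le> 1"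
proof -
  have "N {0} ^ (2 * n) > 0" using N_pos[OF Z0] by (rule zero_less_power)
  thus "0 \<le> q n e" "q n e \<le> 1" unfolding q_def
    using corr_le[OF Z0, of n e] corr_nonneg[OF Z0, of n e] by (simp_all only: pos_divide_le_eq mult_1 divide_nonneg_pos)
qed

lemma q_submult: "norm e = 1 \<Longrightarrow> q (n + k) e \<le> C0 * q n e * q k (\<omega> ^ n * e)"
  using corr_submult[OF Z0, of e n k] N_pos[OF Z0]
  by (simp add: q_def divide_simps power_add distrib_left mult_ac)

lemma q_iterate:
  assumes "norm e = 1"
  shows "q (j * n) e \<le> (\<Prod>i<j. C0 * q n (\<omega> ^ (n * i) * e))"
  using assms
proof (induction j arbitrary: e)
  case 0
  then show ?case using q_bounds by simp
next
  case (Suc j)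
  have C0: "C0 \<ge> 0" using C0_ge_1[OF Z0] by simp
  have "norm (\<omega> ^ n * e) = 1" using Suc.prems by (simp add: norm_mult norm_power)
  note IH = Suc.IH[OF this]
  have "q (Suc j * n) e \<le> C0 * q n e * q (j * n) (\<omega> ^ n * e)"
    using q_submult[OF Suc.prems, of n "j * n"] by simp
  also have "\<dots> \<le> C0 * q n e * (\<Prod>i<j. C0 * q n (\<omega> ^ (n * i) * (\<omega> ^ n * e)))"
    using C0 q_bounds by (intro mult_left_mono IH) auto
  also have "\<dots> = (\<Prod>i<Suc j. C0 * q n (\<omega> ^ (n * i) * e))"
    unfolding prod.lessThan_Suc_shift by (simp add: power_add mult_ac)
  finally show ?case .
qed

text \<open>The geometric mean of the cocycle along an orbit is at most its arithmetic mean, which is of the order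
  of the Riesz energy estimate.\<close>

lemma q_uniform:
  fixes \<epsilon> :: real
  assumes eps: "\<epsilon> > 0"
  shows "\<exists>C>0. \<forall>m e. norm e = 1 \<longrightarrow> q m e \<le> C * \<rho> powr ((1 - \<epsilon>) * m)"
proof -
  obtain C1 where C1: "\<And>n. n > 0 \<Longrightarrow> \<exists>j0. \<forall>j\<ge>j0. \<forall>e. norm e = 1 \<longrightarrow>
     (\<Sum>i<j. q n (\<omega> ^ (n * i) * e)) \<le> C1 * \<rho> ^ n * j"
    using corr_orbit_average unfolding q_def by blast
  have C0: "C0 \<ge> 1" by (rule C0_ge_1[OF Z0])
  \<comment> \<open>One block length n is fixed, so large that
    \<open>\<rho> powr (\<epsilon> * n)\<close> absorbs all constants.\<close>
  have "(\<lambda>n. C0 * C1 * (\<rho> powr \<epsilon>) ^ n) \<longlonglongrightarrow> C0 * C1 * 0"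
    using powr_less_mono2[of \<epsilon> \<rho> 1] mu_less eps by (intro tendsto_intros LIMSEQ_power_zero) auto
  hence "eventually (\<lambda>n. C0 * C1 * (\<rho> powr \<epsilon>) ^ n < 1) sequentially"
    by (rule order_tendstoD) simp
  then obtain n where n: "n > 0" "C0 * C1 * (\<rho> powr \<epsilon>) ^ n < 1"
    unfolding eventually_sequentially by (metis le_Suc_eq less_Suc_eq_0_disj nle_le zero_less_Suc)
  define B where "B = \<rho> powr ((1 - \<epsilon>) * n)"
  have B0: "B > 0" using mu_pos by (simp add: B_def)
  have CB: "C0 * (C1 * \<rho> ^ n) \<le> B"
  proof -
    have "\<rho> ^ n = (\<rho> powr \<epsilon>) ^ n * B"
    proof -
      have "(\<rho> powr \<epsilon>) ^ n = \<rho> powr (\<epsilon> * n)" using mu_pos by (simp add: powr_power mult.commute)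
      moreover have "\<epsilon> * real n + (1 - \<epsilon>) * n = real n" by (simp add: algebra_simps)
      ultimately have "(\<rho> powr \<epsilon>) ^ n * B = \<rho> powr (real n)" by (simp only: B_def powr_add[symmetric])
      thus ?thesis using powr_realpow[OF mu_pos] by simp
    qed
    hence "C0 * (C1 * \<rho> ^ n) = (C0 * C1 * (\<rho> powr \<epsilon>) ^ n) * B" by simp
    also have "\<dots> \<le> 1 * B" using n B0 by (intro mult_right_mono) auto
    finally show ?thesis by simp
  qed
  obtain j0 where j0: "\<And>j e. j \<ge> j0 \<Longrightarrow> norm e = 1 \<Longrightarrow> (\<Sum>i<j. q n (\<omega> ^ (n * i) * e)) \<le> C1 * \<rho> ^ n * j"
    using C1[OF n(1)] by blast
  have blk: "q (j * n) e \<le> B ^ j" if "j \<ge> Suc j0" "norm e = 1" for j e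
  proof -
    have "q (j * n) e \<le> (\<Prod>i<j. C0 * q n (\<omega> ^ (n * i) * e))" by (rule q_iterate[OF that(2)])
    also have "\<dots> \<le> B ^ j"
    proof (rule prod_le_mean_power)
      show "j > 0" using that by simp
      show "0 \<le> C0 * q n (\<omega> ^ (n * i) * e)" for i using C0 q_bounds by simp
      have "(\<Sum>i<j. C0 * q n (\<omega> ^ (n * i) * e)) \<le> C0 * (C1 * \<rho> ^ n * j)"
        unfolding sum_distrib_left[symmetric] using C0 that by (intro mult_left_mono j0) auto
      also have "\<dots> = (C0 * (C1 * \<rho> ^ n)) * j" by simp
      also have "\<dots> \<le> B * j" by (intro mult_right_mono CB) auto
      finally show "(\<Sum>i<j. C0 * q n (\<omega> ^ (n * i) * e)) \<le> B * j" .
    qed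
    finally show ?thesis .
  qed
  \<comment> \<open>The maximum with 0 accounts for \<epsilon> > 1. The constant \<open>Cf\<close>
    absorbs the remainder modulo n and all lengths below the waiting time.\<close>
  define a where "a = max 0 (1 - \<epsilon>)"
  define Cf where "Cf = C0 * \<rho> powr (- a * (real n * (real j0 + 2)))"
  have Cf0: "Cf > 0" using C0 mu_pos by (simp add: Cf_def)
  have "q m e \<le> Cf * \<rho> powr ((1 - \<epsilon>) * m)" if e: "norm e = 1" for m e
  proof -
    have big: "1 \<le> \<rho> powr x" if "x \<le> 0" for x
      using powr_mono'[of x 0 \<rho>] that mu_pos mu_less by simp
    have key: "C0 * \<rho> powr y \<le> Cf * \<rho> powr ((1 - \<epsilon>) * m)" if "(1 - \<epsilon>) * m - a * (real n * (real j0 + 2)) \<le> y" for y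
    proof -
      have "\<rho> powr y \<le> \<rho> powr ((1 - \<epsilon>) * m - a * (real n * (real j0 + 2)))"
        using mu_pos mu_less that by (intro powr_mono') auto
      also have "\<dots> = \<rho> powr (- a * (real n * (real j0 + 2))) * \<rho> powr ((1 - \<epsilon>) * m)"
        by (simp flip: powr_add)
      finally show ?thesis using C0 unfolding Cf_def by (simp add: mult.assoc)
    qed
    have a: "a \<ge> 0" "a \<ge> 1 - \<epsilon>" by (auto simp: a_def)
    define j where "j = m div n"
    have m: "m = j * n + m mod n" "m mod n < n" using n by (auto simp: j_def)
    show ?thesis
    proof (cases "j \<ge> Suc j0")
      case True
      have "q m e \<le> C0 * q (j * n) e * q (m mod n) (\<omega> ^ (j * n) * e)"
        using q_submult[OF e, of "j * n" "m mod n"] m(1) by simp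
      also have "\<dots> \<le> C0 * B ^ j * 1"
        using C0 q_bounds blk[OF True e] B0 by (intro mult_mono) auto
      also have "\<dots> = C0 * \<rho> powr ((1 - \<epsilon>) * (real j * real n))"
        using mu_pos by (simp add: B_def powr_power mult_ac)
      also have "\<dots> \<le> Cf * \<rho> powr ((1 - \<epsilon>) * m)"
      proof (rule key)
        have "real m = real j * real n + real (m mod n)" using m(1) by (metis of_nat_add of_nat_mult)
        hence "(1 - \<epsilon>) * m - (1 - \<epsilon>) * (real j * real n) = (1 - \<epsilon>) * real (m mod n)" by (simp add: algebra_simps)
        also have "\<dots> \<le> a * real (m mod n)" using a by (intro mult_right_mono) auto
        also have "\<dots> \<le> a * (real n * (real j0 + 2))"
        proof (rule mult_left_mono)
          have "real (m mod n) \<le> real n * 1" using m(2) by simp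
          also have "\<dots> \<le> real n * (real j0 + 2)" by (intro mult_left_mono) auto
          finally show "real (m mod n) \<le> real n * (real j0 + 2)" .
        qed (use a in auto)
        finally show "(1 - \<epsilon>) * m - a * (real n * (real j0 + 2)) \<le> (1 - \<epsilon>) * (real j * real n)" by simp
      qed
      finally show ?thesis .
    next
      case False
      have "q m e \<le> C0 * \<rho> powr 0" using q_bounds[of m e] C0 mu_pos by (simp add: order_trans)
      also have "\<dots> \<le> Cf * \<rho> powr ((1 - \<epsilon>) * m)"
      proof (rule key)
        have "(1 - \<epsilon>) * m \<le> a * m" using a by (intro mult_right_mono) auto
        also have "\<dots> \<le> a * (real n * (real j0 + 2))"
        proof (rule mult_left_mono)
          have "m \<le> j0 * n + n" using False m mult_right_mono[of j j0 n] by linarith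
          hence "real m \<le> real (j0 * n + n)" by (simp only: of_nat_le_iff)
          thus "real m \<le> real n * (real j0 + 2)" by (simp add: algebra_simps)
        qed (use a in auto)
        finally show "(1 - \<epsilon>) * m - a * (real n * (real j0 + 2)) \<le> 0" by simp
      qed
      finally show ?thesis .
    qed
  qed
  thus ?thesis using Cf0 by blast
qed

end

section \<open>Pair counts and exponential sums\<close>

lemma norm_sum_cis_sq:
  assumes "finite P"
  shows "(norm (\<Sum>p\<in>P. cis (f p)))\<^sup>2 = (\<Sum>x\<in>P \<times> P. cos (f (fst x) - f (snd x)))"
proof -
  have "complex_of_real ((norm (\<Sum>p\<in>P. cis (f p)))\<^sup>2) = (\<Sum>p\<in>P. cis (f p)) * cnj (\<Sum>p\<in>P. cis (f p))"
    by (rule complex_norm_square)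
  also have "\<dots> = (\<Sum>p\<in>P. cis (f p)) * (\<Sum>q\<in>P. cis (- f q))" by (simp add: cis_cnj)
  also have "\<dots> = (\<Sum>x\<in>P \<times> P. cis (f (fst x) - f (snd x)))"
    by (simp add: sum_product sum.cartesian_product case_prod_beta cis_mult)
  finally have "Re (complex_of_real ((norm (\<Sum>p\<in>P. cis (f p)))\<^sup>2)) = Re (\<Sum>x\<in>P \<times> P. cis (f (fst x) - f (snd x)))"
    by simp
  thus ?thesis by simp
qed

section \<open>The Fejer kernel: pair counts bounded by integrals of exponential sums\<close>

lemma has_integral_fejer:
  fixes x :: real
  assumes "x \<noteq> 0"
  shows "((\<lambda>\<xi>. (1 - \<xi>) * cos (\<xi> * x)) has_integral ((1 - cos x) / x\<^sup>2)) {0..1}"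
proof -
  define F where "F \<xi> = (1 - \<xi>) * sin (\<xi> * x) / x - cos (\<xi> * x) / x\<^sup>2" for \<xi>
  have "((\<lambda>\<xi>. (1 - \<xi>) * cos (\<xi> * x)) has_integral (F 1 - F 0)) {0..1}"
  proof (rule fundamental_theorem_of_calculus)
    fix \<xi> :: real
    have "(F has_real_derivative (1 - \<xi>) * cos (\<xi> * x)) (at \<xi> within {0..1})"
      unfolding F_def using assms
      by (auto intro!: derivative_eq_intros simp: divide_simps power2_eq_square)
    thus "(F has_vector_derivative (1 - \<xi>) * cos (\<xi> * x)) (at \<xi> within {0..1})"
      by (simp add: has_real_derivative_iff_has_vector_derivative)
  qed simp
  moreover have "F 1 - F 0 = (1 - cos x) / x\<^sup>2" by (simp add: F_def diff_divide_distrib)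
  ultimately show ?thesis by simp
qed

lemma fejer_nonneg:
  fixes x :: real
  shows "0 \<le> integral {0..1} (\<lambda>\<xi>. (1 - \<xi>) * cos (\<xi> * x))"
proof (cases "x = 0")
  case True
  have "0 \<le> integral {0..1} (\<lambda>\<xi>::real. 1 - \<xi>)"
    by (rule integral_nonneg) (auto intro!: integrable_continuous_real continuous_intros)
  thus ?thesis using True by simp
next
  case False
  thus ?thesis using has_integral_fejer[OF False] by (simp add: integral_unique)
qed

lemma cos_ge_half: "\<bar>x\<bar> \<le> 1 \<Longrightarrow> cos x \<ge> (1/2::real)"
proof -
  assume x: "\<bar>x\<bar> \<le> 1"
  have p: "pi / 3 \<ge> 1" using pi_gt3 by simp
  have "cos (pi / 3) \<le> cos \<bar>x\<bar>" using x p pi_gt_zero by (intro cos_monotone_0_pi_le) auto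
  thus ?thesis by (simp add: cos_60)
qed

lemma fejer_lower:
  fixes x :: real
  assumes "\<bar>x\<bar> \<le> 1"
  shows "1/4 \<le> integral {0..1} (\<lambda>\<xi>. (1 - \<xi>) * cos (\<xi> * x))"
proof -
  have "((\<lambda>\<xi>::real. (1 - \<xi>) * (1/2)) has_integral ((1 - 1\<^sup>2 / 2) * (1/2) - (0 - 0\<^sup>2 / 2) * (1/2))) {0..1}"
    by (rule fundamental_theorem_of_calculus)
      (auto intro!: derivative_eq_intros simp flip: has_real_derivative_iff_has_vector_derivative)
  hence "((\<lambda>\<xi>::real. (1 - \<xi>) * (1/2)) has_integral (1/4)) {0..1}" by simp
  hence "1/4 = integral {0..1} (\<lambda>\<xi>::real. (1 - \<xi>) * (1/2))" by (rule integral_unique[symmetric])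
  also have "\<dots> \<le> integral {0..1} (\<lambda>\<xi>. (1 - \<xi>) * cos (\<xi> * x))"
  proof (rule integral_le)
    fix \<xi> :: real assume "\<xi> \<in> {0..1}"
    hence "\<bar>\<xi> * x\<bar> \<le> 1 * 1" using assms unfolding abs_mult by (intro mult_mono) auto
    thus "(1 - \<xi>) * (1 / 2) \<le> (1 - \<xi>) * cos (\<xi> * x)"
      using \<open>\<xi> \<in> {0..1}\<close> by (intro mult_left_mono cos_ge_half) auto
  qed (auto intro!: integrable_continuous_real continuous_intros)
  finally show ?thesis .
qed

text \<open>The weight \<open>1 - \<xi>\<close> has a nonnegative cosine transform, so pairs that
  are not close cannot hurt. For close pairs the cosine is at least 1/2, and half the integral of
  the weight is 1/4. At the end the weight is bounded by 1.\<close>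

lemma close_pairs_le_integral:
  assumes P: "finite P"
  shows "real (close_pairs P f 1) \<le> 4 * integral {0..1} (\<lambda>\<xi>. (norm (\<Sum>p\<in>P. cis (\<xi> * f p)))\<^sup>2)"
proof -
  let ?S = "P \<times> P" and ?d = "\<lambda>x. f (fst x) - f (snd x)"
  have fS: "finite ?S" using P by simp
  have sq: "(norm (\<Sum>p\<in>P. cis (\<xi> * f p)))\<^sup>2 = (\<Sum>x\<in>?S. cos (\<xi> * ?d x))" for \<xi>
    using norm_sum_cis_sq[OF P, of "\<lambda>p. \<xi> * f p"] by (simp add: right_diff_distrib)
  have "real (close_pairs P f 1) / 4 = (\<Sum>x\<in>?S. of_bool (\<bar>?d x\<bar> \<le> 1) / 4)"
    using fS by (simp add: close_pairs_def Int_def flip: sum_divide_distrib)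
  also have "\<dots> \<le> (\<Sum>x\<in>?S. integral {0..1} (\<lambda>\<xi>. (1 - \<xi>) * cos (\<xi> * ?d x)))"
  proof (rule sum_mono)
    fix x show "of_bool (\<bar>?d x\<bar> \<le> 1) / 4 \<le> integral {0..1} (\<lambda>\<xi>. (1 - \<xi>) * cos (\<xi> * ?d x))"
      using fejer_lower[of "?d x"] fejer_nonneg[of "?d x"] by (cases "\<bar>?d x\<bar> \<le> 1") auto
  qed
  also have "\<dots> = integral {0..1} (\<lambda>\<xi>. \<Sum>x\<in>?S. (1 - \<xi>) * cos (\<xi> * ?d x))"
    by (rule integral_sum[symmetric]) (use fS in \<open>auto intro!: integrable_continuous_real continuous_intros\<close>)
  also have "\<dots> = integral {0..1} (\<lambda>\<xi>. (1 - \<xi>) * (norm (\<Sum>p\<in>P. cis (\<xi> * f p)))\<^sup>2)"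
    by (simp only: sq sum_distrib_left)
  also have "\<dots> \<le> integral {0..1} (\<lambda>\<xi>. (norm (\<Sum>p\<in>P. cis (\<xi> * f p)))\<^sup>2)"
  proof (rule integral_le)
    fix \<xi> :: real assume "\<xi> \<in> {0..1}"
    hence "(1 - \<xi>) * (norm (\<Sum>p\<in>P. cis (\<xi> * f p)))\<^sup>2 \<le> 1 * (norm (\<Sum>p\<in>P. cis (\<xi> * f p)))\<^sup>2"
      by (intro mult_right_mono) auto
    thus "(1 - \<xi>) * (norm (\<Sum>p\<in>P. cis (\<xi> * f p)))\<^sup>2 \<le> (norm (\<Sum>p\<in>P. cis (\<xi> * f p)))\<^sup>2" by simp
  qed (auto intro!: integrable_continuous_real continuous_intros simp: cis_conv_exp)
  finally show ?thesis by simp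
qed

section \<open>The Gaussian kernel: integrals of exponential sums bounded by pair counts\<close>

lemma integral_cos_std_normal:
  "integrable lborel (\<lambda>x. std_normal_density x * cos (x * t))"
  "(\<integral>x. std_normal_density x * cos (x * t) \<partial>lborel) = exp (- t\<^sup>2 / 2)"
proof -
  interpret real_distribution std_normal_distribution by (rule real_dist_normal_dist)
  have int: "integrable std_normal_distribution (\<lambda>x. cos (x * t))"
    by (rule integrable_const_bound[where B=1]) auto
  have inti: "integrable std_normal_distribution (\<lambda>x. iexp (t * x))"
    by (rule integrable_const_bound[where B=1]) (auto simp: norm_exp_i_times)
  have m: "(\<lambda>x. cos (x * t)) \<in> borel_measurable lborel" by measurable
  have nd: "std_normal_density \<in> borel_measurable lborel" by measurable
  show "integrable lborel (\<lambda>x. std_normal_density x * cos (x * t))"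
    using int by (subst (asm) integrable_density) (auto simp: m nd)
  have "complex_of_real (exp (- t\<^sup>2 / 2)) = (CLINT x|std_normal_distribution. iexp (t * x))"
    using char_std_normal_distribution by (metis char_def)
  hence "exp (- t\<^sup>2 / 2) = Re (CLINT x|std_normal_distribution. iexp (t * x))" by (metis Re_complex_of_real)
  also have "\<dots> = (\<integral>x. Re (iexp (t * x)) \<partial>std_normal_distribution)"
    by (rule integral_Re[OF inti, symmetric])
  also have "\<dots> = (\<integral>x. cos (x * t) \<partial>std_normal_distribution)"
    by (simp add: Re_exp mult.commute)
  also have "\<dots> = (\<integral>x. std_normal_density x * cos (x * t) \<partial>lborel)"
    by (subst integral_density) (auto simp: m nd)
  finally show "(\<integral>x. std_normal_density x * cos (x * t) \<partial>lborel) = exp (- t\<^sup>2 / 2)" by simp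
qed

text \<open>Pairs are sorted by the integer part k of their distance. As k \<le> k^2, the Gaussian
  is at most \<open>b ^ k\<close> with b = exp (-1/2); the differences in one class lie within 1 of
  k or of -k, so \<open>close_pairs_shift\<close> bounds the class by 5 + 5 times the central
  count.\<close>

lemma sum_gaussian_le_close_pairs:
  fixes f :: "'a \<Rightarrow> real"
  assumes P: "finite P"
  shows "(\<Sum>x\<in>P \<times> P. exp (- (f (fst x) - f (snd x))\<^sup>2 / 2)) \<le> 10 / (1 - exp (-1/2)) * close_pairs P f 1"
proof -
  let ?S = "P \<times> P" and ?d = "\<lambda>x. f (fst x) - f (snd x)"
  have fS: "finite ?S" using P by simp
  define K where "K = Max ((\<lambda>x. nat \<lfloor>\<bar>?d x\<bar>\<rfloor>) ` ?S)"
  define b where "b = exp (-1/2::real)"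
  have b: "0 < b" "b < 1" by (auto simp: b_def)
  have "(\<Sum>x\<in>?S. exp (- (?d x)\<^sup>2 / 2)) \<le>
     (\<Sum>x\<in>?S. \<Sum>k\<le>K. b ^ k * (of_bool (\<bar>?d x - real k\<bar> \<le> 1) + of_bool (\<bar>?d x - (- real k)\<bar> \<le> 1)))"
  proof (rule sum_mono)
    fix x assume x: "x \<in> ?S"
    define k where "k = nat \<lfloor>\<bar>?d x\<bar>\<rfloor>"
    have k: "k \<le> K" unfolding k_def K_def using x fS by (intro Max_ge) auto
    have kd: "real k \<le> \<bar>?d x\<bar>" "\<bar>?d x\<bar> \<le> real k + 1" unfolding k_def by linarith+
    have "real k \<le> (real k)\<^sup>2" by (cases k) (auto simp: power2_eq_square)
    also have "\<dots> \<le> (?d x)\<^sup>2" using kd by (simp add: abs_le_square_iff[symmetric])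
    finally have "exp (- (?d x)\<^sup>2 / 2) \<le> exp (real k * (-1/2))" by simp
    also have "\<dots> = b ^ k" by (simp only: b_def exp_of_nat_mult)
    also have "\<dots> * 1 \<le> b ^ k * (of_bool (\<bar>?d x - real k\<bar> \<le> 1) + of_bool (\<bar>?d x - (- real k)\<bar> \<le> 1))"
      using kd b by (intro mult_left_mono) (cases "?d x \<ge> 0", auto)
    also have "\<dots> \<le> (\<Sum>k\<le>K. b ^ k * (of_bool (\<bar>?d x - real k\<bar> \<le> 1) + of_bool (\<bar>?d x - (- real k)\<bar> \<le> 1)))"
      by (rule member_le_sum) (use k b in auto)
    finally show "exp (- (?d x)\<^sup>2 / 2) \<le>
      (\<Sum>k\<le>K. b ^ k * (of_bool (\<bar>?d x - real k\<bar> \<le> 1) + of_bool (\<bar>?d x - (- real k)\<bar> \<le> 1)))" by simp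
  qed
  also have "\<dots> = (\<Sum>k\<le>K. b ^ k * (real (card {x \<in> ?S. \<bar>?d x - real k\<bar> \<le> 1 * 1}) + real (card {x \<in> ?S. \<bar>?d x - (- real k)\<bar> \<le> 1 * 1})))"
    using fS by (subst sum.swap) (simp add: sum.distrib Int_def flip: sum_distrib_left)
  also have "\<dots> \<le> (\<Sum>k\<le>K. b ^ k * ((2 * 1 + 3) * real (close_pairs P f 1) + (2 * 1 + 3) * real (close_pairs P f 1)))"
    using b by (intro sum_mono mult_left_mono add_mono close_pairs_shift[OF P]) simp_all
  also have "\<dots> = 10 * close_pairs P f 1 * (\<Sum>k\<le>K. b ^ k)"
    unfolding sum_distrib_left by (intro sum.cong refl) simp
  also have "\<dots> \<le> 10 * close_pairs P f 1 * (1 / (1 - b))"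
    using b by (intro mult_left_mono) (auto simp: sum_gp0 divide_simps)
  finally show ?thesis by (simp add: b_def)
qed

text \<open>Bound the indicator of the frequency window by a
  Gaussian, whose Fourier transform is again positive and decays fast.\<close>

lemma integral_le_close_pairs:
  "\<exists>C>0. \<forall>(P::'a set) f. finite P \<longrightarrow>
    integral {0..1} (\<lambda>\<xi>. (norm (\<Sum>p\<in>P. cis (\<xi> * f p)))\<^sup>2) \<le> C * real (close_pairs P f 1)"
proof -
  define g where "g = std_normal_density 1"
  have g: "g > 0" by (simp add: g_def normal_density_pos)
  define C where "C = 10 / (1 - exp (-1/2)) / g"
  have "integral {0..1} (\<lambda>\<xi>. (norm (\<Sum>p\<in>P. cis (\<xi> * f p)))\<^sup>2) \<le> C * real (close_pairs P f 1)"
    if P: "finite P" for P :: "'a set" and f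
  proof -
    let ?S = "P \<times> P" and ?d = "\<lambda>x. f (fst x) - f (snd x)"
    let ?h = "\<lambda>\<xi>. (norm (\<Sum>p\<in>P. cis (\<xi> * f p)))\<^sup>2"
    have fS: "finite ?S" using P by simp
    have sq: "?h \<xi> = (\<Sum>x\<in>?S. cos (\<xi> * ?d x))" for \<xi>
      using norm_sum_cis_sq[OF P, of "\<lambda>p. \<xi> * f p"] by (simp add: right_diff_distrib)
    have sq': "std_normal_density \<xi> * ?h \<xi> = (\<Sum>x\<in>?S. std_normal_density \<xi> * cos (\<xi> * ?d x))" for \<xi>
      unfolding sq sum_distrib_left ..
    have int: "integrable lborel (\<lambda>\<xi>. std_normal_density \<xi> * ?h \<xi>)"
      unfolding sq' by (intro Bochner_Integration.integrable_sum integral_cos_std_normal)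
    have val: "(\<integral>\<xi>. std_normal_density \<xi> * ?h \<xi> \<partial>lborel) = (\<Sum>x\<in>?S. exp (- (?d x)\<^sup>2 / 2))"
      unfolding sq' by (subst Bochner_Integration.integral_sum) (simp_all only: integral_cos_std_normal)
    have cont: "continuous_on {0..1} ?h" by (auto intro!: continuous_intros simp: cis_conv_exp)
    have si: "set_integrable lborel {0..1} ?h" by (rule borel_integrable_atLeastAtMost') (rule cont)
    have "g * integral {0..1} ?h = (\<integral>\<xi>. g * (indicator {0..1} \<xi> * ?h \<xi>) \<partial>lborel)"
      using set_borel_integral_eq_integral(2)[OF si] by (simp add: set_lebesgue_integral_def)
    also have "\<dots> \<le> (\<integral>\<xi>. std_normal_density \<xi> * ?h \<xi> \<partial>lborel)"
    proof (rule integral_mono)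
      show "integrable lborel (\<lambda>\<xi>. g * (indicator {0..1} \<xi> * ?h \<xi>))"
        using si by (simp add: set_integrable_def)
      fix \<xi> :: real
      have "g \<le> std_normal_density \<xi>" if "\<xi> \<in> {0..1}"
      proof -
        have "\<xi>\<^sup>2 \<le> 1" using that power_mono[of \<xi> 1 2] by simp
        thus ?thesis unfolding g_def std_normal_density_def by (intro mult_left_mono) auto
      qed
      hence "g * indicator {0..1} \<xi> \<le> std_normal_density \<xi>" by (auto simp: indicator_def normal_density_nonneg)
      hence "g * indicator {0..1} \<xi> * ?h \<xi> \<le> std_normal_density \<xi> * ?h \<xi>" by (intro mult_right_mono) auto
      thus "g * (indicator {0..1} \<xi> * ?h \<xi>) \<le> std_normal_density \<xi> * ?h \<xi>" by (simp add: mult.assoc)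
    qed (rule int)
    also have "\<dots> \<le> 10 / (1 - exp (-1/2)) * close_pairs P f 1"
      unfolding val by (rule sum_gaussian_le_close_pairs[OF P])
    finally show ?thesis using g by (simp add: C_def field_simps)
  qed
  moreover have "C > 0" using g by (simp add: C_def)
  ultimately show ?thesis by blast
qed

section \<open>Correlations of the full system\<close>

context hom_sys
begin

text \<open>Modulus of the Fourier transform, at frequency \<open>z\<close>, of the uniform
  distribution on the points \<open>val \<mu> u\<close>.\<close>

definition char_avg :: "complex set \<Rightarrow> nat \<Rightarrow> complex \<Rightarrow> real" where
  "char_avg Z k z = norm (\<Sum>u\<in>words Z k. cis (inner z (val \<mu> u))) / real (card Z) ^ k"

lemma inner_mu_cnj: "inner z (\<mu> ^ n * v) = inner (cnj \<mu> ^ n * z) v"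
proof -
  have "inner a b = Re (cnj a * b)" for a b :: complex by (simp add: inner_complex_def)
  hence "inner z (\<mu> ^ n * v) = Re (cnj z * (\<mu> ^ n * v))"
    "inner (cnj \<mu> ^ n * z) v = Re (cnj (cnj \<mu> ^ n * z) * v)" by blast+
  thus ?thesis by (simp add: mult_ac)
qed

lemma char_avg_add: "finite Z \<Longrightarrow> char_avg Z (n + k) z = char_avg Z n z * char_avg Z k (cnj \<mu> ^ n * z)"
proof -
  assume fin: "finite Z"
  have "(\<Sum>u\<in>words Z (n + k). cis (inner z (val \<mu> u))) =
      (\<Sum>x\<in>words Z n \<times> words Z k. cis (inner z (val \<mu> (fst x @ snd x))))"
    unfolding words_add by (subst sum.reindex[OF inj_on_append_words]) (simp add: case_prod_beta)
  also have "\<dots> = (\<Sum>x\<in>words Z n \<times> words Z k. cis (inner z (val \<mu> (fst x))) * cis (inner (cnj \<mu> ^ n * z) (val \<mu> (snd x))))"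
    by (intro sum.cong refl) (auto simp: val_append inner_add_right inner_mu_cnj cis_mult dest!: length_words)
  also have "\<dots> = (\<Sum>u\<in>words Z n. cis (inner z (val \<mu> u))) * (\<Sum>u\<in>words Z k. cis (inner (cnj \<mu> ^ n * z) (val \<mu> u)))"
    by (simp add: sum_product sum.cartesian_product case_prod_beta)
  finally show ?thesis by (simp add: char_avg_def norm_mult power_add)
qed

lemma char_avg_nonneg: "char_avg Z k z \<ge> 0" by (simp add: char_avg_def)

lemma char_avg_le_1: "finite Z \<Longrightarrow> Z \<noteq> {} \<Longrightarrow> char_avg Z k z \<le> 1"
proof -
  assume Z: "finite Z" "Z \<noteq> {}"
  have "norm (\<Sum>u\<in>words Z k. cis (inner z (val \<mu> u))) \<le> (\<Sum>u\<in>words Z k. norm (cis (inner z (val \<mu> u))))"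
    by (rule norm_sum)
  also have "\<dots> = real (card Z) ^ k" using Z by (simp add: card_words)
  finally show ?thesis using Z by (simp add: char_avg_def divide_le_eq card_gt_0_iff)
qed

lemma char_avg_antimono: "finite Z \<Longrightarrow> Z \<noteq> {} \<Longrightarrow> char_avg Z (n + k) z \<le> char_avg Z n z"
  using char_avg_add[of Z n k z] char_avg_le_1[of Z k "cnj \<mu> ^ n * z"] char_avg_nonneg[of Z n z] char_avg_nonneg[of Z k]
  by (simp add: mult_left_le)

text \<open>Since 1 + exp (2it) = 2 cos t exp (it), the two-digit factor has a product of cosines as
  Fourier transform, as for Bernoulli convolutions.\<close>

lemma char_avg_pair: "char_avg {0, \<Delta>} k z = (\<Prod>i<k. \<bar>cos (inner (cnj \<mu> ^ i * z) \<Delta> / 2)\<bar>)"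
proof (induction k)
  case (Suc k)
  have "char_avg {0, \<Delta>} 1 y = \<bar>cos (inner y \<Delta> / 2)\<bar>" for y
  proof -
    define t where "t = inner y \<Delta> / 2"
    have "words {0, \<Delta>} (Suc 0) = {[0], [\<Delta>]}" by (auto simp: words_Suc)
    hence "(\<Sum>u\<in>words {0, \<Delta>} (Suc 0). cis (inner y (val \<mu> u))) = 1 + cis (2 * t)"
      using \<Delta> by (simp add: t_def)
    also have "\<dots> = cis t * (cis (- t) + cis t)" by (simp add: distrib_left cis_mult)
    also have "cis (- t) + cis t = of_real (2 * cos t)" by (simp add: complex_eq_iff)
    finally show ?thesis using \<Delta> by (simp add: char_avg_def norm_mult t_def)
  qed
  thus ?case using char_avg_add[of "{0, \<Delta>}" k 1 z] Suc.IH by simp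
qed (simp add: char_avg_def)

lemma norm_sum_pt:
  "norm (\<Sum>p\<in>P Z k. cis (inner z (pt \<mu> p))) = norm (\<Sum>u\<in>words D k. cis (inner z (val \<mu> u))) * norm (\<Sum>w\<in>words Z k. cis (inner z (val \<mu> w)))"
proof -
  have "(\<Sum>p\<in>P Z k. cis (inner z (pt \<mu> p))) = (\<Sum>u\<in>words D k. cis (inner z (val \<mu> u))) * (\<Sum>w\<in>words Z k. cis (inner z (val \<mu> w)))"
    unfolding P_def sum_product sum.cartesian_product
    by (intro sum.cong refl) (auto simp: pt_def inner_add_right cis_mult)
  thus ?thesis by (simp add: norm_mult)
qed

definition arg :: "complex \<Rightarrow> nat \<Rightarrow> real \<Rightarrow> complex" where
  "arg e m \<xi> = of_real (\<xi> / \<rho> ^ m) * e"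

text \<open>L2 mass of the Fourier transform of the convolution over the frequencies up to
  \<open>1 / \<rho> ^ m\<close> in direction \<open>e\<close>, rescaled to the unit interval. It
  majorises the correlations at scale \<open>\<rho> ^ m\<close>.\<close>

definition \<Phi> :: "nat \<Rightarrow> complex \<Rightarrow> real" where
  "\<Phi> m e = integral {0..1} (\<lambda>\<xi>. (char_avg D m (arg e m \<xi>) * char_avg {0, \<Delta>} m (arg e m \<xi>))\<^sup>2)"

lemma inner_arg: "inner (arg e m \<xi>) v = \<xi> * (inner e v / \<rho> ^ m)"
proof -
  have "arg e m \<xi> = (\<xi> / \<rho> ^ m) *\<^sub>R e" by (simp add: arg_def scaleR_conv_of_real)
  thus ?thesis by simp
qed

lemma close_pairs_scale:
  "h > 0 \<Longrightarrow> close_pairs A (\<lambda>p. f p / h) 1 = close_pairs A f h"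
  unfolding close_pairs_def
  by (intro arg_cong[where f=card]) (simp add: abs_divide divide_le_eq flip: diff_divide_distrib)

lemma corr_le_Phi: "corr {0, \<Delta>} m e \<le> 4 * N {0, \<Delta>} ^ (2 * m) * \<Phi> m e"
proof -
  have r: "\<rho> ^ m > 0" using mu_pos by simp
  have N0: "N {0, \<Delta>} > 0" using N_pos[OF Z2] .
  let ?f = "\<lambda>p. inner e (pt \<mu> p) / \<rho> ^ m"
  have "corr {0, \<Delta>} m e = real (close_pairs (P {0, \<Delta>} m) ?f 1)"
    unfolding corr_def[OF Z2] close_pairs_scale[OF r] ..
  also have "\<dots> \<le> 4 * integral {0..1} (\<lambda>\<xi>. (norm (\<Sum>p\<in>P {0, \<Delta>} m. cis (\<xi> * ?f p)))\<^sup>2)"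
    by (rule close_pairs_le_integral[OF finP[OF Z2]])
  also have "(\<lambda>\<xi>. (norm (\<Sum>p\<in>P {0, \<Delta>} m. cis (\<xi> * ?f p)))\<^sup>2) = (\<lambda>\<xi>. N {0, \<Delta>} ^ (2 * m) * (char_avg D m (arg e m \<xi>) * char_avg {0, \<Delta>} m (arg e m \<xi>))\<^sup>2)"
  proof
    fix \<xi>
    have "norm (\<Sum>p\<in>P {0, \<Delta>} m. cis (\<xi> * ?f p)) = N {0, \<Delta>} ^ m * (char_avg D m (arg e m \<xi>) * char_avg {0, \<Delta>} m (arg e m \<xi>))"
      using norm_sum_pt[of "arg e m \<xi>" "{0, \<Delta>}" m] N0 card_D \<Delta>
      by (simp add: inner_arg char_avg_def N_def power_mult_distrib)
    thus "(norm (\<Sum>p\<in>P {0, \<Delta>} m. cis (\<xi> * ?f p)))\<^sup>2 = N {0, \<Delta>} ^ (2 * m) * (char_avg D m (arg e m \<xi>) * char_avg {0, \<Delta>} m (arg e m \<xi>))\<^sup>2"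
      by (simp only: power_mult_distrib power_mult[symmetric] mult.commute[of m 2])
  qed
  finally show ?thesis by (simp add: \<Phi>_def)
qed

lemma char_avg_cont: "continuous_on A (\<lambda>\<xi>. char_avg Z k (arg e m \<xi>))"
  unfolding char_avg_def inner_arg cis_conv_exp divide_inverse by (intro continuous_intros)

text \<open>The Gaussian inequality for the \<open>D\<close>-factor alone: the words over
  \<open>{0}\<close> contribute a factor of modulus 1, so a bound on \<open>q\<close> becomes an L2
  bound on the Fourier transform.\<close>

lemma integral_char_avg_le_q:
  "\<exists>C>0. \<forall>k e. integral {0..1} (\<lambda>\<xi>. (char_avg D k (arg e k \<xi>))\<^sup>2) \<le> C * q k e"
proof -
  obtain C where C: "C > 0" "\<And>(A::(complex list \<times> complex list) set) f. finite A \<Longrightarrow>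
    integral {0..1} (\<lambda>\<xi>. (norm (\<Sum>p\<in>A. cis (\<xi> * f p)))\<^sup>2) \<le> C * real (close_pairs A f 1)"
    using integral_le_close_pairs by blast
  have "integral {0..1} (\<lambda>\<xi>. (char_avg D k (arg e k \<xi>))\<^sup>2) \<le> C * q k e" for k e
  proof -
    have r: "\<rho> ^ k > 0" using mu_pos by simp
    have N0: "N {0} > 0" using N_pos[OF Z0] .
    let ?f = "\<lambda>p. inner e (pt \<mu> p) / \<rho> ^ k"
    have w: "norm (\<Sum>w\<in>words {0} k. cis (inner z (val \<mu> w))) = 1" for z
    proof -
      have "words {0::complex} k = {replicate k 0}" by (induction k) (auto simp: words_Suc)
      moreover have "val \<mu> (replicate k 0) = 0" by (induction k) auto
      ultimately show ?thesis by simp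
    qed
    have nn: "norm (\<Sum>p\<in>P {0} k. cis (inner z (pt \<mu> p))) = norm (\<Sum>u\<in>words D k. cis (inner z (val \<mu> u)))" for z
      by (simp add: norm_sum_pt w)
    have "(char_avg D k (arg e k \<xi>))\<^sup>2 = (norm (\<Sum>p\<in>P {0} k. cis (\<xi> * ?f p)))\<^sup>2 / N {0} ^ (2 * k)" for \<xi>
      using nn[of "arg e k \<xi>"]
      by (simp add: inner_arg char_avg_def N_def power_divide mult.commute[of 2 k] power_mult)
    hence "integral {0..1} (\<lambda>\<xi>. (char_avg D k (arg e k \<xi>))\<^sup>2) = integral {0..1} (\<lambda>\<xi>. (norm (\<Sum>p\<in>P {0} k. cis (\<xi> * ?f p)))\<^sup>2) / N {0} ^ (2 * k)"
      by simp
    also have "\<dots> \<le> C * real (close_pairs (P {0} k) ?f 1) / N {0} ^ (2 * k)"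
      using N0 by (intro divide_right_mono C(2) finP[OF Z0]) auto
    also have "\<dots> = C * q k e"
      unfolding close_pairs_scale[OF r] by (simp add: corr_def[OF Z0] q_def)
    finally show ?thesis .
  qed
  thus ?thesis using C(1) by blast
qed

lemma Phi_0: "\<Phi> 0 e \<le> 1"
proof -
  have "\<Phi> 0 e \<le> integral {0..1} (\<lambda>\<xi>::real. 1)"
    unfolding \<Phi>_def
    by (rule integral_le) (auto intro!: integrable_continuous_real continuous_intros char_avg_cont simp: char_avg_def)
  thus ?thesis by simp
qed

text \<open>Splitting the frequencies at \<open>\<rho>\<close> gives a recursion: the low frequencies rescale to the previous
  level, and on the top annulus the Erdos--Kahane factor can be estimated uniformly.\<close>

lemma Phi_Suc:
  assumes C: "\<And>k e. integral {0..1} (\<lambda>\<xi>. (char_avg D k (arg e k \<xi>))\<^sup>2) \<le> C * q k e"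
    and V: "\<And>\<xi>. \<rho> \<le> \<xi> \<Longrightarrow> \<xi> \<le> 1 \<Longrightarrow> (char_avg {0, \<Delta>} (Suc m) (arg e (Suc m) \<xi>))\<^sup>2 \<le> V"
  shows "\<Phi> (Suc m) e \<le> \<rho> * \<Phi> m e + V * (C * q (Suc m) e)"
proof -
  let ?F = "\<lambda>m \<xi>. (char_avg D m (arg e m \<xi>) * char_avg {0, \<Delta>} m (arg e m \<xi>))\<^sup>2"
  have cF: "continuous_on A (?F k)" for A k by (intro continuous_intros char_avg_cont)
  have V0: "V \<ge> 0" using V[of 1] mu_less by (meson less_imp_le order_trans order_refl zero_le_power2)
  have nD: "D \<noteq> {}" using card_D by auto
  have "\<Phi> (Suc m) e = integral {0..\<rho>} (?F (Suc m)) + integral {\<rho>..1} (?F (Suc m))"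
    unfolding \<Phi>_def using mu_pos mu_less
    by (intro Henstock_Kurzweil_Integration.integral_combine[symmetric] integrable_continuous_real cF) auto
  also have "integral {0..\<rho>} (?F (Suc m)) \<le> integral {0..\<rho>} (\<lambda>\<xi>. ?F m (\<xi> / \<rho>))"
  proof (rule integral_le)
    fix \<xi> :: real
    \<comment> \<open>The frequency is the same after rescaling, and the additional letter can only
      decrease the averages.\<close>
    have a: "arg e (Suc m) \<xi> = arg e m (\<xi> / \<rho>)" by (simp add: arg_def mult.commute)
    have "char_avg D (Suc m) (arg e (Suc m) \<xi>) * char_avg {0, \<Delta>} (Suc m) (arg e (Suc m) \<xi>) \<le> char_avg D m (arg e m (\<xi> / \<rho>)) * char_avg {0, \<Delta>} m (arg e m (\<xi> / \<rho>))"
      unfolding a using char_avg_antimono[of D m 1] char_avg_antimono[of "{0, \<Delta>}" m 1] finD nD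
      by (intro mult_mono char_avg_nonneg) auto
    thus "?F (Suc m) \<xi> \<le> ?F m (\<xi> / \<rho>)" by (intro power_mono mult_nonneg_nonneg char_avg_nonneg)
  next
    have "continuous_on {0..\<rho>} (?F m \<circ> (\<lambda>\<xi>. \<xi> / \<rho>))"
      using mu_pos by (intro continuous_on_compose cF continuous_intros) auto
    thus "(\<lambda>\<xi>. ?F m (\<xi> / \<rho>)) integrable_on {0..\<rho>}"
      by (intro integrable_continuous_real) (simp add: o_def)
  qed (intro integrable_continuous_real cF)
  also have "integral {0..\<rho>} (\<lambda>\<xi>. ?F m (\<xi> / \<rho>)) = \<rho> * \<Phi> m e"
  proof -
    have "(?F m has_integral \<Phi> m e) {0..1}"
      unfolding \<Phi>_def by (intro integrable_integral integrable_continuous_real cF)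
    from has_integral_stretch_real[OF this, of "1 / \<rho>"] mu_pos
    have "((\<lambda>\<xi>. ?F m (\<xi> / \<rho>)) has_integral (\<rho> * \<Phi> m e)) ((\<lambda>x. x * \<rho>) ` {0..1})" by simp
    moreover have "(\<lambda>x. x * \<rho>) ` {0..1} = {0..\<rho>}"
      using image_mult_atLeastAtMost[of \<rho> 0 1] mu_pos by (simp add: mult.commute)
    ultimately show ?thesis by (simp add: integral_unique)
  qed
  also have "integral {\<rho>..1} (?F (Suc m)) \<le> integral {\<rho>..1} (\<lambda>\<xi>. V * (char_avg D (Suc m) (arg e (Suc m) \<xi>))\<^sup>2)"
  proof (rule integral_le)
    fix \<xi> assume "\<xi> \<in> {\<rho>..1}"
    hence "(char_avg {0, \<Delta>} (Suc m) (arg e (Suc m) \<xi>))\<^sup>2 * (char_avg D (Suc m) (arg e (Suc m) \<xi>))\<^sup>2 \<le> V * (char_avg D (Suc m) (arg e (Suc m) \<xi>))\<^sup>2"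
      by (intro mult_right_mono V) auto
    thus "?F (Suc m) \<xi> \<le> V * (char_avg D (Suc m) (arg e (Suc m) \<xi>))\<^sup>2" by (simp add: power_mult_distrib mult.commute)
  qed (intro integrable_continuous_real cF continuous_intros char_avg_cont)+
  also have "\<dots> \<le> integral {0..1} (\<lambda>\<xi>. V * (char_avg D (Suc m) (arg e (Suc m) \<xi>))\<^sup>2)"
    using mu_pos V0 by (intro integral_subset_le integrable_continuous_real continuous_intros char_avg_cont) auto
  also have "\<dots> = V * integral {0..1} (\<lambda>\<xi>. (char_avg D (Suc m) (arg e (Suc m) \<xi>))\<^sup>2)" by simp
  also have "\<dots> \<le> V * (C * q (Suc m) e)" by (intro mult_left_mono C V0)
  finally show ?thesis by simp
qed

text \<open>The recursion divided by \<open>\<rho> ^ m\<close> and unrolled: every annulus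
  contributes one summand. The optimal order \<open>\<rho> ^ m\<close> follows once the sum stays
  bounded, that is, once the decay \<open>V\<close> beats the loss in the bound for
  \<open>q\<close>.\<close>

lemma Phi_bound:
  "\<exists>C>0. \<forall>e V m. (\<forall>k<m. \<forall>\<xi>\<in>{\<rho>..1}. (char_avg {0, \<Delta>} (Suc k) (arg e (Suc k) \<xi>))\<^sup>2 \<le> V (Suc k)) \<longrightarrow>
     \<Phi> m e \<le> \<rho> ^ m * (1 + C * (\<Sum>k<m. V (Suc k) * q (Suc k) e / \<rho> ^ Suc k))"
proof -
  obtain C where C: "C > 0" "\<And>k e. integral {0..1} (\<lambda>\<xi>. (char_avg D k (arg e k \<xi>))\<^sup>2) \<le> C * q k e"
    using integral_char_avg_le_q by blast
  have "\<Phi> m e \<le> \<rho> ^ m * (1 + C * (\<Sum>k<m. V (Suc k) * q (Suc k) e / \<rho> ^ Suc k))"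
    if "\<And>k \<xi>. k < m \<Longrightarrow> \<rho> \<le> \<xi> \<Longrightarrow> \<xi> \<le> 1 \<Longrightarrow> (char_avg {0, \<Delta>} (Suc k) (arg e (Suc k) \<xi>))\<^sup>2 \<le> V (Suc k)" for e V m
    using that
  proof (induction m)
    case 0
    show ?case using Phi_0 by simp
  next
    case (Suc m)
    have rp: "\<rho> ^ Suc m > 0" using mu_pos by (rule zero_less_power)
    have "\<Phi> (Suc m) e \<le> \<rho> * \<Phi> m e + V (Suc m) * (C * q (Suc m) e)"
      by (rule Phi_Suc[OF C(2)]) (use Suc.prems in auto)
    also have "\<dots> \<le> \<rho> * (\<rho> ^ m * (1 + C * (\<Sum>k<m. V (Suc k) * q (Suc k) e / \<rho> ^ Suc k))) + V (Suc m) * (C * q (Suc m) e)"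
      using Suc.prems by (intro add_right_mono mult_left_mono Suc.IH) auto
    also have "\<dots> = \<rho> ^ Suc m * (1 + C * (\<Sum>k<m. V (Suc k) * q (Suc k) e / \<rho> ^ Suc k)) + \<rho> ^ Suc m * (C * (V (Suc m) * q (Suc m) e / \<rho> ^ Suc m))"
    proof -
      have h: "\<rho> ^ Suc m * (C * (v / \<rho> ^ Suc m)) = C * v" for v using mu_pos by simp
      show ?thesis unfolding h by (simp add: mult_ac)
    qed
    also have "\<dots> = \<rho> ^ Suc m * (1 + C * (\<Sum>k<Suc m. V (Suc k) * q (Suc k) e / \<rho> ^ Suc k))"
      by (simp only: sum.lessThan_Suc distrib_left add.assoc)
    finally show ?case .
  qed
  thus ?thesis using C(1) by (intro exI[of _ C]) auto
qed

end

section \<open>The Erdos--Kahane exceptional set\<close>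

text \<open>Exponential moments: weighting a word by \<open>x\<close> to the number of its nonzero
  letters gives the total weight \<open>(1 + 2 * B * x) ^ n\<close>, and each word that is counted
  weighs at least \<open>x powr d\<close>.\<close>

lemma card_sparse_words:
  fixes x d :: real and B :: nat
  assumes x: "0 < x" "x \<le> 1"
  shows "real (card {l \<in> words {- int B..int B} n. real (length (filter (\<lambda>a. a \<noteq> 0) l)) \<le> d})
     \<le> x powr (- d) * (1 + 2 * B * x) ^ n"
proof -
  let ?A = "{- int B..int B}" and ?c = "\<lambda>l::int list. length (filter (\<lambda>a. a \<noteq> 0) l)"
  have gen: "(\<Sum>l\<in>words ?A n. x ^ ?c l) = (1 + 2 * B * x) ^ n" for n
  proof (induction n)
    case (Suc n)
    have "(\<Sum>l\<in>words ?A (Suc n). x ^ ?c l) = (\<Sum>a\<in>?A. \<Sum>l\<in>words ?A n. (if a = 0 then 1 else x) * x ^ ?c l)"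
      unfolding sum_words_Suc by (intro sum.cong refl) simp
    also have "\<dots> = (\<Sum>a\<in>?A. if a = 0 then 1 else x) * (1 + 2 * B * x) ^ n"
      by (simp add: Suc.IH sum_product[symmetric] flip: sum_distrib_left sum_distrib_right)
    also have "(\<Sum>a\<in>?A. if a = 0 then 1 else x) = 1 + 2 * B * x"
      by (subst sum.remove[of _ 0]) (auto simp: card_Diff_singleton_if)
    finally show ?case by simp
  qed simp
  let ?S = "{l \<in> words ?A n. real (?c l) \<le> d}"
  have "real (card ?S) * x powr d = (\<Sum>l\<in>?S. x powr d)" by simp
  also have "\<dots> \<le> (\<Sum>l\<in>?S. x ^ ?c l)"
  proof (rule sum_mono)
    fix l assume "l \<in> ?S"
    hence "x powr d \<le> x powr real (?c l)" using x by (intro powr_mono') auto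
    thus "x powr d \<le> x ^ ?c l" using x by (simp add: powr_realpow)
  qed
  also have "\<dots> \<le> (\<Sum>l\<in>words ?A n. x ^ ?c l)" using x by (intro sum_mono2) auto
  finally show ?thesis using x by (simp add: gen powr_minus field_simps)
qed

text \<open>sin t = 2 sin (t/2) cos (t/2), and by the mean value theorem sin (t/2) is t/2 times
  another cosine; both cosines are at least sqrt 2 / 2, so their product is at least 1/2.\<close>

lemma abs_sin_ge:
  fixes t :: real
  assumes "\<bar>t\<bar> \<le> pi / 2"
  shows "\<bar>t\<bar> / 2 \<le> \<bar>sin t\<bar>"
proof -
  have main: "t / 2 \<le> sin t" if t: "0 < t" "t \<le> pi / 2" for t :: real
  proof -
    have "\<exists>z. 0 < z \<and> z < t / 2 \<and> sin (t / 2) - sin 0 = (t / 2 - 0) * cos z"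
      using t by (intro MVT2) (auto intro!: derivative_eq_intros)
    then obtain z where z: "0 < z" "z < t / 2" "sin (t / 2) = t / 2 * cos z" by auto
    have c: "sqrt 2 / 2 \<le> cos y" if "0 \<le> y" "y \<le> t / 2" for y
    proof -
      have "cos (pi / 4) \<le> cos y" using that t by (intro cos_monotone_0_pi_le) auto
      thus ?thesis by (simp add: cos_45)
    qed
    have cz: "0 \<le> cos z" by (rule order_trans[OF _ c]) (use z in auto)
    have "t / 2 = t * (sqrt 2 / 2 * (sqrt 2 / 2))" by simp
    also have "\<dots> \<le> t * (cos z * cos (t / 2))"
      using t z c[of z] c[of "t / 2"] cz by (intro mult_left_mono mult_mono) auto
    also have "\<dots> = 2 * sin (t / 2) * cos (t / 2)" using z by simp
    also have "\<dots> = sin t" using sin_double[of "t / 2"] by simp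
    finally show ?thesis .
  qed
  show ?thesis using main[of t] main[of "- t"] assms by (cases "t = 0"; cases "t > 0") auto
qed

lemma cis_dist_ge:
  assumes "\<beta> \<in> {0..<pi}" "\<beta>' \<in> {0..<pi}"
  shows "\<bar>\<beta> - \<beta>'\<bar> \<le> 2 * norm (cis \<beta> - cis \<beta>')"
proof -
  define t where "t = (\<beta> - \<beta>') / 2"
  define u where "u = (\<beta> + \<beta>') / 2"
  have "cis \<beta> - cis \<beta>' = cis u * (cis t - cis (- t))"
    by (simp add: right_diff_distrib cis_mult t_def u_def field_simps)
  also have "cis t - cis (- t) = 2 * \<i> * of_real (sin t)" by (simp add: complex_eq_iff)
  finally have "norm (cis \<beta> - cis \<beta>') = 2 * \<bar>sin t\<bar>" by (simp add: norm_mult)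
  moreover have "\<bar>t\<bar> \<le> pi / 2" using assms by (auto simp: t_def abs_le_iff)
  ultimately show ?thesis using abs_sin_ge[of t] by (simp add: t_def)
qed

lemma round_err: "\<bar>of_int (round y) - (y::real)\<bar> \<le> 1/2"
  using of_int_round_ge[of y] of_int_round_le[of y] by linarith

text \<open>Erdos--Kahane: for a sequence satisfying a second order linear recurrence, the nearest integers
  determine each other except next to a term that is far from the integers.\<close>

lemma recurrence_round_sparse:
  fixes y :: "nat \<Rightarrow> real" and a b :: real and c0 :: real
  assumes rec: "\<And>k. y (k + 2) = a * y (k + 1) - b * y k"
    and A: "1 + \<bar>a\<bar> + \<bar>b\<bar> \<le> A" and c0: "c0 * A < 1/2" "c0 > 0"
    and dev: "\<And>k. dev k = round (y (k + 2)) - round (a * of_int (round (y (k + 1))) - b * of_int (round (y k)))"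
  shows "\<bar>dev k\<bar> \<le> \<lceil>A\<rceil>"
    and "card {k. k < M - 2 \<and> dev k \<noteq> 0} \<le> 3 * card {k. k < M \<and> c0 \<le> \<bar>of_int (round (y k)) - y k\<bar>}"
proof -
  define er where "er k = of_int (round (y k)) - y k" for k
  have bound: "\<bar>of_int (round (y (k + 2))) - (a * of_int (round (y (k + 1))) - b * of_int (round (y k)))\<bar> \<le> A * c"
    if "\<bar>er k\<bar> \<le> c" "\<bar>er (k + 1)\<bar> \<le> c" "\<bar>er (k + 2)\<bar> \<le> c" for k c
  proof -
    have "of_int (round (y (k + 2))) - (a * of_int (round (y (k + 1))) - b * of_int (round (y k)))
      = er (k + 2) - a * er (k + 1) + b * er k"
      unfolding er_def using rec[of k] by (simp add: algebra_simps)
    also have "\<bar>\<dots>\<bar> \<le> \<bar>er (k + 2)\<bar> + \<bar>a\<bar> * \<bar>er (k + 1)\<bar> + \<bar>b\<bar> * \<bar>er k\<bar>"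
      unfolding abs_mult[symmetric] by linarith
    also have "\<dots> \<le> 1 * c + \<bar>a\<bar> * c + \<bar>b\<bar> * c"
      using that by (intro add_mono mult_left_mono) auto
    also have "\<dots> = (1 + \<bar>a\<bar> + \<bar>b\<bar>) * c" by (simp add: algebra_simps)
    also have "\<dots> \<le> A * c" using A that by (intro mult_right_mono) auto
    finally show ?thesis .
  qed
  have er: "\<bar>er k\<bar> \<le> 1/2" for k unfolding er_def by (rule round_err)
  have A1: "A \<ge> 1" using A by linarith
  show "\<bar>dev k\<bar> \<le> \<lceil>A\<rceil>"
  proof -
    have "\<bar>real_of_int (dev k)\<bar> \<le> A * (1/2) + 1/2"
      unfolding dev of_int_diff using bound[OF er er er, of k]
        round_err[of "a * of_int (round (y (k + 1))) - b * of_int (round (y k))"] by linarith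
    hence "\<bar>real_of_int (dev k)\<bar> \<le> of_int \<lceil>A\<rceil>" using A1 by linarith
    thus ?thesis by linarith
  qed
  define F where "F = {k. k < M \<and> c0 \<le> \<bar>of_int (round (y k)) - y k\<bar>}"
  have fF: "finite F" by (simp add: F_def)
  \<comment> \<open>\<open>dev k\<close> involves the terms k, k + 1 and k + 2, so one far term
    spoils at most three deviations; k < M - 2 keeps all three indices below M.\<close>
  have "{k. k < M - 2 \<and> dev k \<noteq> 0} \<subseteq> F \<union> (\<lambda>k. k - 1) ` F \<union> (\<lambda>k. k - 2) ` F"
  proof
    fix k assume k: "k \<in> {k. k < M - 2 \<and> dev k \<noteq> 0}"
    have "\<not> (\<bar>er k\<bar> \<le> c0 \<and> \<bar>er (k + 1)\<bar> \<le> c0 \<and> \<bar>er (k + 2)\<bar> \<le> c0)"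
    proof
      assume "\<bar>er k\<bar> \<le> c0 \<and> \<bar>er (k + 1)\<bar> \<le> c0 \<and> \<bar>er (k + 2)\<bar> \<le> c0"
      hence "\<bar>of_int (round (y (k + 2))) - (a * of_int (round (y (k + 1))) - b * of_int (round (y k)))\<bar> < 1/2"
        using bound[of k c0] c0 by (simp add: mult.commute)
      hence "round (a * of_int (round (y (k + 1))) - b * of_int (round (y k))) = round (y (k + 2))"
        by (intro round_unique') linarith
      thus False using k dev[of k] by simp
    qed
    hence "k \<in> F \<or> k + 1 \<in> F \<or> k + 2 \<in> F" using k unfolding F_def er_def by auto
    thus "k \<in> F \<union> (\<lambda>k. k - 1) ` F \<union> (\<lambda>k. k - 2) ` F" by (force simp: image_iff)
  qed
  hence "card {k. k < M - 2 \<and> dev k \<noteq> 0} \<le> card (F \<union> (\<lambda>k. k - 1) ` F \<union> (\<lambda>k. k - 2) ` F)"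
    using fF by (intro card_mono) auto
  also have "\<dots> \<le> card F + card ((\<lambda>k. k - 1) ` F) + card ((\<lambda>k. k - 2) ` F)"
    by (meson card_Un_le add_right_mono order_trans)
  also have "\<dots> \<le> card F + card F + card F" using fF by (intro add_mono card_image_le) auto
  finally show "card {k. k < M - 2 \<and> dev k \<noteq> 0} \<le> 3 * card {k. k < M \<and> c0 \<le> \<bar>of_int (round (y k)) - y k\<bar>}"
    by (simp add: F_def)
qed

lemma rounded_recurrence_determined:
  fixes n n' :: "nat \<Rightarrow> int" and g :: "int \<Rightarrow> int \<Rightarrow> int"
  assumes "n 0 = n' 0" "n 1 = n' 1"
    and "\<And>k. k + 2 < M \<Longrightarrow> n (k + 2) - g (n (k + 1)) (n k) = n' (k + 2) - g (n' (k + 1)) (n' k)"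
    and "k < M"
  shows "n k = n' k"
  using assms(4)
proof (induction k rule: less_induct)
  case (less k)
  show ?case
  proof (cases "k < 2")
    case True thus ?thesis using assms(1,2) by (cases k) (auto simp: less_2_cases_iff)
  next
    case False
    then obtain j where j: "k = j + 2" by (metis add.commute le_Suc_ex not_less)
    have "n (j + 1) = n' (j + 1)" "n j = n' j" using less j by auto
    thus ?thesis using assms(3)[of j] less.prems j by simp
  qed
qed

context hom_sys
begin

text \<open>The coefficients of the recurrence below, with the leading 1, have absolute values
  summing to at most (1 + 1 / \<rho>)^2. Multiplied by this sum, \<open>c0\<close> stays at most
  1/4, safely under the 1/2 at which rounding becomes ambiguous.\<close>

definition c0 :: real where "c0 = 1 / (4 * (1 + 1 / \<rho>)\<^sup>2)"

lemma c0_pos: "c0 > 0"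
proof -
  have "1 + 1 / \<rho> > 0" by (intro add_pos_nonneg) auto
  thus ?thesis unfolding c0_def by (intro divide_pos_pos mult_pos_pos zero_less_power) auto
qed

text \<open>The i-th cosine in the Fourier transform of the two-digit factor, at frequency
  \<open>x / \<rho> ^ M\<close> in direction \<beta>, is the cosine of pi times this number; it is
  bounded away from 1 in modulus when the number is far from the integers.\<close>

definition ang :: "real \<Rightarrow> nat \<Rightarrow> nat \<Rightarrow> real \<Rightarrow> real" where
  "ang \<beta> M i x = inner (of_real (x * \<rho> ^ i / \<rho> ^ M) * (\<omega> ^ i * cis \<beta>)) \<Delta> / (2 * pi)"

definition far :: "real \<Rightarrow> bool" where "far t \<longleftrightarrow> c0 \<le> \<bar>of_int (round t) - t\<bar>"

text \<open>For \<delta> > 0 this means power decay of the Fourier transform of the two-digit factor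
  in direction \<beta>: at all large frequencies a fixed proportion of the cosines is bounded away
  from 1. The interval of \<open>x\<close> is one multiplicative period of frequencies.\<close>

definition good :: "real \<Rightarrow> real \<Rightarrow> bool" where
  "good \<delta> \<beta> \<longleftrightarrow> (\<exists>M0. \<forall>M\<ge>M0. \<forall>x\<in>{\<rho>..1}. \<delta> * M \<le> real (card {i. i < M \<and> far (ang \<beta> M i x)}))"

definition start_point :: "real \<Rightarrow> nat \<Rightarrow> real \<Rightarrow> complex" where
  "start_point \<beta> M x = of_real x * cnj (\<omega> ^ M * cis \<beta>) * \<Delta> / of_real (2 * pi)"

text \<open>The angles in reversed order. Read from index M - 1 downwards they are real parts of an
  orbit expanding by 1 / \<mu>, so knowing the last ones up to a bounded error determines the start
  point up to an error of order \<open>\<rho> ^ M\<close>.\<close>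

definition orbit_coord :: "real \<Rightarrow> nat \<Rightarrow> real \<Rightarrow> nat \<Rightarrow> real" where
  "orbit_coord \<beta> M x k = Re ((1 / \<mu>) ^ Suc k * start_point \<beta> M x)"

lemma mu_ne: "\<mu> \<noteq> 0" using mu_pos by auto

lemma ang_eq_orbit_coord:
  assumes "k < M"
  shows "ang \<beta> M (M - Suc k) x = orbit_coord \<beta> M x k"
proof -
  define i where "i = M - Suc k"
  have M: "M = i + Suc k" using assms by (simp add: i_def)
  have i: "inner a b = Re (cnj a * b)" for a b :: complex by (simp add: inner_complex_def)
  have mu: "\<mu> = of_real \<rho> * cnj \<omega>" using mu_pos by (simp add: \<omega>_def)
  have w: "cnj \<omega> \<noteq> 0" using norm_omega by (metis complex_cnj_zero_iff norm_zero zero_neq_one)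
  have r: "\<rho> \<noteq> 0" using mu_pos by simp
  have "cnj (of_real (x * \<rho> ^ i / \<rho> ^ M) * (\<omega> ^ i * cis \<beta>)) * \<Delta> = of_real (2 * pi) * ((1 / \<mu>) ^ Suc k * start_point \<beta> M x)"
  proof -
    have "of_real (x * \<rho> ^ i / \<rho> ^ M) = (of_real x / of_real \<rho> ^ Suc k :: complex)"
    proof -
      have "x * \<rho> ^ i / \<rho> ^ M = x / \<rho> ^ Suc k" using mu_ne by (simp add: M power_add)
      thus ?thesis by (simp only: of_real_divide of_real_power)
    qed
    moreover have "(1 / \<mu>) ^ Suc k * cnj \<omega> ^ M = cnj \<omega> ^ i / of_real \<rho> ^ Suc k"
    proof -
      have "cnj \<omega> ^ M = cnj \<omega> ^ i * cnj \<omega> ^ Suc k" by (simp only: M power_add)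
      moreover have "(1 / \<mu>) ^ Suc k = 1 / (of_real \<rho> ^ Suc k * cnj \<omega> ^ Suc k)"
        by (subst mu) (simp only: power_divide power_one power_mult_distrib)
      ultimately show ?thesis using w r by (simp del: power_Suc)
    qed
    moreover have "of_real (2 * pi) * ((1 / \<mu>) ^ Suc k * start_point \<beta> M x) = of_real x * ((1 / \<mu>) ^ Suc k * cnj \<omega> ^ M) * cnj (cis \<beta>) * \<Delta>"
      by (simp add: start_point_def del: power_Suc)
    ultimately show ?thesis by simp
  qed
  hence "inner (of_real (x * \<rho> ^ i / \<rho> ^ M) * (\<omega> ^ i * cis \<beta>)) \<Delta> = 2 * pi * Re ((1 / \<mu>) ^ Suc k * start_point \<beta> M x)"
    unfolding i by (simp only: Re_complex_of_real Im_complex_of_real times_complex.sel mult_zero_left diff_zero)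
  thus ?thesis by (simp add: ang_def orbit_coord_def i_def[symmetric])
qed

lemma card_far: "card {i. i < M \<and> far (ang \<beta> M i x)} = card {k. k < M \<and> far (orbit_coord \<beta> M x k)}"
proof (rule bij_betw_same_card[of "\<lambda>i. M - Suc i"])
  show "bij_betw (\<lambda>i. M - Suc i) {i. i < M \<and> far (ang \<beta> M i x)} {k. k < M \<and> far (orbit_coord \<beta> M x k)}"
  proof (rule bij_betw_byWitness[where f'="\<lambda>i. M - Suc i"])
    show "(\<lambda>i. M - Suc i) ` {i. i < M \<and> far (ang \<beta> M i x)} \<subseteq> {k. k < M \<and> far (orbit_coord \<beta> M x k)}"
    proof
      fix k assume "k \<in> (\<lambda>i. M - Suc i) ` {i. i < M \<and> far (ang \<beta> M i x)}"
      then obtain i where i: "i < M" "far (ang \<beta> M i x)" "k = M - Suc i" by blast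
      hence "M - Suc k = i" "k < M" by auto
      thus "k \<in> {k. k < M \<and> far (orbit_coord \<beta> M x k)}" using i ang_eq_orbit_coord[of k M \<beta> x] by simp
    qed
  qed (auto simp: ang_eq_orbit_coord)
qed

text \<open>The number z = 1 / \<mu> is a root of X^2 - 2 Re z X + |z|^2, whose coefficients are
  real, so real parts of a geometric orbit inherit the relation.\<close>

lemma orbit_coord_rec: "orbit_coord \<beta> M x (k + 2) = (2 * Re (1 / \<mu>)) * orbit_coord \<beta> M x (k + 1) - (norm (1 / \<mu>))\<^sup>2 * orbit_coord \<beta> M x k"
proof -
  define z where "z = 1 / \<mu>"
  have zz: "z\<^sup>2 = of_real (2 * Re z) * z - of_real ((norm z)\<^sup>2)"
    by (simp add: complex_eq_iff power2_eq_square cmod_power2[unfolded power2_eq_square] algebra_simps)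
  have "z ^ Suc (k + 2) * start_point \<beta> M x = z\<^sup>2 * (z ^ Suc k * start_point \<beta> M x)"
    by (simp add: power2_eq_square mult_ac)
  also have "\<dots> = (of_real (2 * Re z) * z - of_real ((norm z)\<^sup>2)) * (z ^ Suc k * start_point \<beta> M x)"
    by (simp only: zz)
  also have "\<dots> = of_real (2 * Re z) * (z ^ Suc (k + 1) * start_point \<beta> M x) - of_real ((norm z)\<^sup>2) * (z ^ Suc k * start_point \<beta> M x)"
    by (simp add: algebra_simps)
  finally have "z ^ Suc (k + 2) * start_point \<beta> M x = of_real (2 * Re z) * (z ^ Suc (k + 1) * start_point \<beta> M x) - of_real ((norm z)\<^sup>2) * (z ^ Suc k * start_point \<beta> M x)" .
  thus ?thesis unfolding orbit_coord_def z_def[symmetric] by (metis Re_complex_of_real Im_complex_of_real mult_zero_left diff_zero times_complex.sel(1) minus_complex.sel(1))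
qed

lemma norm_start_point: "x \<in> {\<rho>..1} \<Longrightarrow> norm (start_point \<beta> M x) \<le> norm \<Delta>"
proof -
  assume x: "x \<in> {\<rho>..1}"
  have "norm (start_point \<beta> M x) = \<bar>x\<bar> * norm \<Delta> / (2 * pi)"
    by (simp add: start_point_def norm_mult norm_divide norm_power)
  also have "\<dots> \<le> 1 * norm \<Delta> / 1"
    using x order_trans[OF norm_ge_zero[of \<mu>], of x] pi_gt3 by (intro frac_le mult_mono) auto
  finally show ?thesis by simp
qed

text \<open>The modulus of a start point encodes \<open>x\<close> and its argument encodes \<beta>.
  Moduli differ by at most |v|, which leaves at most 2 |v| for the angular part, to be divided by x
  \<ge> \<rho>. Thus \<open>x\<close> and \<open>x'\<close> may be different.\<close>

lemma start_point_dist: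
  assumes x: "x \<in> {\<rho>..1}" "x' \<in> {\<rho>..1}" and b: "\<beta> \<in> {0..<pi}" "\<beta>' \<in> {0..<pi}"
  shows "\<bar>\<beta> - \<beta>'\<bar> \<le> 8 * pi / (\<rho> * norm \<Delta>) * norm (start_point \<beta> M x - start_point \<beta>' M x')"
proof -
  define v where "v = of_real x * cis \<beta> - of_real x' * cis \<beta>'"
  have "start_point \<beta> M x - start_point \<beta>' M x' = cnj v * cnj \<omega> ^ M * \<Delta> / of_real (2 * pi)"
    by (simp add: start_point_def v_def algebra_simps diff_divide_distrib)
  hence n: "norm (start_point \<beta> M x - start_point \<beta>' M x') = norm v * norm \<Delta> / (2 * pi)"
    by (simp add: norm_mult norm_divide norm_power)
  have "\<bar>x - x'\<bar> \<le> norm v"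
    using norm_triangle_ineq3[of "of_real x * cis \<beta>" "of_real x' * cis \<beta>'"] x
      order_trans[OF norm_ge_zero[of \<mu>], of x] order_trans[OF norm_ge_zero[of \<mu>], of x']
    by (simp add: v_def norm_mult)
  moreover have "of_real x * (cis \<beta> - cis \<beta>') = v + of_real (x' - x) * cis \<beta>'"
    by (simp add: v_def algebra_simps)
  hence "norm (of_real x * (cis \<beta> - cis \<beta>')) \<le> norm v + \<bar>x' - x\<bar>"
    by (metis norm_triangle_ineq norm_mult norm_cis mult_1_right norm_of_real)
  ultimately have "\<bar>x\<bar> * norm (cis \<beta> - cis \<beta>') \<le> 2 * norm v" by (simp add: norm_mult)
  moreover have "\<rho> * norm (cis \<beta> - cis \<beta>') \<le> \<bar>x\<bar> * norm (cis \<beta> - cis \<beta>')"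
    using x by (intro mult_right_mono) auto
  ultimately have "norm (cis \<beta> - cis \<beta>') \<le> 2 * norm v / \<rho>"
    using mu_pos by (simp add: pos_le_divide_eq mult.commute)
  hence "\<bar>\<beta> - \<beta>'\<bar> \<le> 4 * norm v / \<rho>" using cis_dist_ge[OF b] by simp
  also have "\<dots> = 8 * pi / (\<rho> * norm \<Delta>) * norm (start_point \<beta> M x - start_point \<beta>' M x')"
    using \<Delta> by (simp add: n)
  finally show ?thesis .
qed

definition deviation :: "real \<Rightarrow> nat \<Rightarrow> real \<Rightarrow> nat \<Rightarrow> int" where
  "deviation \<beta> M x k = round (orbit_coord \<beta> M x (k + 2)) - round ((2 * Re (1 / \<mu>)) * of_int (round (orbit_coord \<beta> M x (k + 1)))
      - (norm (1 / \<mu>))\<^sup>2 * of_int (round (orbit_coord \<beta> M x k)))"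

text \<open>Data from which all M rounded coordinates can be reconstructed: two initial values and
  the M - 2 errors made in predicting a value from its two predecessors. When few angles are far,
  most of these errors are 0.\<close>

definition code :: "real \<Rightarrow> nat \<Rightarrow> real \<Rightarrow> int \<times> int \<times> int list" where
  "code \<beta> M x = (round (orbit_coord \<beta> M x 0), round (orbit_coord \<beta> M x 1), map (deviation \<beta> M x) [0..<M - 2])"

section \<open>Directions with a common code lie in a short interval, and codes are few\<close>

lemma Im_mu: "Im \<mu> \<noteq> 0" using irr[of 1] by simp

text \<open>As \<mu> is not real, the real parts of \<open>V\<close> and \<open>\<mu> * V\<close>
  are independent coordinates of \<open>V\<close>.\<close>

lemma norm_le_Re:
  assumes "\<bar>Re V\<bar> \<le> 1" "\<bar>Re (\<mu> * V)\<bar> \<le> 1"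
  shows "norm V \<le> 1 + 2 / \<bar>Im \<mu>\<bar>"
proof -
  have "Im \<mu> * Im V = Re \<mu> * Re V - Re (\<mu> * V)" by simp
  hence "\<bar>Im \<mu>\<bar> * \<bar>Im V\<bar> \<le> \<bar>Re \<mu>\<bar> * \<bar>Re V\<bar> + \<bar>Re (\<mu> * V)\<bar>"
    by (metis abs_mult abs_triangle_ineq4)
  also have "\<dots> \<le> 1 * 1 + 1"
    using assms abs_Re_le_cmod[of \<mu>] mu_less by (intro add_mono mult_mono) auto
  finally have "\<bar>Im V\<bar> \<le> 2 / \<bar>Im \<mu>\<bar>" using Im_mu by (simp add: pos_le_divide_eq mult.commute)
  thus ?thesis using cmod_le[of V] assms by linarith
qed

text \<open>Equal codes give equal rounded coordinates, hence coordinates that differ by at most 1.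
  For the last two this bounds the difference of the start points after M expansions, and undoing
  the expansions gives the factor \<open>\<rho> ^ M\<close>.\<close>

lemma code_diam:
  assumes x: "x \<in> {\<rho>..1}" "x' \<in> {\<rho>..1}" and b: "\<beta> \<in> {0..<pi}" "\<beta>' \<in> {0..<pi}"
    and M: "M \<ge> 2" and c: "code \<beta> M x = code \<beta>' M x'"
  shows "\<bar>\<beta> - \<beta>'\<bar> \<le> 8 * pi / (\<rho> * norm \<Delta>) * (1 + 2 / \<bar>Im \<mu>\<bar>) * \<rho> ^ M"
proof -
  define g where "g p p' = round ((2 * Re (1 / \<mu>)) * of_int p - (norm (1 / \<mu>))\<^sup>2 * of_int p')" for p p' :: int
  have eq: "round (orbit_coord \<beta> M x k) = round (orbit_coord \<beta>' M x' k)" if "k < M" for k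
  proof (rule rounded_recurrence_determined[where g=g and M=M])
    fix k assume k: "k + 2 < M"
    have "deviation \<beta> M x k = map (deviation \<beta> M x) [0..<M - 2] ! k" using k by simp
    also have "\<dots> = map (deviation \<beta>' M x') [0..<M - 2] ! k" using c by (simp add: code_def del: map_eq_conv)
    also have "\<dots> = deviation \<beta>' M x' k" using k by simp
    finally show "round (orbit_coord \<beta> M x (k + 2)) - g (round (orbit_coord \<beta> M x (k + 1))) (round (orbit_coord \<beta> M x k))
       = round (orbit_coord \<beta>' M x' (k + 2)) - g (round (orbit_coord \<beta>' M x' (k + 1))) (round (orbit_coord \<beta>' M x' k))"
      by (simp add: deviation_def g_def)
  qed (use c that in \<open>auto simp: code_def\<close>)
  have yd: "\<bar>orbit_coord \<beta> M x k - orbit_coord \<beta>' M x' k\<bar> \<le> 1" if "k < M" for k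
    using round_err[of "orbit_coord \<beta> M x k"] round_err[of "orbit_coord \<beta>' M x' k"] eq[OF that] by linarith
  define d where "d = start_point \<beta> M x - start_point \<beta>' M x'"
  define V where "V = (1 / \<mu>) ^ M * d"
  have yV: "orbit_coord \<beta> M x k - orbit_coord \<beta>' M x' k = Re ((1 / \<mu>) ^ Suc k * d)" for k
    unfolding orbit_coord_def d_def by (simp only: right_diff_distrib minus_complex.sel)
  have m: "M = Suc (Suc m)" if "m = M - 2" for m using M that by simp
  define m where "m = M - 2"
  note m = m[OF m_def]
  have "\<bar>Re V\<bar> \<le> 1" using yd[of "Suc m"] yV[of "Suc m"] m by (simp add: V_def)
  moreover have "\<mu> * V = (1 / \<mu>) ^ Suc m * d" using mu_ne by (simp add: V_def m)
  hence "\<bar>Re (\<mu> * V)\<bar> \<le> 1" using yd[of m] yV[of m] m by simp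
  ultimately have nV: "norm V \<le> 1 + 2 / \<bar>Im \<mu>\<bar>" by (rule norm_le_Re)
  have "norm d = norm V * \<rho> ^ M" using mu_pos by (simp add: V_def norm_mult norm_power norm_divide power_divide)
  also have "\<dots> \<le> (1 + 2 / \<bar>Im \<mu>\<bar>) * \<rho> ^ M" using nV by (intro mult_right_mono) auto
  finally have "norm d \<le> (1 + 2 / \<bar>Im \<mu>\<bar>) * \<rho> ^ M" .
  moreover have "0 \<le> 8 * pi / (\<rho> * norm \<Delta>)" by simp
  ultimately have "8 * pi / (\<rho> * norm \<Delta>) * norm d \<le> 8 * pi / (\<rho> * norm \<Delta>) * ((1 + 2 / \<bar>Im \<mu>\<bar>) * \<rho> ^ M)"
    by (intro mult_left_mono)
  thus ?thesis using start_point_dist[OF x b, of M] by (simp add: d_def mult.assoc)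
qed

definition rec_norm :: real where "rec_norm = (1 + 1 / \<rho>)\<^sup>2"

text \<open>\<open>L\<close> bounds the two initial values, and the factor 3 is that of
  \<open>recurrence_round_sparse\<close>.\<close>

definition codes :: "real \<Rightarrow> nat \<Rightarrow> (int \<times> int \<times> int list) set" where
  "codes \<delta> M = (let L = \<lceil>norm \<Delta> / \<rho>\<^sup>2\<rceil> + 1 in {-L..L} \<times> {-L..L} \<times>
     {l \<in> words {- int (nat \<lceil>rec_norm\<rceil>)..int (nat \<lceil>rec_norm\<rceil>)} (M - 2). real (length (filter (\<lambda>a. a \<noteq> 0) l)) \<le> 3 * (\<delta> * M)})"

lemma rec_norm_bound: "1 + \<bar>2 * Re (1 / \<mu>)\<bar> + \<bar>(norm (1 / \<mu>))\<^sup>2\<bar> \<le> rec_norm"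
proof -
  have n: "norm (1 / \<mu>) = 1 / \<rho>" by (simp add: norm_divide)
  have "\<bar>Re (1 / \<mu>)\<bar> \<le> 1 / \<rho>" using abs_Re_le_cmod[of "1 / \<mu>"] n by simp
  thus ?thesis unfolding n rec_norm_def by (simp add: power2_sum abs_mult)
qed

lemma code_in_codes:
  fixes x \<delta> :: real
  assumes x: "x \<in> {\<rho>..1}" and few: "real (card {i. i < M \<and> far (ang \<beta> M i x)}) < \<delta> * M"
  shows "code \<beta> M x \<in> codes \<delta> M"
proof -
  define L where "L = \<lceil>norm \<Delta> / \<rho>\<^sup>2\<rceil> + 1"
  have yb: "\<bar>orbit_coord \<beta> M x k\<bar> \<le> norm \<Delta> / \<rho>\<^sup>2" if "k \<le> 1" for k
  proof -
    have "\<bar>orbit_coord \<beta> M x k\<bar> \<le> norm ((1 / \<mu>) ^ Suc k * start_point \<beta> M x)" unfolding orbit_coord_def by (rule abs_Re_le_cmod)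
    also have "\<dots> = (1 / \<rho>) ^ Suc k * norm (start_point \<beta> M x)" by (simp only: norm_mult norm_power norm_divide norm_one)
    also have "\<dots> \<le> (1 / \<rho>) ^ 2 * norm \<Delta>"
      using that mu_pos mu_less by (intro mult_mono norm_start_point[OF x] power_increasing) auto
    finally show ?thesis by (simp add: power_divide)
  qed
  have rb: "round (orbit_coord \<beta> M x k) \<in> {-L..L}" if "k \<le> 1" for k
    using yb[OF that] round_err[of "orbit_coord \<beta> M x k"] unfolding L_def atLeastAtMost_iff by linarith
  have c0A: "c0 * rec_norm < 1/2"
  proof -
    have "(1 + 1 / \<rho>)\<^sup>2 > 0" using mu_pos by (intro zero_less_power add_pos_pos) auto
    thus ?thesis by (simp add: c0_def rec_norm_def)
  qed
  note R = recurrence_round_sparse[where y="orbit_coord \<beta> M x" and dev="deviation \<beta> M x", OF orbit_coord_rec rec_norm_bound c0A c0_pos deviation_def]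
  have AA0: "rec_norm \<ge> 0" by (simp add: rec_norm_def)
  define I where "I = {- int (nat \<lceil>rec_norm\<rceil>)..int (nat \<lceil>rec_norm\<rceil>)}"
  have "deviation \<beta> M x k \<in> I" for k using R(1)[of k] AA0 by (auto simp: I_def)
  hence "map (deviation \<beta> M x) [0..<M - 2] \<in> words I (M - 2)" by (auto simp: words_def)
  moreover have "real (length (filter (\<lambda>a. a \<noteq> 0) (map (deviation \<beta> M x) [0..<M - 2]))) \<le> 3 * (\<delta> * M)"
  proof -
    have "length (filter (\<lambda>a. a \<noteq> 0) (map (deviation \<beta> M x) [0..<M - 2])) = card {k. k < M - 2 \<and> deviation \<beta> M x k \<noteq> 0}"
      unfolding length_filter_conv_card by (intro arg_cong[where f=card]) auto
    also have "\<dots> \<le> 3 * card {k. k < M \<and> far (orbit_coord \<beta> M x k)}"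
      unfolding far_def by (rule R(2))
    finally show ?thesis using few by (simp add: card_far)
  qed
  ultimately show ?thesis unfolding codes_def code_def Let_def L_def[symmetric] I_def[symmetric] using rb[of 0] rb[of 1] by simp
qed

lemma card_codes:
  fixes x \<delta> :: real
  assumes x: "0 < x" "x \<le> 1"
  shows "\<exists>C. \<forall>M. real (card (codes \<delta> M)) \<le> C * (x powr (- (3 * \<delta>)) * (1 + 2 * nat \<lceil>rec_norm\<rceil> * x)) ^ M"
proof -
  define L where "L = \<lceil>norm \<Delta> / \<rho>\<^sup>2\<rceil> + 1"
  define C where "C = real (card {-L..L}) * real (card {-L..L})"
  define B where "B = nat \<lceil>rec_norm\<rceil>"
  have "real (card (codes \<delta> M)) \<le> C * (x powr (- (3 * \<delta>)) * (1 + 2 * B * x)) ^ M" for M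
  proof -
    have "real (card (codes \<delta> M)) = C * real (card {l \<in> words {- int B..int B} (M - 2). real (length (filter (\<lambda>a. a \<noteq> 0) l)) \<le> 3 * (\<delta> * M)})"
      unfolding codes_def Let_def L_def[symmetric] B_def[symmetric] card_cartesian_product C_def of_nat_mult by (rule mult.assoc[symmetric])
    also have "\<dots> \<le> C * (x powr (- (3 * (\<delta> * M))) * (1 + 2 * B * x) ^ (M - 2))"
      by (intro mult_left_mono card_sparse_words x) (simp add: C_def)
    also have "\<dots> \<le> C * (x powr (- (3 * (\<delta> * M))) * (1 + 2 * B * x) ^ M)"
      using x by (intro mult_left_mono power_increasing) (auto simp: C_def)
    also have "x powr (- (3 * (\<delta> * M))) = (x powr (- (3 * \<delta>))) ^ M"
      using x by (simp add: powr_power mult_ac)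
    finally show ?thesis by (simp add: power_mult_distrib)
  qed
  thus ?thesis unfolding B_def by blast
qed

text \<open>Failure for every \<delta> is demanded: the dimension bound for the directions failing
  at one fixed \<delta> is positive and tends to 0 only with \<delta>.\<close>

definition exc_dirs :: "real set" where "exc_dirs = {\<beta> \<in> {0..<pi}. \<forall>\<delta>>0. \<not> good \<delta> \<beta>}"

text \<open>A direction that is not good has few far angles for infinitely many M, and its code then
  belongs to \<open>codes \<delta> M\<close>. So \<open>hcontent_0_limsup\<close> applies with sets
  of diameter of order \<open>\<rho> ^ M\<close>; hypothesis \<open>g\<close> says that the number
  of codes grows more slowly than \<open>\<rho> powr (- s * M)\<close>.\<close>

lemma hcontent_not_good:
  fixes s x \<delta> :: real
  assumes s: "s > 0" and x: "0 < x" "x \<le> 1"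
    and g: "x powr (- (3 * \<delta>)) * (1 + 2 * nat \<lceil>rec_norm\<rceil> * x) * \<rho> powr s < 1"
  shows "hcontent s {\<beta> \<in> {0..<pi}. \<not> good \<delta> \<beta>} = 0"
proof -
  define Cd where "Cd = 8 * pi / (\<rho> * norm \<Delta>) * (1 + 2 / \<bar>Im \<mu>\<bar>)"
  have Cd: "Cd \<ge> 0" by (simp add: Cd_def)
  define b where "b = x powr (- (3 * \<delta>)) * (1 + 2 * nat \<lceil>rec_norm\<rceil> * x)"
  have b0: "b \<ge> 0" using x by (simp add: b_def)
  obtain C where C: "\<And>M. real (card (codes \<delta> M)) \<le> C * b ^ M" using card_codes[OF x] unfolding b_def by blast
  \<comment> \<open>Since \<open>code_diam\<close> compares directions with different
    \<open>x\<close>, the frequency can be quantified inside the set instead of being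
    discretised.\<close>
  define S where "S M c = {\<beta> \<in> {0..<pi}. M \<ge> 2 \<and> (\<exists>x\<in>{\<rho>..1}. code \<beta> M x = c)}" for M c
  show ?thesis
  proof (rule hcontent_0_limsup[where F="codes \<delta>" and S=S and D="\<lambda>M. Cd * \<rho> ^ M"])
    show "finite (codes \<delta> M)" for M by (simp add: codes_def Let_def)
    show "bounded (S M c)" for M c
      by (rule bounded_subset[of "{0..pi}"]) (auto simp: S_def)
    show "diameter (S M c) \<le> Cd * \<rho> ^ M" for M c
    proof (rule diameter_le)
      show "S M c \<noteq> {} \<or> 0 \<le> Cd * \<rho> ^ M" using Cd by simp
      fix y z assume "y \<in> S M c" "z \<in> S M c"
      then obtain x x' where "y \<in> {0..<pi}" "z \<in> {0..<pi}" "M \<ge> 2" "x \<in> {\<rho>..1}" "x' \<in> {\<rho>..1}" "code y M x = c" "code z M x' = c"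
        unfolding S_def by blast
      thus "norm (y - z) \<le> Cd * \<rho> ^ M" using code_diam[of x x' y z M] unfolding Cd_def real_norm_def by simp
    qed
    show "\<exists>M\<ge>M0. \<exists>c\<in>codes \<delta> M. \<beta> \<in> S M c" if "\<beta> \<in> {\<beta> \<in> {0..<pi}. \<not> good \<delta> \<beta>}" for \<beta> M0
    proof -
      from that have b: "\<beta> \<in> {0..<pi}" "\<not> good \<delta> \<beta>" by auto
      then obtain M x where M: "M \<ge> max M0 2" "x \<in> {\<rho>..1}" "real (card {i. i < M \<and> far (ang \<beta> M i x)}) < \<delta> * M"
        unfolding good_def not_all not_ex not_le by (metis linorder_not_le)
      have "code \<beta> M x \<in> codes \<delta> M" by (rule code_in_codes[OF M(2,3)])
      moreover have "\<beta> \<in> S M (code \<beta> M x)" using M b by (auto simp: S_def)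
      ultimately show ?thesis using M(1) by (intro exI[of _ M]) auto
    qed
    show "summable (\<lambda>M. real (card (codes \<delta> M)) * (Cd * \<rho> ^ M) powr s)"
    proof (rule summable_comparison_test)
      show "summable (\<lambda>M. C * Cd powr s * (b * \<rho> powr s) ^ M)"
        using g b0 unfolding b_def[symmetric] by (intro summable_mult summable_geometric) (simp add: abs_mult)
      have "norm (real (card (codes \<delta> M)) * (Cd * \<rho> ^ M) powr s) \<le> C * Cd powr s * (b * \<rho> powr s) ^ M" for M
      proof -
        have "(Cd * \<rho> ^ M) powr s = Cd powr s * (\<rho> powr s) ^ M"
          using Cd mu_pos by (simp add: powr_mult powr_power powr_powr mult.commute flip: powr_realpow)
        hence "norm (real (card (codes \<delta> M)) * (Cd * \<rho> ^ M) powr s) = real (card (codes \<delta> M)) * (Cd powr s * (\<rho> powr s) ^ M)"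
          by (simp add: abs_mult)
        also have "\<dots> \<le> C * b ^ M * (Cd powr s * (\<rho> powr s) ^ M)"
          by (intro mult_right_mono C) simp
        finally show ?thesis by (simp add: power_mult_distrib mult_ac)
      qed
      thus "\<exists>N. \<forall>M\<ge>N. norm (real (card (codes \<delta> M)) * (Cd * \<rho> ^ M) powr s) \<le> C * Cd powr s * (b * \<rho> powr s) ^ M" by blast
    qed
  qed (rule s)
qed

lemma hcontent_exc_dirs:
  assumes s: "s > 0"
  shows "hcontent s exc_dirs = 0"
proof -
  define B where "B = real (nat \<lceil>rec_norm\<rceil>) + 1"
  have B: "B > 0" by (simp add: B_def)
  have l: "ln \<rho> < 0" using mu_pos mu_less by simp
  have r1: "\<rho> powr (- (s / 2)) > 1" using powr_less_mono'[of \<rho> "-(s/2)" 0] mu_pos mu_less s by simp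
  \<comment> \<open>\<open>x\<close> makes \<open>1 + 2 * B * x\<close> at most
    \<open>\<rho> powr (- s / 2)\<close>, and then \<open>\<delta>\<close> makes
    \<open>x powr (- 3 * \<delta>)\<close> equal to \<open>\<rho> powr (- 3 * s / 8)\<close>; an
    exponent s / 8 > 0 remains.\<close>
  define x where "x = min (1/2) ((\<rho> powr (- (s / 2)) - 1) / (2 * B))"
  have x: "0 < x" "x < 1" using r1 B by (auto simp: x_def)
  define \<delta> where "\<delta> = s * ln \<rho> / (8 * ln x)"
  have lx: "ln x < 0" using x by simp
  have d: "\<delta> > 0" using s l lx by (simp add: \<delta>_def zero_less_divide_iff mult_pos_neg)
  have "x powr (- (3 * \<delta>)) = \<rho> powr (- (3 * s / 8))"
    using x mu_pos mu_ne lx by (simp add: powr_def \<delta>_def)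
  moreover have "1 + 2 * nat \<lceil>rec_norm\<rceil> * x \<le> \<rho> powr (- (s / 2))"
  proof -
    have "x \<le> (\<rho> powr (- (s / 2)) - 1) / (2 * B)" by (simp add: x_def)
    hence "2 * B * x \<le> \<rho> powr (- (s / 2)) - 1" using B by (simp add: pos_le_divide_eq mult.commute)
    moreover have "2 * nat \<lceil>rec_norm\<rceil> * x \<le> 2 * B * x" using x by (intro mult_right_mono) (auto simp: B_def)
    ultimately show ?thesis by linarith
  qed
  ultimately have "x powr (- (3 * \<delta>)) * (1 + 2 * nat \<lceil>rec_norm\<rceil> * x) * \<rho> powr s \<le> \<rho> powr (- (3 * s / 8)) * \<rho> powr (- (s / 2)) * \<rho> powr s"
    using x by (intro mult_right_mono mult_mono add_nonneg_nonneg mult_nonneg_nonneg) auto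
  also have "\<dots> = \<rho> powr (s / 8)" by (simp flip: powr_add)
  also have "\<dots> < 1" using powr_less_mono2[of "s/8" \<rho> 1] mu_less s by simp
  finally have "hcontent s {\<beta> \<in> {0..<pi}. \<not> good \<delta> \<beta>} = 0" using x by (intro hcontent_not_good[OF s]) auto
  moreover have "exc_dirs \<subseteq> {\<beta> \<in> {0..<pi}. \<not> good \<delta> \<beta>}" using d by (auto simp: exc_dirs_def)
  ultimately show ?thesis using hcontent_mono by (metis le_zero_eq)
qed

end

section \<open>Directional energy\<close>

context hom_sys
begin

text \<open>Not the measure of the overview, but a bound for the cosine factor at a far
  angle.\<close>

definition \<eta> :: real where "\<eta> = cos (pi * c0)"

lemma c0_le: "c0 \<le> 1/4"
proof -
  have "1 \<le> (1 + 1 / \<rho>)\<^sup>2" by (rule one_le_power) simp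
  thus ?thesis unfolding c0_def by (simp add: divide_simps)
qed

lemma eta: "0 < \<eta>" "\<eta> < 1"
proof -
  have a: "0 < pi * c0" "pi * c0 < pi / 2" using c0_pos c0_le by (auto simp: field_simps)
  show "0 < \<eta>" unfolding \<eta>_def using a by (intro cos_gt_zero) auto
  have "cos (pi * c0) < cos 0" using a by (intro cos_monotone_0_pi) auto
  thus "\<eta> < 1" by (simp add: \<eta>_def)
qed

lemma cos_far:
  assumes "far t"
  shows "\<bar>cos (pi * t)\<bar> \<le> \<eta>"
proof -
  define d where "d = of_int (round t) - t"
  have d: "c0 \<le> \<bar>d\<bar>" "\<bar>d\<bar> \<le> 1/2" using assms round_err[of t] by (auto simp: far_def d_def)
  have "pi * t = pi * of_int (round t) - pi * d" by (simp add: d_def algebra_simps)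
  hence "cos (pi * t) = cos (pi * of_int (round t)) * cos (pi * d)"
    by (simp add: cos_diff)
  moreover have "\<bar>cos (pi * of_int (round t))\<bar> = 1" by simp
  ultimately have "\<bar>cos (pi * t)\<bar> = \<bar>cos (pi * d)\<bar>" by (simp add: abs_mult)
  also have "\<dots> = \<bar>cos (pi * \<bar>d\<bar>)\<bar>" by (cases "d \<ge> 0") auto
  also have "\<dots> = cos (pi * \<bar>d\<bar>)"
  proof (intro abs_of_nonneg cos_ge_zero)
    show "- (pi / 2) \<le> pi * \<bar>d\<bar>" by (rule order_trans[of _ 0]) auto
    show "pi * \<bar>d\<bar> \<le> pi / 2" using d by (simp add: field_simps)
  qed
  also have "\<dots> \<le> \<eta>" unfolding \<eta>_def using d c0_pos by (intro cos_monotone_0_pi_le) (auto simp: field_simps)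
  finally show ?thesis .
qed

text \<open>The direction \<open>\<omega> ^ j * cis \<beta>\<close> at scale k has the angles of
  \<beta> at scale k + j without the first j of them. Goodness of \<beta> therefore controls its
  whole orbit.\<close>

lemma char_avg_pair_far:
  "char_avg {0, \<Delta>} k (arg (\<omega> ^ j * cis \<beta>) k \<xi>) \<le> \<eta> ^ card {i. i < k \<and> far (ang \<beta> (k + j) (i + j) \<xi>)}"
proof -
  have mu: "cnj \<mu> = of_real \<rho> * \<omega>" using mu_pos by (simp add: \<omega>_def)
  have fac: "\<bar>cos (inner (cnj \<mu> ^ i * arg (\<omega> ^ j * cis \<beta>) k \<xi>) \<Delta> / 2)\<bar> \<le> (if far (ang \<beta> (k + j) (i + j) \<xi>) then \<eta> else 1)" for i
  proof -
    have "cnj \<mu> ^ i * arg (\<omega> ^ j * cis \<beta>) k \<xi> = of_real (\<xi> * \<rho> ^ (i + j) / \<rho> ^ (k + j)) * (\<omega> ^ (i + j) * cis \<beta>)"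
    proof -
      have "\<xi> * \<rho> ^ (i + j) / \<rho> ^ (k + j) = \<rho> ^ i * (\<xi> / \<rho> ^ k)" using mu_ne by (simp add: power_add)
      hence "of_real (\<xi> * \<rho> ^ (i + j) / \<rho> ^ (k + j)) = (of_real \<rho> ^ i * of_real (\<xi> / \<rho> ^ k) :: complex)"
        by (simp only: of_real_mult of_real_power)
      thus ?thesis unfolding arg_def by (subst mu) (simp add: power_mult_distrib power_add mult_ac del: of_real_divide)
    qed
    hence "inner (cnj \<mu> ^ i * arg (\<omega> ^ j * cis \<beta>) k \<xi>) \<Delta> / 2 = pi * ang \<beta> (k + j) (i + j) \<xi>"
      by (simp add: ang_def)
    thus ?thesis using cos_far by (simp add: abs_cos_le_one)
  qed
  have "char_avg {0, \<Delta>} k (arg (\<omega> ^ j * cis \<beta>) k \<xi>) \<le> (\<Prod>i<k. if far (ang \<beta> (k + j) (i + j) \<xi>) then \<eta> else 1)"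
    unfolding char_avg_pair by (intro prod_mono) (use fac in auto)
  also have "\<dots> = \<eta> ^ card ({..<k} \<inter> {i. far (ang \<beta> (k + j) (i + j) \<xi>)})"
    by (subst prod.If_cases) auto
  also have "{..<k} \<inter> {i. far (ang \<beta> (k + j) (i + j) \<xi>)} = {i. i < k \<and> far (ang \<beta> (k + j) (i + j) \<xi>)}" by auto
  finally show ?thesis .
qed

lemma card_far_shift:
  "card {i. i < k + j \<and> far (ang \<beta> (k + j) i \<xi>)} \<le> j + card {i. i < k \<and> far (ang \<beta> (k + j) (i + j) \<xi>)}"
proof -
  have "{i. i < k + j \<and> far (ang \<beta> (k + j) i \<xi>)} \<subseteq> {..<j} \<union> (\<lambda>i. i + j) ` {i. i < k \<and> far (ang \<beta> (k + j) (i + j) \<xi>)}"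
  proof
    fix i assume i: "i \<in> {i. i < k + j \<and> far (ang \<beta> (k + j) i \<xi>)}"
    show "i \<in> {..<j} \<union> (\<lambda>i. i + j) ` {i. i < k \<and> far (ang \<beta> (k + j) (i + j) \<xi>)}"
    proof (cases "i < j")
      case False
      thus ?thesis using i by (intro UnI2 image_eqI[of _ _ "i - j"]) auto
    qed simp
  qed
  hence "card {i. i < k + j \<and> far (ang \<beta> (k + j) i \<xi>)} \<le> card ({..<j} \<union> (\<lambda>i. i + j) ` {i. i < k \<and> far (ang \<beta> (k + j) (i + j) \<xi>)})"
    by (intro card_mono) auto
  also have "\<dots> \<le> card {..<j} + card ((\<lambda>i. i + j) ` {i. i < k \<and> far (ang \<beta> (k + j) (i + j) \<xi>)})"
    by (rule card_Un_le)
  also have "\<dots> \<le> j + card {i. i < k \<and> far (ang \<beta> (k + j) (i + j) \<xi>)}"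
    by (intro add_mono card_image_le) auto
  finally show ?thesis .
qed

text \<open>Of the far angles that goodness provides at scale k + j, at most j are lost, so the
  decay sets in once k exceeds a multiple of j. Up to there the trivial bound 1 is used, at a cost
  exponential in j whose base can be pushed below any b > 1.\<close>

lemma Phi_orbit:
  fixes \<beta> b :: real
  assumes bet: "\<beta> \<in> {0..<pi} - exc_dirs" and b: "b > 1"
  shows "\<exists>C>0. \<forall>m j. \<Phi> m (\<omega> ^ j * cis \<beta>) \<le> C * b ^ j * \<rho> ^ m"
proof -
  obtain \<delta> where d: "\<delta> > 0" "good \<delta> \<beta>" using bet by (auto simp: exc_dirs_def)
  then obtain M0 where M0: "\<And>M x. M \<ge> M0 \<Longrightarrow> x \<in> {\<rho>..1} \<Longrightarrow> \<delta> * M \<le> real (card {i. i < M \<and> far (ang \<beta> M i x)})"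
    unfolding good_def by blast
  have l: "ln \<rho> < 0" "ln \<eta> < 0" "ln b > 0" using mu_pos mu_less eta b by auto
  \<comment> \<open>The first bound makes the decay at least
    \<open>\<rho> powr (2 * \<epsilon>)\<close> per step, twice the loss in
    \<open>q_uniform\<close>; the second keeps the price
    \<open>\<rho> powr (- 4 * \<epsilon> * j / \<delta>)\<close> of the delay below
    \<open>b ^ j\<close>.\<close>
  define \<epsilon> where "\<epsilon> = min (\<delta> * ln \<eta> / (2 * ln \<rho>)) (\<delta> * ln b / (- 4 * ln \<rho>))"
  have e0: "\<epsilon> > 0"
  proof -
    have "\<delta> * ln \<eta> / (2 * ln \<rho>) > 0" using d l by (intro divide_neg_neg mult_pos_neg) auto
    moreover have "\<delta> * ln b / (- 4 * ln \<rho>) > 0" using d l by (intro divide_pos_pos) auto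
    ultimately show ?thesis by (simp add: \<epsilon>_def)
  qed
  have e1: "\<eta> powr \<delta> \<le> \<rho> powr (2 * \<epsilon>)"
  proof -
    have "\<epsilon> \<le> \<delta> * ln \<eta> / (2 * ln \<rho>)" by (simp add: \<epsilon>_def)
    hence "\<epsilon> * (2 * ln \<rho>) \<ge> \<delta> * ln \<eta>" using l by (simp add: neg_le_divide_eq)
    thus ?thesis using mu_ne eta by (simp add: powr_def mult_ac)
  qed
  have e2: "\<rho> powr (- 4 * \<epsilon> / \<delta>) \<le> b"
  proof -
    have "\<epsilon> \<le> \<delta> * ln b / (- 4 * ln \<rho>)" by (simp add: \<epsilon>_def)
    hence "\<epsilon> * (- 4 * ln \<rho>) \<le> \<delta> * ln b" using l by (subst (asm) pos_le_divide_eq) auto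
    hence "- 4 * \<epsilon> / \<delta> * ln \<rho> \<le> ln b" using d by (simp add: field_simps)
    hence "exp (- 4 * \<epsilon> / \<delta> * ln \<rho>) \<le> exp (ln b)" by (simp only: exp_le_cancel_iff)
    thus ?thesis using mu_ne b by (simp add: powr_def)
  qed
  \<comment> \<open>Decay delayed by \<open>M0 + 2 * j / \<delta>\<close> steps, written so that it
    is at least 1 as long as counting far angles is inconclusive.\<close>
  define V where "V j k = \<rho> powr (2 * \<epsilon> * (real k - real M0 - 2 * real j / \<delta>))" for j k :: nat
  have SSV: "(char_avg {0, \<Delta>} k (arg (\<omega> ^ j * cis \<beta>) k \<xi>))\<^sup>2 \<le> V j k" if xi: "\<xi> \<in> {\<rho>..1}" for \<xi> j k
  proof (cases "k + j \<ge> M0 \<and> 2 * real j \<le> \<delta> * (k + j)")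
    case True
    let ?c = "card {i. i < k \<and> far (ang \<beta> (k + j) (i + j) \<xi>)}"
    have "\<delta> * real (k + j) \<le> real j + real ?c"
      using M0[OF _ xi, of "k + j"] card_far_shift[of k j \<beta> \<xi>] True by linarith
    \<comment> \<open>In this case at most half of the far angles are lost; squaring the Fourier
      transform doubles the exponent and restores \<open>\<delta> * k\<close>.\<close>
    hence c: "\<delta> * k \<le> 2 * real ?c"
    proof -
      have "\<delta> * (k + j) \<ge> \<delta> * k" using d by simp
      thus ?thesis using \<open>\<delta> * real (k + j) \<le> real j + real ?c\<close> True by linarith
    qed
    have "(char_avg {0, \<Delta>} k (arg (\<omega> ^ j * cis \<beta>) k \<xi>))\<^sup>2 \<le> (\<eta> ^ ?c)\<^sup>2"
      by (intro power_mono char_avg_pair_far char_avg_nonneg)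
    also have "\<dots> = \<eta> powr (2 * real ?c)" using eta powr_realpow[of \<eta> "2 * ?c"]
      by (simp add: power_mult[symmetric] mult.commute)
    also have "\<dots> \<le> \<eta> powr (\<delta> * k)" using eta c by (intro powr_mono') auto
    also have "\<dots> = (\<eta> powr \<delta>) powr k" by (simp add: powr_powr)
    also have "\<dots> \<le> (\<rho> powr (2 * \<epsilon>)) powr k" using e1 by (intro powr_mono2) auto
    also have "\<dots> = \<rho> powr (2 * \<epsilon> * k)" by (simp add: powr_powr)
    also have "\<dots> \<le> V j k"
    proof -
      have "0 \<le> 2 * real j / \<delta>" using d by simp
      hence "real k - real M0 - 2 * real j / \<delta> \<le> real k" by linarith
      hence "2 * \<epsilon> * (real k - real M0 - 2 * real j / \<delta>) \<le> 2 * \<epsilon> * k" using e0 by (intro mult_left_mono) auto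
      thus ?thesis unfolding V_def using mu_pos mu_less by (intro powr_mono') auto
    qed
    finally show ?thesis .
  next
    case False
    have "(char_avg {0, \<Delta>} k (arg (\<omega> ^ j * cis \<beta>) k \<xi>))\<^sup>2 \<le> 1"
      using char_avg_le_1[of "{0, \<Delta>}"] char_avg_nonneg by (intro power_le_one) auto
    also have "1 = \<rho> powr 0" using mu_ne by simp
    also have "\<dots> \<le> V j k"
    proof -
      have "real k - real M0 - 2 * real j / \<delta> \<le> 0"
      proof (cases "k + j \<ge> M0")
        case True
        hence "\<delta> * (k + j) \<le> 2 * real j" using False by simp
        hence "real k + real j \<le> 2 * real j / \<delta>" using d by (simp add: pos_le_divide_eq mult.commute)
        thus ?thesis by linarith
      next
        case False
        have "0 \<le> 2 * real j / \<delta>" using d by simp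
        thus ?thesis using False by linarith
      qed
      hence "2 * \<epsilon> * (real k - real M0 - 2 * real j / \<delta>) \<le> 0" using e0 by (intro mult_nonneg_nonpos) auto
      thus ?thesis unfolding V_def using mu_pos mu_less by (intro powr_mono') auto
    qed
    finally show ?thesis .
  qed
  obtain C where C: "C > 0" "\<And>e V m. (\<And>k \<xi>. k < m \<Longrightarrow> \<xi> \<in> {\<rho>..1} \<Longrightarrow> (char_avg {0, \<Delta>} (Suc k) (arg e (Suc k) \<xi>))\<^sup>2 \<le> V (Suc k)) \<Longrightarrow>
     \<Phi> m e \<le> \<rho> ^ m * (1 + C * (\<Sum>k<m. V (Suc k) * q (Suc k) e / \<rho> ^ Suc k))"
    using Phi_bound by blast
  obtain Q where Q: "Q > 0" "\<And>m e. norm e = 1 \<Longrightarrow> q m e \<le> Q * \<rho> powr ((1 - \<epsilon>) * m)"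
    using q_uniform[OF e0] by blast
  define g where "g = \<rho> powr \<epsilon>"
  have g: "0 < g" "g < 1" using powr_less_mono2[of \<epsilon> \<rho> 1] mu_less e0 mu_ne by (auto simp: g_def)
  define Q' where "Q' = Q * \<rho> powr (- 2 * \<epsilon> * M0)"
  have Q': "Q' > 0" using Q mu_ne by (simp add: Q'_def)
  \<comment> \<open>A gain 2\<epsilon> from \<open>V\<close> against a loss \<epsilon> from
    \<open>q\<close> leaves the geometric factor \<open>g ^ k\<close>.\<close>
  have trm: "V j k * q k (\<omega> ^ j * cis \<beta>) / \<rho> ^ k \<le> Q' * b ^ j * g ^ k" for j k
  proof -
    have rk: "\<rho> ^ k = \<rho> powr k" using mu_pos by (simp add: powr_realpow)
    have "V j k * q k (\<omega> ^ j * cis \<beta>) \<le> V j k * (Q * \<rho> powr ((1 - \<epsilon>) * k))"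
      by (intro mult_left_mono Q(2)) (auto simp: V_def norm_mult norm_power)
    hence "V j k * q k (\<omega> ^ j * cis \<beta>) / \<rho> ^ k \<le> V j k * (Q * \<rho> powr ((1 - \<epsilon>) * k)) / \<rho> ^ k"
      by (rule divide_right_mono) simp
    also have "\<dots> = Q * (V j k * \<rho> powr ((1 - \<epsilon>) * k) / \<rho> powr k)" unfolding rk by simp
    also have "V j k * \<rho> powr ((1 - \<epsilon>) * k) / \<rho> powr k = \<rho> powr (2 * \<epsilon> * (real k - real M0 - 2 * real j / \<delta>) + (1 - \<epsilon>) * k - k)"
      unfolding V_def by (simp only: powr_add powr_diff)
    also have "2 * \<epsilon> * (real k - real M0 - 2 * real j / \<delta>) + (1 - \<epsilon>) * k - k = - 2 * \<epsilon> * M0 + (- 4 * \<epsilon> / \<delta>) * j + \<epsilon> * k"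
      by (simp add: algebra_simps)
    also have "\<rho> powr (- 2 * \<epsilon> * M0 + (- 4 * \<epsilon> / \<delta>) * j + \<epsilon> * k) = \<rho> powr (- 2 * \<epsilon> * M0) * (\<rho> powr (- 4 * \<epsilon> / \<delta>)) ^ j * g ^ k"
    proof -
      have "\<rho> powr (c * real i) = (\<rho> powr c) ^ i" for c i using mu_ne by (simp add: powr_power mult.commute)
      thus ?thesis by (simp only: powr_add g_def)
    qed
    also have "Q * \<dots> \<le> Q * (\<rho> powr (- 2 * \<epsilon> * M0) * b ^ j * g ^ k)"
      using Q(1) e2 g by (intro mult_left_mono mult_right_mono power_mono) auto
    finally show ?thesis by (simp add: Q'_def mult_ac)
  qed
  define Cf where "Cf = 1 + C * Q' / (1 - g)"
  have "\<Phi> m (\<omega> ^ j * cis \<beta>) \<le> Cf * b ^ j * \<rho> ^ m" for m j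
  proof -
    have bj: "b ^ j \<ge> 1" using b by simp
    have "\<Phi> m (\<omega> ^ j * cis \<beta>) \<le> \<rho> ^ m * (1 + C * (\<Sum>k<m. V j (Suc k) * q (Suc k) (\<omega> ^ j * cis \<beta>) / \<rho> ^ Suc k))"
      by (rule C(2)) (rule SSV)
    also have "\<dots> \<le> \<rho> ^ m * (1 + C * (\<Sum>k<m. Q' * b ^ j * g ^ Suc k))"
      using C(1) by (intro mult_left_mono add_left_mono sum_mono trm) auto
    also have "\<dots> \<le> \<rho> ^ m * (1 * b ^ j + C * (Q' * b ^ j * (1 / (1 - g))))"
    proof (intro mult_left_mono add_mono)
      have "(\<Sum>k<m. g ^ Suc k) \<le> (\<Sum>k<m. g ^ k)" using g by (intro sum_mono power_decreasing) auto
      also have "\<dots> \<le> 1 / (1 - g)" using g by (simp add: sum_gp_strict divide_simps)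
      finally have "Q' * b ^ j * (\<Sum>k<m. g ^ Suc k) \<le> Q' * b ^ j * (1 / (1 - g))"
        using Q' b by (intro mult_left_mono) auto
      thus "(\<Sum>k<m. Q' * b ^ j * g ^ Suc k) \<le> Q' * b ^ j * (1 / (1 - g))" by (simp only: sum_distrib_left)
    qed (use bj C(1) in auto)
    also have "\<dots> = Cf * b ^ j * \<rho> ^ m" by (simp add: Cf_def algebra_simps)
    finally show ?thesis .
  qed
  moreover have "Cf > 0" using C(1) Q' g by (simp add: Cf_def add_pos_nonneg)
  ultimately show ?thesis by blast
qed

definition dirpairs :: "nat \<Rightarrow> real \<Rightarrow> ((complex list \<times> complex list) \<times> (complex list \<times> complex list)) set" where
  "dirpairs n \<beta> = {x \<in> P {0, \<Delta>} n \<times> P {0, \<Delta>} n. \<bar>inner (cis \<beta>) (pt \<mu> (fst x)) - inner (cis \<beta>) (pt \<mu> (snd x))\<bar> \<le> \<rho> ^ n}"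

text \<open>By \<open>near_dir\<close> and \<open>Phi_orbit\<close>, the number of pairs at distance
  about \<open>\<rho> ^ j\<close> is of the order of \<open>Nn ^ (2 * n) * \<rho> ^ n\<close> times
  the j-th power of b / (Nn \<rho>). The kernel adds \<open>\<rho> powr (- \<tau> * j)\<close>, and
  a geometric series in b / G results.\<close>

lemma directional_energy:
  assumes bet: "\<beta> \<in> {0..<pi} - exc_dirs"
  shows "\<exists>C>0. \<forall>n. (\<Sum>x\<in>dirpairs n \<beta>. max (norm (pt \<mu> (fst x) - pt \<mu> (snd x))) (\<rho> ^ n) powr (- \<tau>))
     \<le> C * N {0, \<Delta>} ^ (2 * n) * \<rho> ^ n"
proof -
  define X where "X = 2 * R"
  have X: "X \<ge> 1" using R_ge_1 by (simp add: X_def)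
  define CX where "CX = (4 * (X + 2 * R) / r0 + 5)\<^sup>2"
  have CX: "CX > 0" using X R_ge_1 r0 by (simp add: CX_def add_pos_nonneg add_nonneg_pos zero_less_power2) (smt (verit) divide_nonneg_pos)
  define Nn where "Nn = N {0, \<Delta>}"
  have N0: "Nn > 0" unfolding Nn_def by (rule N_pos[OF Z2])
  define G where "G = Nn * \<rho> powr (1 + \<tau>)"
  have G: "G > 1"
  proof -
    have "real (card D) * \<rho> powr (1 + \<tau>) \<le> G"
      unfolding G_def Nn_def using N_ge[OF Z2] by (intro mult_right_mono) auto
    thus ?thesis using size by linarith
  qed
  \<comment> \<open>Any value strictly between 1 and G would do: \<open>size\<close> is what leaves
    room for the exponential loss along the orbit.\<close>
  define b where "b = (1 + G) / 2"
  have b: "b > 1" "b < G" using G by (auto simp: b_def)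
  obtain C where C: "C > 0" "\<And>m j. \<Phi> m (\<omega> ^ j * cis \<beta>) \<le> C * b ^ j * \<rho> ^ m"
    using Phi_orbit[OF bet b(1)] by blast
  define Cf where "Cf = 20 * CX * C * \<rho> powr (- \<tau>) / (1 - b / G)"
  have bG: "0 \<le> b / G" "b / G < 1" using b by auto
  have "(\<Sum>x\<in>dirpairs n \<beta>. max (norm (pt \<mu> (fst x) - pt \<mu> (snd x))) (\<rho> ^ n) powr (- \<tau>)) \<le> Cf * Nn ^ (2 * n) * \<rho> ^ n" for n
  proof -
    have rp: "\<rho> ^ k > 0" for k using mu_pos by simp
    let ?t = "\<lambda>x. norm (pt \<mu> (fst x) - pt \<mu> (snd x))"
    have "(\<Sum>x\<in>dirpairs n \<beta>. max (?t x) (\<rho> ^ n) powr (- \<tau>))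
      \<le> (\<Sum>j\<le>n. (\<rho> ^ Suc j) powr (- \<tau>) * real (card {x \<in> dirpairs n \<beta>. ?t x \<le> X * \<rho> ^ j}))"
    proof (rule sum_by_scale[OF mu_pos mu_less])
      show "finite (dirpairs n \<beta>)" by (simp add: dirpairs_def finP[OF Z2])
      show "0 \<le> (\<rho> ^ Suc j) powr (- \<tau>)" for j by simp
      fix x assume "x \<in> dirpairs n \<beta>"
      hence x: "fst x \<in> P {0, \<Delta>} n" "snd x \<in> P {0, \<Delta>} n" by (auto simp: dirpairs_def)
      show "?t x \<le> X"
        using norm_pt[OF Z2 x(1)] norm_pt[OF Z2 x(2)] norm_triangle_ineq4[of "pt \<mu> (fst x)" "pt \<mu> (snd x)"]
        by (auto simp: X_def)
      fix j assume j: "j \<le> n" "j = n \<or> X * \<rho> ^ Suc j < ?t x"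
      have "\<rho> ^ Suc j \<le> max (?t x) (\<rho> ^ n)"
      proof (cases "j = n")
        case True
        have "\<rho> ^ Suc n \<le> \<rho> ^ n" using mu_pos mu_less by (intro power_decreasing) auto
        thus ?thesis using True by simp
      next
        case False
        have "1 * \<rho> ^ Suc j \<le> X * \<rho> ^ Suc j" using X rp by (intro mult_right_mono) auto
        thus ?thesis using j False by auto
      qed
      thus "max (?t x) (\<rho> ^ n) powr (- \<tau>) \<le> (\<rho> ^ Suc j) powr (- \<tau>)"
        using tau rp[of "Suc j"] by (intro powr_mono2') simp_all
    qed
    also have "\<dots> \<le> (\<Sum>j\<le>n. (20 * CX * C * \<rho> powr (- \<tau>) * Nn ^ (2 * n) * \<rho> ^ n) * (b / G) ^ j)"
    proof (rule sum_mono)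
      fix j assume "j \<in> {..n}"
      hence j: "j \<le> n" by simp
      have "real (card {x \<in> dirpairs n \<beta>. ?t x \<le> X * \<rho> ^ j}) \<le> 5 * CX * Nn ^ j * corr {0, \<Delta>} (n - j) (\<omega> ^ j * cis \<beta>)"
      proof -
        have "{x \<in> dirpairs n \<beta>. ?t x \<le> X * \<rho> ^ j} = {x \<in> P {0, \<Delta>} n \<times> P {0, \<Delta>} n. ?t x \<le> X * \<rho> ^ j \<and>
          \<bar>inner (cis \<beta>) (pt \<mu> (fst x)) - inner (cis \<beta>) (pt \<mu> (snd x))\<bar> \<le> \<rho> ^ n}"
          by (auto simp: dirpairs_def)
        thus ?thesis unfolding CX_def Nn_def using near_dir[OF Z2 _ j, of X "cis \<beta>"] X by simp
      qed
      also have "\<dots> \<le> 5 * CX * Nn ^ j * (4 * Nn ^ (2 * (n - j)) * \<Phi> (n - j) (\<omega> ^ j * cis \<beta>))"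
        using CX N0 corr_le_Phi[of "n - j"] unfolding Nn_def by (intro mult_left_mono) auto
      also have "\<dots> \<le> 5 * CX * Nn ^ j * (4 * Nn ^ (2 * (n - j)) * (C * b ^ j * \<rho> ^ (n - j)))"
        using CX N0 by (intro mult_left_mono C(2)) auto
      finally have "(\<rho> ^ Suc j) powr (- \<tau>) * real (card {x \<in> dirpairs n \<beta>. ?t x \<le> X * \<rho> ^ j})
        \<le> (\<rho> ^ Suc j) powr (- \<tau>) * (5 * CX * Nn ^ j * (4 * Nn ^ (2 * (n - j)) * (C * b ^ j * \<rho> ^ (n - j))))"
        by (rule mult_left_mono) simp
      also have "\<dots> = (20 * CX * C * \<rho> powr (- \<tau>) * Nn ^ (2 * n) * \<rho> ^ n) * (b / G) ^ j"
      proof -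
        define k where "k = n - j"
        have n: "n = k + j" using j by (simp add: k_def)
        have p1: "(\<rho> ^ Suc j) powr (- \<tau>) = \<rho> powr (- \<tau>) * (\<rho> powr (- \<tau>)) ^ j"
          using mu_ne by (simp add: powr_mult powr_power powr_powr mult.commute flip: powr_realpow)
        have p2: "G = Nn * (\<rho> / \<rho> powr (- \<tau>))"
          unfolding G_def using mu_ne by (simp add: powr_add powr_minus field_simps)
        have pt0: "\<rho> powr (- \<tau>) > 0" using mu_ne by simp
        have "(b / G) ^ j = b ^ j * (\<rho> powr (- \<tau>)) ^ j / (Nn ^ j * \<rho> ^ j)"
          unfolding p2 by (simp add: power_divide power_mult_distrib)
        moreover have "Nn ^ (2 * n) = Nn ^ j * Nn ^ j * Nn ^ (2 * k)" "\<rho> ^ n = \<rho> ^ k * \<rho> ^ j"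
          by (simp_all add: n power_add mult_2)
        ultimately show ?thesis unfolding p1 k_def[symmetric] using N0 mu_ne by simp
      qed
      finally show "(\<rho> ^ Suc j) powr (- \<tau>) * real (card {x \<in> dirpairs n \<beta>. ?t x \<le> X * \<rho> ^ j})
         \<le> (20 * CX * C * \<rho> powr (- \<tau>) * Nn ^ (2 * n) * \<rho> ^ n) * (b / G) ^ j" .
    qed
    also have "\<dots> = (20 * CX * C * \<rho> powr (- \<tau>) * Nn ^ (2 * n) * \<rho> ^ n) * (\<Sum>j\<le>n. (b / G) ^ j)"
      by (simp only: sum_distrib_left)
    also have "\<dots> \<le> (20 * CX * C * \<rho> powr (- \<tau>) * Nn ^ (2 * n) * \<rho> ^ n) * (1 / (1 - b / G))"
      using CX C N0 by (intro mult_left_mono sum_rho_bound bG) auto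
    also have "\<dots> = Cf * Nn ^ (2 * n) * \<rho> ^ n" by (simp add: Cf_def)
    finally show ?thesis .
  qed
  moreover have "Cf > 0" using CX C(1) mu_ne bG by (simp add: Cf_def)
  ultimately show ?thesis unfolding Nn_def by blast
qed

end

section \<open>Homogeneous subsystems of a planar iterated function system\<close>

lemma sum_words_prod_list:
  fixes f :: "'a \<Rightarrow> real"
  shows "(\<Sum>u\<in>words A n. prod_list (map f u)) = (\<Sum>a\<in>A. f a) ^ n"
proof (induction n)
  case (Suc n)
  show ?case unfolding sum_words_Suc
    by (simp add: Suc.IH flip: sum_distrib_left sum_distrib_right)
qed simp

lemma poly_times_power_tendsto_0:
  fixes x :: real
  assumes x: "0 < x" "x < 1" and m: "m > 0"
  shows "(\<lambda>L. (real L + 1) ^ m * x ^ L) \<longlonglongrightarrow> 0"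
proof -
  define y where "y = x powr (1 / m)"
  have y: "0 < y" "y < 1" using x m powr_less_mono2[of "1 / m" x 1] by (auto simp: y_def)
  have ym: "y ^ m = x" using x m by (simp add: y_def powr_power)
  have "(\<lambda>L. real L * y ^ L + y ^ L) \<longlonglongrightarrow> 0 + 0"
    using y by (intro tendsto_add powser_times_n_limit_0 LIMSEQ_power_zero) auto
  hence "(\<lambda>L. (real L * y ^ L + y ^ L) ^ m) \<longlonglongrightarrow> (0 + 0) ^ m" by (rule tendsto_power)
  moreover have "(real L * y ^ L + y ^ L) ^ m = (real L + 1) ^ m * x ^ L" for L
  proof -
    have "(real L * y ^ L + y ^ L) ^ m = ((real L + 1) * y ^ L) ^ m" by (simp add: algebra_simps)
    also have "\<dots> = (real L + 1) ^ m * (y ^ m) ^ L" by (simp add: power_mult_distrib mult.commute flip: power_mult)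
    finally show ?thesis by (simp add: ym)
  qed
  ultimately show ?thesis using m by (simp add: zero_power)
qed

text \<open>If all rotations had finite order, the group would consist of p-th roots of unity for a
  common p. These form a closed set that misses \<open>cis (pi / p)\<close>.\<close>

lemma dense_rotations_irrational:
  fixes \<theta> :: "nat \<Rightarrow> real"
  assumes "closure {cis (\<Sum>i<m. of_int (n i) * \<theta> i) | n :: nat \<Rightarrow> int. True} = sphere 0 1"
  shows "\<exists>l<m. \<forall>k>0. cis (\<theta> l) ^ k \<noteq> 1"
proof (rule ccontr)
  assume "\<not> (\<exists>l<m. \<forall>k>0. cis (\<theta> l) ^ k \<noteq> 1)"
  hence "\<forall>l. \<exists>k. l < m \<longrightarrow> k > 0 \<and> cis (\<theta> l) ^ k = 1" by blast
  from choice[OF this] obtain k where k: "\<And>l. l < m \<Longrightarrow> k l > 0 \<and> cis (\<theta> l) ^ k l = 1" by blast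
  define p where "p = (\<Prod>l<m. k l)"
  have p: "p > 0" unfolding p_def using k by (intro prod_pos) auto
  have kp: "cis (\<theta> l) ^ p = 1" if "l < m" for l
  proof -
    have "k l dvd p" unfolding p_def using that by (intro dvd_prodI) auto
    then obtain d where "p = k l * d" by (elim dvdE)
    thus ?thesis using k[OF that] by (simp add: power_mult)
  qed
  have "{cis (\<Sum>i<m. of_int (n i) * \<theta> i) | n :: nat \<Rightarrow> int. True} \<subseteq> {z. z ^ p = 1}"
  proof
    fix z assume "z \<in> {cis (\<Sum>i<m. of_int (n i) * \<theta> i) | n :: nat \<Rightarrow> int. True}"
    then obtain n :: "nat \<Rightarrow> int" where z: "z = cis (\<Sum>i<m. of_int (n i) * \<theta> i)" by blast
    have "cis (\<Sum>i<M. of_int (n i) * \<theta> i) ^ p = 1" if "M \<le> m" for M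
      using that
    proof (induction M)
      case (Suc M)
      have "cis (of_int (n M) * \<theta> M) ^ p = (cis (\<theta> M) ^ p) powi n M"
        by (simp add: Complex.DeMoivre cis_power_int mult_ac)
      also have "\<dots> = 1" using kp[of M] Suc.prems by simp
      finally have "cis (of_int (n M) * \<theta> M) ^ p = 1" .
      moreover have "cis (\<Sum>i<Suc M. of_int (n i) * \<theta> i) = cis (\<Sum>i<M. of_int (n i) * \<theta> i) * cis (of_int (n M) * \<theta> M)"
        by (simp add: cis_mult)
      ultimately show ?case using Suc by (simp add: power_mult_distrib)
    qed simp
    thus "z \<in> {z. z ^ p = 1}" using z by simp
  qed
  moreover have "closed {z::complex. z ^ p = 1}" by (intro closed_Collect_eq continuous_intros)
  ultimately have "sphere 0 1 \<subseteq> {z::complex. z ^ p = 1}" unfolding assms[symmetric] by (rule closure_minimal)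
  moreover have "cis (pi / p) \<in> sphere 0 1" by simp
  ultimately have "cis (pi / p) ^ p = 1" by blast
  moreover have "cis (pi / p) ^ p = cis pi" using p by (simp add: Complex.DeMoivre)
  ultimately show False by (simp add: cis_pi)
qed

locale ifs =
  fixes m :: nat and c a :: "nat \<Rightarrow> complex"
  assumes c: "\<And>i. i < m \<Longrightarrow> 0 < norm (c i) \<and> norm (c i) < 1"
begin

text \<open>The map of a word \<open>w\<close> is z to \<open>wt w + wl w * z\<close>, where the
  first letter acts last.\<close>

definition wl :: "nat list \<Rightarrow> complex" where "wl w = prod_list (map c w)"

primrec wt :: "nat list \<Rightarrow> complex" where
  "wt [] = 0"
| "wt (i # w) = a i + c i * wt w"

lemma wl_append: "wl (u @ v) = wl u * wl v" by (simp add: wl_def)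

lemma wt_append: "wt (u @ v) = wt u + wl u * wt v"
  by (induction u) (auto simp: wl_def algebra_simps)

lemma wl_pos: "set w \<subseteq> {..<m} \<Longrightarrow> 0 < norm (wl w)"
  using c by (induction w) (auto simp: wl_def norm_mult)

text \<open>Linear parts of orientation preserving plane similitudes are complex numbers and so
  commute; only the letter counts matter.\<close>

lemma wl_counts: "set w \<subseteq> {..<m} \<Longrightarrow> wl w = (\<Prod>i<m. c i ^ count_list w i)"
proof (induction w)
  case (Cons j w)
  have "(\<Prod>i<m. c i ^ count_list (j # w) i) = (\<Prod>i<m. (if i = j then c i else 1) * c i ^ count_list w i)"
    by (intro prod.cong refl) auto
  also have "\<dots> = c j * (\<Prod>i<m. c i ^ count_list w i)"
    using Cons.prems by (simp add: prod.distrib prod.delta)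
  finally show ?case using Cons by (simp add: wl_def)
qed (simp add: wl_def)

lemma wmap_mem:
  assumes K: "\<And>i z. i < m \<Longrightarrow> z \<in> K \<Longrightarrow> a i + c i * z \<in> K"
  shows "set w \<subseteq> {..<m} \<Longrightarrow> z \<in> K \<Longrightarrow> wt w + wl w * z \<in> K"
proof (induction w)
  case (Cons i w)
  hence "a i + c i * (wt w + wl w * z) \<in> K" by (intro K) auto
  thus ?case by (simp add: wl_def algebra_simps)
qed (simp add: wl_def)

text \<open>Distinct words of equal length map \<open>U\<close> to disjoint sets. When their linear
  parts agree, the maps differ by a translation, and a translation shorter than r1 |wl w| would make
  the images of a ball of radius \<open>r1\<close> in \<open>U\<close> overlap.\<close>

lemma word_sep:
  assumes U: "open U" "U \<noteq> {}" "\<And>i z. i < m \<Longrightarrow> z \<in> U \<Longrightarrow> a i + c i * z \<in> U"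
    and disj: "\<And>i j z z'. i < m \<Longrightarrow> j < m \<Longrightarrow> z \<in> U \<Longrightarrow> z' \<in> U \<Longrightarrow> a i + c i * z = a j + c j * z' \<Longrightarrow> i = j"
  shows "\<exists>r1>0. \<forall>w w'. set w \<subseteq> {..<m} \<longrightarrow> set w' \<subseteq> {..<m} \<longrightarrow> length w = length w' \<longrightarrow> wl w = wl w' \<longrightarrow>
     w \<noteq> w' \<longrightarrow> r1 * norm (wl w) \<le> norm (wt w - wt w')"
proof -
  obtain z0 r1 where r1: "r1 > 0" "ball z0 r1 \<subseteq> U" using U(1,2) openE by blast
  have eq: "w = w'" if "length w = length w'" "set w \<subseteq> {..<m}" "set w' \<subseteq> {..<m}" "z \<in> U" "z' \<in> U"
    "wt w + wl w * z = wt w' + wl w' * z'" for w w' z z'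
    using that
  proof (induction w w' rule: list_induct2)
    case (Cons i w j w')
    have e: "a i + c i * (wt w + wl w * z) = a j + c j * (wt w' + wl w' * z')"
      using Cons.prems by (simp add: wl_def algebra_simps)
    have "wt w + wl w * z \<in> U" "wt w' + wl w' * z' \<in> U"
      using wmap_mem[OF U(3)] Cons.prems by auto
    hence ij: "i = j" using disj[OF _ _ _ _ e] Cons.prems by auto
    have "c i \<noteq> 0" using c[of i] Cons.prems by auto
    hence "wt w + wl w * z = wt w' + wl w' * z'" using e ij by simp
    thus ?case using Cons ij by auto
  qed simp
  have "r1 * norm (wl w) \<le> norm (wt w - wt w')"
    if w: "set w \<subseteq> {..<m}" "set w' \<subseteq> {..<m}" "length w = length w'" "wl w = wl w'" "w \<noteq> w'" for w w'
  proof (rule ccontr)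
    assume h: "\<not> r1 * norm (wl w) \<le> norm (wt w - wt w')"
    have lw: "norm (wl w) > 0" using wl_pos[OF w(1)] .
    \<comment> \<open>The point whose image under \<open>w\<close> is the image of the centre
      \<open>z0\<close> under \<open>w'\<close>; closeness of the translations puts it into the
      ball.\<close>
    define z where "z = z0 + (wt w' - wt w) / wl w"
    have "norm (z - z0) = norm (wt w - wt w') / norm (wl w)"
      by (simp add: z_def norm_divide norm_minus_commute)
    also have "\<dots> < r1" using h lw by (simp add: divide_less_eq)
    finally have "z \<in> U" using r1 by (auto simp: dist_norm norm_minus_commute)
    moreover have "z0 \<in> U" using r1 by auto
    moreover have "wt w + wl w * z = wt w' + wl w' * z0"
      using lw w(4) by (auto simp: z_def algebra_simps diff_divide_distrib)
    ultimately show False using eq[OF w(3,1,2)] w(5) by blast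
  qed
  thus ?thesis using r1(1) by blast
qed

text \<open>Pigeonhole on the letter counts, of which there are only polynomially many.\<close>

lemma homogeneous_class:
  assumes s: "(\<Sum>i<m. norm (c i) powr s) = 1" and t: "0 \<le> t" "t < s" and m: "m > 0"
  shows "\<exists>L Cl l1. Cl \<subseteq> words {..<m} L \<and> (\<forall>w\<in>Cl. wl w = l1) \<and> Cl \<noteq> {} \<and> B < real (card Cl) * norm l1 powr t"
proof -
  define rm where "rm = Max ((\<lambda>i. norm (c i)) ` {..<m})"
  have ne: "(\<lambda>i. norm (c i)) ` {..<m} \<noteq> {}" using m by auto
  have "rm \<in> (\<lambda>i. norm (c i)) ` {..<m}" unfolding rm_def using ne by (intro Max_in) auto
  hence rm: "0 < rm" "rm < 1" using c by auto
  have rm_ge: "norm (c i) \<le> rm" if "i < m" for i unfolding rm_def using that by (intro Max_ge) auto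
  \<comment> \<open>With exponent s the words of length L have total weight 1, so some class of
    equal letter counts weighs at least \<open>1 / (L + 1) ^ m\<close>. Lowering the exponent to t
    gains at least \<open>(1 / x) ^ L\<close>, which outgrows the polynomial.\<close>
  define x where "x = rm powr (s - t)"
  have x: "0 < x" "x < 1" using rm t powr_less_mono2[of "s - t" rm 1] by (auto simp: x_def)
  have "eventually (\<lambda>L. (real L + 1) ^ m * x ^ L < 1 / (\<bar>B\<bar> + 1)) sequentially"
    using poly_times_power_tendsto_0[OF x m] by (rule order_tendstoD) simp
  then obtain L where L: "(real L + 1) ^ m * x ^ L < 1 / (\<bar>B\<bar> + 1)"
    by (auto simp: eventually_sequentially)
  define W where "W = words {..<m} L"
  have fW: "finite W" by (simp add: W_def)
  have Wm: "set w \<subseteq> {..<m}" "length w = L" if "w \<in> W" for w using that by (auto simp: W_def words_def)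
  define f where "f w = map (count_list w) [0..<m]" for w :: "nat list"
  define g where "g w = norm (wl w) powr s" for w
  have sum1: "(\<Sum>w\<in>W. g w) = 1"
  proof -
    have "norm (wl w) powr s = prod_list (map (\<lambda>i. norm (c i) powr s) w)" for w
      by (induction w) (auto simp: wl_def norm_mult powr_mult)
    thus ?thesis unfolding g_def W_def using sum_words_prod_list[of "\<lambda>i. norm (c i) powr s" "{..<m}" L] s by simp
  qed
  have cf: "real (card (f ` W)) \<le> (real L + 1) ^ m"
  proof -
    have "f ` W \<subseteq> words {..L} m"
    proof
      fix y assume "y \<in> f ` W"
      then obtain w where w: "w \<in> W" "y = f w" by blast
      have "count_list w i \<le> L" for i using count_le_length[of w i] Wm(2)[OF w(1)] by simp
      thus "y \<in> words {..L} m" by (auto simp: w words_def f_def)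
    qed
    hence "card (f ` W) \<le> card (words {..L} m)" by (intro card_mono) auto
    hence "real (card (f ` W)) \<le> real (Suc L ^ m)" by (simp only: card_words finite_atMost card_atMost of_nat_le_iff)
    thus ?thesis by (simp add: add.commute)
  qed
  have Lp: "(real L + 1) ^ m > 0" by simp
  obtain y where y: "y \<in> f ` W" "1 / (real L + 1) ^ m \<le> (\<Sum>w\<in>{w \<in> W. f w = y}. g w)"
  proof (rule ccontr)
    assume "\<not> thesis"
    hence h: "(\<Sum>w\<in>{w \<in> W. f w = y}. g w) < 1 / (real L + 1) ^ m" if "y \<in> f ` W" for y
      using that \<open>\<And>y. y \<in> f ` W \<Longrightarrow> 1 / (real L + 1) ^ m \<le> sum g {w \<in> W. f w = y} \<Longrightarrow> thesis\<close> by (meson not_le)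
    have neW: "f ` W \<noteq> {}" using sum1 by auto
    have "1 = (\<Sum>y\<in>f ` W. \<Sum>w\<in>{w \<in> W. f w = y}. g w)" using sum.image_gen[OF fW, of g f] sum1 by simp
    also have "\<dots> < (\<Sum>y\<in>f ` W. 1 / (real L + 1) ^ m)"
      using fW neW h by (intro sum_strict_mono) auto
    also have "\<dots> \<le> 1" using cf Lp by (simp add: divide_le_eq)
    finally show False by simp
  qed
  define Cl where "Cl = {w \<in> W. f w = y}"
  obtain w0 where w0: "w0 \<in> W" "y = f w0" using y(1) by blast
  have ClW: "w \<in> W" if "w \<in> Cl" for w using that by (simp add: Cl_def)
  define l1 where "l1 = wl w0"
  have same: "wl w = l1" if "w \<in> Cl" for w
  proof -
    have "f w = f w0" using that w0 by (simp add: Cl_def)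
    hence "count_list w i = count_list w0 i" if "i < m" for i using that by (simp add: f_def)
    thus ?thesis unfolding l1_def using wl_counts[OF Wm(1)[OF ClW[OF that]]] wl_counts[OF Wm(1)[OF w0(1)]] by simp
  qed
  have l1p: "norm l1 > 0" unfolding l1_def using wl_pos[OF Wm(1)[OF w0(1)]] .
  have "norm (wl w) \<le> rm ^ length w" if "set w \<subseteq> {..<m}" for w
    using that
  proof (induction w)
    case (Cons i w)
    have "norm (wl (i # w)) = norm (c i) * norm (wl w)" by (simp add: wl_def norm_mult)
    also have "\<dots> \<le> rm * rm ^ length w" using Cons rm rm_ge by (intro mult_mono) auto
    finally show ?case by simp
  qed (simp add: wl_def)
  hence l1r: "norm l1 \<le> rm ^ L" unfolding l1_def using Wm[OF w0(1)] by metis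
  have "1 / (real L + 1) ^ m \<le> (\<Sum>w\<in>Cl. g w)" using y(2) by (simp add: Cl_def)
  also have "\<dots> = real (card Cl) * norm l1 powr s" by (simp add: g_def same)
  also have "\<dots> = real (card Cl) * norm l1 powr t * norm l1 powr (s - t)"
    by (simp flip: powr_add)
  also have "\<dots> \<le> real (card Cl) * norm l1 powr t * x ^ L"
  proof (rule mult_left_mono)
    have "norm l1 powr (s - t) \<le> (rm ^ L) powr (s - t)" using l1r t by (intro powr_mono2) auto
    also have "\<dots> = x ^ L"
    proof -
      have "(rm ^ L) powr (s - t) = rm powr (L * (s - t))" using rm by (simp add: powr_powr flip: powr_realpow)
      also have "\<dots> = x ^ L" using rm by (simp add: x_def powr_power mult.commute)
      finally show ?thesis .
    qed
    finally show "norm l1 powr (s - t) \<le> x ^ L" .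
  qed simp
  finally have "1 \<le> real (card Cl) * norm l1 powr t * x ^ L * (real L + 1) ^ m"
    using Lp by (simp add: divide_le_eq)
  hence main: "1 \<le> real (card Cl) * norm l1 powr t * ((real L + 1) ^ m * x ^ L)" by (simp add: mult_ac)
  define Z where "Z = real (card Cl) * norm l1 powr t"
  have Z0: "Z \<ge> 0" by (simp add: Z_def)
  have "1 \<le> Z * ((real L + 1) ^ m * x ^ L)" using main by (simp only: Z_def)
  also have "\<dots> \<le> Z * (1 / (\<bar>B\<bar> + 1))" using Z0 L by (intro mult_left_mono) auto
  finally have "1 \<le> Z * (1 / (\<bar>B\<bar> + 1))" .
  moreover have "b \<le> Z" if "1 \<le> Z * (1 / b)" "b > 0" for b using that by (simp add: field_simps)
  ultimately have "\<bar>B\<bar> + 1 \<le> Z" by auto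
  hence "B < Z" by linarith
  moreover have "Cl \<noteq> {}" using w0 by (auto simp: Cl_def)
  ultimately show ?thesis using same ClW unfolding Z_def W_def by blast
qed

text \<open>If both \<open>A\<close> and \<open>A * c i\<close> had a real power, so would their
  quotient. Appending one irrational letter when necessary hence makes a rotation
  irrational.\<close>

lemma real_power_quotient:
  assumes "i < m" and A: "A \<noteq> 0" and k: "k > 0" "Im (A ^ k) = 0" "k' > 0" "Im ((A * c i) ^ k') = 0"
  shows "\<exists>n>0. Im (c i ^ n) = 0"
proof -
  have r: "z ^ j \<in> \<real>" if "z \<in> \<real>" for z :: complex and j using that by (rule Reals_power)
  have 1: "A ^ (k * k') \<in> \<real>" using k(2) r[of "A ^ k" k'] by (simp add: power_mult complex_is_Real_iff)
  have 2: "(A * c i) ^ (k * k') \<in> \<real>"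
    using k(4) r[of "(A * c i) ^ k'" k] by (simp only: mult.commute[of k k'] power_mult complex_is_Real_iff)
  have "c i ^ (k * k') = (A * c i) ^ (k * k') / A ^ (k * k')" using A by (simp add: power_mult_distrib)
  also have "\<dots> \<in> \<real>" using 1 2 by (rule Reals_divide[rotated])
  finally show ?thesis using k by (intro exI[of _ "k * k'"]) (auto simp: complex_is_Real_iff)
qed

text \<open>The words 01 and 10 have the same linear part and different translations; appended to
  the words of one class they produce the digits 0 and \<Delta>. Appending costs the contraction of
  a few letters, so the class is taken with weight above \<open>1 / \<nu> powr t\<close> to keep
  \<open>size\<close>.\<close>

theorem homogeneous_subsystem:
  assumes m: "m \<ge> 2" and s: "(\<Sum>i<m. norm (c i) powr s) = 1" and tau: "\<tau> > 0" "1 + \<tau> < s"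
    and l: "l < m" "\<And>k. k > 0 \<Longrightarrow> Im (c l ^ k) \<noteq> 0"
    and U: "open U" "U \<noteq> {}" "\<And>i z. i < m \<Longrightarrow> z \<in> U \<Longrightarrow> a i + c i * z \<in> U"
    and disj: "\<And>i j z z'. i < m \<Longrightarrow> j < m \<Longrightarrow> z \<in> U \<Longrightarrow> z' \<in> U \<Longrightarrow> a i + c i * z = a j + c j * z' \<Longrightarrow> i = j"
    and K: "\<And>i z. i < m \<Longrightarrow> z \<in> K \<Longrightarrow> a i + c i * z \<in> K"
  shows "\<exists>D \<Delta> \<mu> r0. hom_sys D \<Delta> \<mu> r0 \<tau> \<and>
     (\<forall>n. \<forall>p\<in>words D n \<times> words {0, \<Delta>} n. \<forall>z\<in>K. pt \<mu> p + \<mu> ^ n * z \<in> K)"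
proof -
  obtain r1 where r1: "r1 > 0" "\<And>w w'. set w \<subseteq> {..<m} \<Longrightarrow> set w' \<subseteq> {..<m} \<Longrightarrow> length w = length w' \<Longrightarrow> wl w = wl w' \<Longrightarrow>
     w \<noteq> w' \<Longrightarrow> r1 * norm (wl w) \<le> norm (wt w - wt w')"
  proof -
    have "\<exists>r1>0. \<forall>w w'. set w \<subseteq> {..<m} \<longrightarrow> set w' \<subseteq> {..<m} \<longrightarrow> length w = length w' \<longrightarrow> wl w = wl w' \<longrightarrow>
       w \<noteq> w' \<longrightarrow> r1 * norm (wl w) \<le> norm (wt w - wt w')"
      by (rule word_sep[of U]) (fact U(1), fact U(2), rule U(3), assumption, assumption, rule disj, assumption+)
    thus ?thesis using that by blast
  qed
  define t where "t = 1 + \<tau>"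
  have t: "0 \<le> t" "t < s" using tau by (auto simp: t_def)
  \<comment> \<open>A lower bound for the contraction of whatever is appended. It is fixed before
    the class, because whether \<open>l\<close> gets appended depends on the class.\<close>
  define \<nu> where "\<nu> = norm (c l * (c 0 * c 1))"
  have c01: "0 < norm (c 0 * c 1)" "norm (c 0 * c 1) < 1"
    using c[of 0] c[of 1] m mult_strict_mono[of "norm (c 0)" 1 "norm (c 1)" 1] by (auto simp: norm_mult)
  have nu: "0 < \<nu>" "\<nu> \<le> norm (c 0 * c 1)"
    using c[OF l(1)] c01 by (auto simp: \<nu>_def norm_mult intro!: mult_left_le_one_le)
  obtain L Cl l1 where Cl: "Cl \<subseteq> words {..<m} L" "\<And>w. w \<in> Cl \<Longrightarrow> wl w = l1" "Cl \<noteq> {}"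
    "1 / \<nu> powr t < real (card Cl) * norm l1 powr t"
    using homogeneous_class[OF s t, of "1 / \<nu> powr t"] m by (metis gr0I not_numeral_le_zero)
  have Cm: "set w \<subseteq> {..<m}" "length w = L" if "w \<in> Cl" for w using Cl(1) that by (auto simp: words_def)
  have l1: "norm l1 > 0" using Cl(2,3) Cm(1) wl_pos by (metis ex_in_conv)
  define A where "A = l1 * (c 0 * c 1)"
  have A0: "A \<noteq> 0" using l1 c01 by (auto simp: A_def)
  \<comment> \<open>The letter \<open>l\<close> is inserted if the class followed by 01 has a linear
    part with a real power.\<close>
  define e where "e = (if \<exists>k>0. Im (A ^ k) = 0 then [l] else [])"
  have em: "set e \<subseteq> {..<m}" using l by (auto simp: e_def)
  define v0 where "v0 = e @ [0, 1]"
  define v1 where "v1 = e @ [1, 0]"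
  define l2 where "l2 = wl v0"
  have vm: "set v0 \<subseteq> {..<m}" "set v1 \<subseteq> {..<m}" using em m by (auto simp: v0_def v1_def)
  have vne: "v0 \<noteq> v1" and vlen: "length v0 = length v1" by (auto simp: v0_def v1_def)
  have wl1: "wl v1 = l2" by (simp add: l2_def v0_def v1_def wl_append) (simp add: wl_def mult.commute)
  have l2e: "l2 = wl e * (c 0 * c 1)" by (simp add: l2_def v0_def wl_append) (simp add: wl_def)
  define \<mu> where "\<mu> = l1 * l2"
  have irr: "Im (\<mu> ^ k) \<noteq> 0" if k: "k > 0" for k
  proof (cases "\<exists>k>0. Im (A ^ k) = 0")
    case True
    then obtain k' where k': "k' > 0" "Im (A ^ k') = 0" by blast
    have "e = [l]" using True by (simp only: e_def if_True)
    hence "\<mu> = A * c l" by (simp add: \<mu>_def l2e A_def wl_def)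
    thus ?thesis using real_power_quotient[OF l(1) A0 k' k] l(2) by auto
  next
    case False
    have "e = []" using False by (simp only: e_def if_False)
    hence "\<mu> = A" by (simp add: \<mu>_def l2e A_def wl_def)
    thus ?thesis using False k by metis
  qed
  have nul2: "\<nu> \<le> norm l2" "norm l2 < 1"
  proof -
    have "norm l2 = norm (wl e) * norm (c 0 * c 1)" by (simp add: l2e norm_mult)
    moreover have "norm (wl e) = norm (c l) \<or> norm (wl e) = 1" by (auto simp: e_def wl_def)
    ultimately have "norm l2 = \<nu> \<or> norm l2 = norm (c 0 * c 1)" by (auto simp: \<nu>_def norm_mult)
    thus "\<nu> \<le> norm l2" "norm l2 < 1" using nu c01 by auto
  qed
  have l1le: "norm l1 \<le> 1"
  proof -
    have "norm (wl w) \<le> 1" if "set w \<subseteq> {..<m}" for w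
      using that
    proof (induction w)
      case (Cons i w)
      thus ?case using c[of i] mult_mono[of "norm (c i)" 1 "norm (wl w)" 1] by (auto simp: wl_def norm_mult)
    qed (simp add: wl_def)
    thus ?thesis using Cl(2,3) Cm(1) by (metis ex_in_conv)
  qed
  have mu: "0 < norm \<mu>" "norm \<mu> < 1"
  proof -
    show "0 < norm \<mu>" using l1 nul2 nu by (auto simp: \<mu>_def)
    have "norm \<mu> \<le> 1 * norm l2" unfolding \<mu>_def norm_mult using l1le by (intro mult_right_mono) auto
    thus "norm \<mu> < 1" using nul2 by simp
  qed
  \<comment> \<open>The translation of \<open>v0\<close> is absorbed into \<open>D\<close>, so that
    \<open>v0\<close> becomes the digit 0 and \<open>v1\<close> the digit
    \<open>\<Delta>\<close>.\<close>
  define D where "D = (\<lambda>w. wt w + l1 * wt v0) ` Cl"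
  define \<Delta> where "\<Delta> = l1 * (wt v1 - wt v0)"
  have wtinj: "wt w \<noteq> wt w'" if "set w \<subseteq> {..<m}" "set w' \<subseteq> {..<m}" "length w = length w'" "wl w = wl w'" "w \<noteq> w'" for w w'
  proof
    assume "wt w = wt w'"
    hence "r1 * norm (wl w) \<le> 0" using r1(2)[OF that] by simp
    thus False using r1(1) wl_pos[OF that(1)] by (simp add: mult_le_0_iff)
  qed
  have finCl: "finite Cl" using Cl(1) by (rule finite_subset) simp
  have injCl: "inj_on wt Cl" using wtinj Cm Cl(2) by (metis inj_onI)
  have cardD: "card D = card Cl" unfolding D_def
    using injCl by (intro card_image) (auto simp: inj_on_def)
  have D0: "\<Delta> \<noteq> 0" using wtinj[OF vm vlen _ vne] wl1 l1 by (auto simp: \<Delta>_def l2_def)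
  have "\<forall>d. \<exists>w. d \<in> D \<longrightarrow> w \<in> Cl \<and> d = wt w + l1 * wt v0" unfolding D_def by blast
  from choice[OF this] obtain iw where iw: "\<And>d. d \<in> D \<Longrightarrow> iw d \<in> Cl \<and> d = wt (iw d) + l1 * wt v0" by blast
  define vw where "vw b = (if b = 0 then v0 else v1)" for b :: complex
  define blk where "blk d b = iw d @ vw b" for d b
  have blk: "set (blk d b) \<subseteq> {..<m}" "length (blk d b) = L + length v0" "wl (blk d b) = \<mu>" "wt (blk d b) = d + b"
    if "d \<in> D" "b \<in> {0, \<Delta>}" for d b
  proof -
    show "set (blk d b) \<subseteq> {..<m}" using iw[OF that(1)] Cm vm by (auto simp: blk_def vw_def)
    show "length (blk d b) = L + length v0" using iw[OF that(1)] Cm vlen by (auto simp: blk_def vw_def)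
    show "wl (blk d b) = \<mu>" using iw[OF that(1)] Cl(2) wl1 by (auto simp: blk_def vw_def wl_append \<mu>_def l2_def)
    have "wt (blk d b) = wt (iw d) + l1 * wt (vw b)" using iw[OF that(1)] Cl(2) by (simp add: blk_def wt_append)
    also have "wt (vw b) = wt v0 + b / l1" using that(2) D0 l1 by (auto simp: vw_def \<Delta>_def)
    finally show "wt (blk d b) = d + b" using iw[OF that(1)] l1 by (auto simp: algebra_simps)
  qed
  \<comment> \<open>Translates a pair of digit words back into one word of the original system: each
    pair of digits becomes a word of the class followed by \<open>v0\<close> or
    \<open>v1\<close>.\<close>
  define wd where "wd p = concat (map2 blk (fst p) (snd p))" for p
  have wd_Cons: "wd (d # u, b # w) = blk d b @ wd (u, w)" for d u b w by (simp add: wd_def)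
  have wdP: "set (wd p) \<subseteq> {..<m} \<and> length (wd p) = n * (L + length v0) \<and> wl (wd p) = \<mu> ^ n \<and> wt (wd p) = pt \<mu> p"
    if "p \<in> words D n \<times> words {0, \<Delta>} n" for p n
    using that
  proof (induction n arbitrary: p)
    case 0
    thus ?case by (auto simp: wd_def wl_def pt_def)
  next
    case (Suc n)
    then obtain d u b w where p: "p = (d # u, b # w)" "d \<in> D" "b \<in> {0, \<Delta>}" "(u, w) \<in> words D n \<times> words {0, \<Delta>} n"
      by (auto simp: words_Suc)
    note IH = Suc.IH[OF p(4)] and B = blk[OF p(2,3)]
    show ?case using IH B(1,2) unfolding p(1) wd_Cons wl_append wt_append B(3,4)
      by (simp add: pt_def algebra_simps)
  qed
  have wdinj: "p = q" if "p \<in> words D n \<times> words {0, \<Delta>} n" "q \<in> words D n \<times> words {0, \<Delta>} n" "wd p = wd q" for p q n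
    using that
  proof (induction n arbitrary: p q)
    case 0
    thus ?case by auto
  next
    case (Suc n)
    obtain d u b w where p: "p = (d # u, b # w)" "d \<in> D" "b \<in> {0, \<Delta>}" "(u, w) \<in> words D n \<times> words {0, \<Delta>} n"
      using Suc.prems(1) by (auto simp: words_Suc)
    obtain d' u' b' w' where q: "q = (d' # u', b' # w')" "d' \<in> D" "b' \<in> {0, \<Delta>}" "(u', w') \<in> words D n \<times> words {0, \<Delta>} n"
      using Suc.prems(2) by (auto simp: words_Suc)
    have "blk d b @ wd (u, w) = blk d' b' @ wd (u', w')" using Suc.prems(3) by (simp add: p q wd_Cons)
    hence b: "blk d b = blk d' b'" and w: "wd (u, w) = wd (u', w')"
      using blk(2)[OF p(2,3)] blk(2)[OF q(2,3)] by auto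
    have "iw d = iw d'" "vw b = vw b'"
      using b iw[OF p(2)] iw[OF q(2)] Cm(2) by (auto simp: blk_def)
    hence "d = d'" "b = b'" using iw[OF p(2)] iw[OF q(2)] p(3) q(3) D0 vne by (auto simp: vw_def split: if_splits)
    thus ?case using Suc.IH[OF p(4) q(4) w] p q by simp
  qed
  have "hom_sys D \<Delta> \<mu> (min 1 r1) \<tau>"
  proof
    show "finite D" using finCl by (simp add: D_def)
    show "\<Delta> \<noteq> 0" "0 < norm \<mu>" "norm \<mu> < 1" "0 < \<tau>" "0 < min 1 r1" using D0 mu tau r1 by auto
    show "Im (\<mu> ^ k) \<noteq> 0" if "k > 0" for k using irr[OF that] .
    fix n p q assume pq: "p \<in> words D n \<times> words {0, \<Delta>} n" "q \<in> words D n \<times> words {0, \<Delta>} n" "p \<noteq> q"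
    have "r1 * norm (wl (wd p)) \<le> norm (wt (wd p) - wt (wd q))"
      using wdP[OF pq(1)] wdP[OF pq(2)] wdinj[OF pq(1,2)] pq(3) by (intro r1(2)) auto
    hence "r1 * norm \<mu> ^ n \<le> norm (pt \<mu> p - pt \<mu> q)" using wdP[OF pq(1)] wdP[OF pq(2)] by (simp add: norm_power)
    moreover have "min 1 r1 * norm \<mu> ^ n \<le> r1 * norm \<mu> ^ n" by (intro mult_right_mono) auto
    ultimately show "min 1 r1 * norm \<mu> ^ n \<le> norm (pt \<mu> p - pt \<mu> q)" by linarith
  next
    have "1 = 1 / \<nu> powr t * \<nu> powr t" using nu by simp
    also have "\<dots> < real (card Cl) * norm l1 powr t * \<nu> powr t" using Cl(4) nu by (intro mult_strict_right_mono) auto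
    also have "\<dots> \<le> real (card Cl) * norm l1 powr t * norm l2 powr t"
      using nul2 nu t by (intro mult_left_mono powr_mono2) auto
    also have "\<dots> = real (card D) * norm \<mu> powr (1 + \<tau>)"
      by (simp add: cardD \<mu>_def norm_mult powr_mult t_def)
    finally show "1 < real (card D) * norm \<mu> powr (1 + \<tau>)" .
  qed
  moreover have "pt \<mu> p + \<mu> ^ n * z \<in> K" if "p \<in> words D n \<times> words {0, \<Delta>} n" "z \<in> K" for n p z
    using wmap_mem[OF K, of "wd p" z] wdP[OF that(1)] that(2) by simp
  ultimately show ?thesis by blast
qed

end

section \<open>Slices\<close>

text \<open>Finitely many open balls make the property stable when a compact slice is moved
  slightly, which zero content is not. For compact sets, \<open>covered\<close> for every c > 0 is
  the same as zero content, by the two lemmas below.\<close>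

definition covered :: "real \<Rightarrow> real \<Rightarrow> 'a::metric_space set \<Rightarrow> bool" where
  "covered t c A \<longleftrightarrow> (\<exists>\<C>. finite \<C> \<and> (\<forall>b\<in>\<C>. snd b > 0) \<and> A \<subseteq> (\<Union>b\<in>\<C>. ball (fst b) (snd b)) \<and>
     (\<Sum>b\<in>\<C>. snd b powr t) < c)"

text \<open>Each covering set is enlarged to an open ball of radius r with r^t equal to the t-th
  power of its diameter plus a summable error; compactness then leaves finitely many balls.\<close>

lemma covered_if_hcontent_0:
  fixes A :: "'a::metric_space set"
  assumes t: "t > 0" and c: "c > 0" and A: "compact A" and h: "hcontent t A = 0"
  shows "covered t c A"
proof -
  have "hcontent t A < ennreal (c / 2)" using h c by simp
  then obtain U :: "nat \<Rightarrow> 'a set" where U: "A \<subseteq> (\<Union>i. U i)" "\<And>i. bounded (U i)" "(\<Sum>i. hs_term t (U i)) < ennreal (c / 2)"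
    unfolding hcontent_def Inf_less_iff by blast
  define d where "d i = diameter (U i) powr t" for i
  define w where "w i = c / 2 * (1 / 2) ^ Suc i" for i
  define r where "r i = (d i + w i) powr (1 / t)" for i
  have d0: "d i \<ge> 0" and w0: "w i > 0" for i using c by (auto simp: d_def w_def)
  have rt: "r i powr t = d i + w i" for i using t d0[of i] w0[of i] by (simp add: r_def powr_powr)
  have r0: "r i > 0" for i using d0[of i] w0[of i] by (simp add: r_def)
  have dr: "diameter (U i) < r i" for i
  proof -
    have "diameter (U i) = d i powr (1 / t)" using t diameter_ge_0[OF U(2)[of i]] by (simp add: d_def powr_powr)
    also have "\<dots> < r i" unfolding r_def using t d0[of i] w0[of i] by (intro powr_less_mono2) auto
    finally show ?thesis .
  qed
  have "\<forall>i. \<exists>x. U i \<noteq> {} \<longrightarrow> x \<in> U i" by blast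
  from choice[OF this] obtain x where x: "\<And>i. U i \<noteq> {} \<Longrightarrow> x i \<in> U i" by blast
  have Ub: "U i \<subseteq> ball (x i) (r i)" for i
  proof
    fix y assume y: "y \<in> U i"
    hence "dist (x i) y \<le> diameter (U i)" using x by (intro diameter_bounded_bound U(2)) auto
    thus "y \<in> ball (x i) (r i)" using dr[of i] by simp
  qed
  have "A \<subseteq> (\<Union>i\<in>UNIV. ball (x i) (r i))" using U(1) Ub by fastforce
  then obtain I where I: "finite I" "A \<subseteq> (\<Union>i\<in>I. ball (x i) (r i))"
    using compactE_image[OF A, of UNIV "\<lambda>i. ball (x i) (r i)"] by auto
  let ?\<C> = "(\<lambda>i. (x i, r i)) ` I"
  have sd: "(\<Sum>i\<in>I. d i) < c / 2"
  proof -
    have "ennreal (\<Sum>i\<in>I. d i) = (\<Sum>i\<in>I. hs_term t (U i))"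
      using t by (simp add: hs_term_powr d_def sum_ennreal)
    also have "\<dots> \<le> (\<Sum>i. hs_term t (U i))" by (rule sum_le_suminf) (use I in auto)
    finally show ?thesis using U(3) d0 by (metis ennreal_less_iff le_less_trans sum_nonneg)
  qed
  have sw: "(\<Sum>i\<in>I. w i) \<le> c / 2"
  proof -
    have "w sums (c / 2 * 1)" unfolding w_def by (intro sums_mult power_half_series)
    thus ?thesis using sum_le_suminf[of w I] I(1) w0 by (auto simp: sums_iff less_imp_le)
  qed
  have "(\<Sum>b\<in>?\<C>. snd b powr t) \<le> (\<Sum>i\<in>I. snd (x i, r i) powr t)"
    using I(1) sum_image_le[of I "\<lambda>b. snd b powr t" "\<lambda>i. (x i, r i)"] by simp
  also have "\<dots> = (\<Sum>i\<in>I. d i) + (\<Sum>i\<in>I. w i)" by (simp add: rt sum.distrib)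
  also have "\<dots> < c" using sd sw by linarith
  finally have "(\<Sum>b\<in>?\<C>. snd b powr t) < c" .
  thus ?thesis unfolding covered_def using I r0 by (intro exI[of _ ?\<C>]) auto
qed

lemma hcontent_0_if_covered:
  fixes A :: "'a::metric_space set"
  assumes t: "t > 0" and cov: "\<And>c. c > 0 \<Longrightarrow> covered t c A"
  shows "hcontent t A = 0"
proof -
  have "hcontent t A \<le> ennreal e" if e: "e > 0" for e
  proof -
    have "e / 2 powr t > 0" using e by simp
    from cov[OF this] obtain \<C> where C: "finite \<C>" "\<forall>b\<in>\<C>. snd b > 0" "A \<subseteq> (\<Union>b\<in>\<C>. ball (fst b) (snd b))"
      "(\<Sum>b\<in>\<C>. snd b powr t) < e / 2 powr t" unfolding covered_def by blast
    obtain g where g: "bij_betw g {0..<card \<C>} \<C>" using ex_bij_betw_nat_finite[OF C(1)] by blast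
    define U where "U i = (if i < card \<C> then ball (fst (g i)) (snd (g i)) else {})" for i
    have "hcontent t A \<le> (\<Sum>i. hs_term t (U i))"
    proof -
      have "A \<subseteq> (\<Union>i. U i)"
      proof
        fix x assume "x \<in> A"
        then obtain b where b: "b \<in> \<C>" "x \<in> ball (fst b) (snd b)" using C(3) by blast
        then obtain i where "i < card \<C>" "g i = b" using g unfolding bij_betw_def by (metis atLeastLessThan_iff imageE)
        thus "x \<in> (\<Union>i. U i)" using b(2) by (auto simp: U_def)
      qed
      moreover have "bounded (U i)" for i by (simp add: U_def)
      ultimately show ?thesis unfolding hcontent_def by (intro Inf_lower CollectI exI[of _ U]) auto
    qed
    also have "\<dots> = (\<Sum>i<card \<C>. hs_term t (U i))"
      by (rule suminf_finite) (auto simp: U_def hs_term_def)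
    also have "\<dots> \<le> (\<Sum>i<card \<C>. ennreal ((2 * snd (g i)) powr t))"
    proof (rule sum_mono)
      fix i assume i: "i \<in> {..<card \<C>}"
      hence gi: "g i \<in> \<C>" using g unfolding bij_betw_def by auto
      have b: "bounded (U i)" by (simp add: U_def)
      have "diameter (U i) \<le> 2 * snd (g i)"
      proof -
        have "dist x y \<le> 2 * snd (g i)" if "x \<in> U i" "y \<in> U i" for x y
        proof -
          have "dist (fst (g i)) x < snd (g i)" "dist (fst (g i)) y < snd (g i)" using that i by (auto simp: U_def)
          thus ?thesis using dist_triangle3[of x y "fst (g i)"] by linarith
        qed
        thus ?thesis unfolding diameter_def using C(2) gi by (auto intro!: cSUP_least)
      qed
      thus "hs_term t (U i) \<le> ennreal ((2 * snd (g i)) powr t)"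
        using t diameter_ge_0[OF b] by (auto simp: hs_term_powr intro!: ennreal_leI powr_mono2)
    qed
    also have "\<dots> = ennreal (\<Sum>i<card \<C>. (2 * snd (g i)) powr t)" by (rule sum_ennreal) simp
    also have "(\<Sum>i<card \<C>. (2 * snd (g i)) powr t) = (\<Sum>b\<in>\<C>. (2 * snd b) powr t)"
      using sum.reindex_bij_betw[OF g, of "\<lambda>b. (2 * snd b) powr t"] by (simp add: atLeast0LessThan)
    also have "\<dots> = 2 powr t * (\<Sum>b\<in>\<C>. snd b powr t)"
      unfolding sum_distrib_left using C(2) by (intro sum.cong refl) (simp add: powr_mult)
    also have "\<dots> \<le> e" using C(4) by (simp add: less_divide_eq mult.commute)
    finally show ?thesis by (simp add: ennreal_leI)
  qed
  thus ?thesis by (metis ennreal_le_epsilon ennreal_0 add_0 le_zero_eq)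
qed

lemma hcontent_0_mono:
  fixes A :: "'a::metric_space set"
  assumes t: "0 < t" "t \<le> t'" and h: "hcontent t A = 0"
  shows "hcontent t' A = 0"
proof -
  have "hcontent t' A \<le> ennreal e" if e: "e > 0" for e
  proof -
    have "hcontent t A < ennreal (min e 1)" using h e by simp
    then obtain U :: "nat \<Rightarrow> 'a set" where U: "A \<subseteq> (\<Union>i. U i)" "\<And>i. bounded (U i)" "(\<Sum>i. hs_term t (U i)) < ennreal (min e 1)"
      unfolding hcontent_def Inf_less_iff by blast
    have "hs_term t' (U i) \<le> hs_term t (U i)" for i
    proof -
      have "hs_term t (U i) \<le> (\<Sum>i. hs_term t (U i))" using sum_le_suminf[of "\<lambda>i. hs_term t (U i)" "{i}"] by simp
      hence "ennreal (diameter (U i) powr t) < ennreal (min e 1)" using U(3) t by (simp add: hs_term_powr)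
      hence "diameter (U i) powr t < 1 powr t" using e by (auto simp: ennreal_less_iff)
      hence "\<not> 1 < diameter (U i)" using powr_less_mono2[OF t(1), of 1 "diameter (U i)"] by linarith
      thus ?thesis using t diameter_ge_0[OF U(2)[of i]] by (auto simp: hs_term_powr intro!: ennreal_leI powr_mono')
    qed
    hence "(\<Sum>i. hs_term t' (U i)) \<le> (\<Sum>i. hs_term t (U i))" by (intro suminf_le) auto
    moreover have "hcontent t' A \<le> (\<Sum>i. hs_term t' (U i))" unfolding hcontent_def using U by (intro Inf_lower) auto
    moreover have "ennreal (min e 1) \<le> ennreal e" by (intro ennreal_leI) auto
    ultimately show ?thesis using U(3) by (meson less_imp_le order_trans)
  qed
  thus ?thesis by (metis ennreal_le_epsilon ennreal_0 add_0 le_zero_eq)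
qed

definition rich_slices :: "(complex \<Rightarrow> real) \<Rightarrow> complex set \<Rightarrow> real \<Rightarrow> real \<Rightarrow> real set" where
  "rich_slices g K t c = {x. \<not> covered t c (K \<inter> g -` {x})}"

text \<open>A cover of the slice at \<open>x\<close> by open balls also covers the slices nearby:
  the part of \<open>K\<close> outside the balls is compact, and its image is a closed set missing
  \<open>x\<close>.\<close>

lemma closed_rich_slices:
  fixes g :: "complex \<Rightarrow> real"
  assumes K: "compact K" and g: "continuous_on K g"
  shows "closed (rich_slices g K t c)"
proof -
  have "open {x. covered t c (K \<inter> g -` {x})}"
  proof (rule Topological_Spaces.openI)
    fix x assume "x \<in> {x. covered t c (K \<inter> g -` {x})}"
    then obtain \<C> where C: "finite \<C>" "\<forall>b\<in>\<C>. snd b > 0" "K \<inter> g -` {x} \<subseteq> (\<Union>b\<in>\<C>. ball (fst b) (snd b))"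
      "(\<Sum>b\<in>\<C>. snd b powr t) < c" unfolding covered_def by blast
    let ?O = "\<Union>b\<in>\<C>. ball (fst b) (snd b)"
    have "compact (g ` (K - ?O))"
      using g K by (intro compact_continuous_image compact_diff) (auto intro: continuous_on_subset)
    hence "open (- g ` (K - ?O))" by (intro open_Compl compact_imp_closed)
    moreover have "x \<in> - g ` (K - ?O)" using C(3) by blast
    moreover have "- g ` (K - ?O) \<subseteq> {x. covered t c (K \<inter> g -` {x})}"
    proof
      fix x' assume "x' \<in> - g ` (K - ?O)"
      hence "K \<inter> g -` {x'} \<subseteq> ?O" by blast
      thus "x' \<in> {x. covered t c (K \<inter> g -` {x})}" unfolding covered_def using C by blast
    qed
    ultimately show "\<exists>T. open T \<and> x \<in> T \<and> T \<subseteq> {x. covered t c (K \<inter> g -` {x})}" by blast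
  qed
  thus ?thesis unfolding rich_slices_def closed_def by (simp add: Compl_eq)
qed

lemma rich_slices_subset: "c > 0 \<Longrightarrow> rich_slices g K t c \<subseteq> g ` K"
proof
  fix x assume c: "c > 0" and x: "x \<in> rich_slices g K t c"
  show "x \<in> g ` K"
  proof (rule ccontr)
    assume "x \<notin> g ` K"
    hence "K \<inter> g -` {x} = {}" by auto
    hence "covered t c (K \<inter> g -` {x})" unfolding covered_def using c by (intro exI[of _ "{}"]) auto
    thus False using x by (simp add: rich_slices_def)
  qed
qed

text \<open>Mass distribution principle for counting measure: each point is assigned to one ball,
  Cauchy-Schwarz is applied over the balls with weights \<open>snd b powr (t / 2)\<close>, and pairs
  within one ball are at distance at most twice its radius. Radii of at least
  \<open>\<delta>\<close> make the truncated kernel comparable.\<close>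

lemma card_sq_le_energy:
  fixes f :: "'i \<Rightarrow> complex" and \<delta> t :: real
  assumes B: "finite B" and C: "finite \<C>" "\<And>b. b \<in> \<C> \<Longrightarrow> \<delta> \<le> snd b" and \<delta>: "\<delta> > 0" and t: "t > 0"
    and cov: "\<And>u. u \<in> B \<Longrightarrow> \<exists>b\<in>\<C>. f u \<in> ball (fst b) (snd b)"
    and c: "(\<Sum>b\<in>\<C>. snd b powr t) \<le> c"
  shows "(real (card B))\<^sup>2 \<le> 2 powr t * c * (\<Sum>x\<in>B \<times> B. max (norm (f (fst x) - f (snd x))) \<delta> powr (- t))"
proof -
  let ?h = "\<lambda>x. max (norm (f (fst x) - f (snd x))) \<delta> powr (- t)"
  have "\<forall>u. \<exists>b. u \<in> B \<longrightarrow> b \<in> \<C> \<and> f u \<in> ball (fst b) (snd b)" using cov by blast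
  from choice[OF this] obtain i where i: "\<And>u. u \<in> B \<Longrightarrow> i u \<in> \<C> \<and> f u \<in> ball (fst (i u)) (snd (i u))" by blast
  define T where "T b = {u \<in> B. i u = b}" for b
  have fT: "finite (T b)" for b using B by (simp add: T_def)
  have rp: "snd b > 0" if "b \<in> \<C>" for b using C(2)[OF that] \<delta> by linarith
  have "i ` B \<subseteq> \<C>" using i by auto
  hence cB: "real (card B) = (\<Sum>b\<in>\<C>. real (card (T b)))"
    using sum.group[OF B C(1), of i "\<lambda>_. 1::real"] by (simp add: T_def)
  have "(\<Sum>b\<in>\<C>. real (card (T b)))\<^sup>2 = (\<Sum>b\<in>\<C>. snd b powr (t / 2) * (real (card (T b)) * snd b powr (- t / 2)))\<^sup>2"
  proof (intro arg_cong[where f="\<lambda>x. x\<^sup>2"] sum.cong refl)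
    fix b assume b: "b \<in> \<C>"
    have "snd b powr (t / 2) * snd b powr (- t / 2) = 1"
      using less_imp_neq[OF rp[OF b]] by (simp flip: powr_add)
    thus "real (card (T b)) = snd b powr (t / 2) * (real (card (T b)) * snd b powr (- t / 2))"
      by (metis mult.left_commute mult.right_neutral)
  qed
  also have "\<dots> \<le> (\<Sum>b\<in>\<C>. (snd b powr (t / 2))\<^sup>2) * (\<Sum>b\<in>\<C>. (real (card (T b)) * snd b powr (- t / 2))\<^sup>2)"
    by (rule Cauchy_Schwarz_ineq_sum)
  also have "(\<Sum>b\<in>\<C>. (snd b powr (t / 2))\<^sup>2) = (\<Sum>b\<in>\<C>. snd b powr t)"
    by (intro sum.cong refl) (simp add: power2_eq_square flip: powr_add)
  also have "(\<Sum>b\<in>\<C>. (real (card (T b)) * snd b powr (- t / 2))\<^sup>2) = (\<Sum>b\<in>\<C>. 2 powr t * ((real (card (T b)))\<^sup>2 * (2 * snd b) powr (- t)))"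
  proof (intro sum.cong refl)
    fix b assume b: "b \<in> \<C>"
    have "(snd b powr (- t / 2))\<^sup>2 = snd b powr (- t)" by (simp add: power2_eq_square flip: powr_add)
    also have "\<dots> = 2 powr t * (2 * snd b) powr (- t)"
      using less_imp_neq[OF rp[OF b]] by (simp add: powr_mult powr_minus)
    finally show "(real (card (T b)) * snd b powr (- t / 2))\<^sup>2 = 2 powr t * ((real (card (T b)))\<^sup>2 * (2 * snd b) powr (- t))"
      by (simp add: power_mult_distrib)
  qed
  also have "\<dots> = 2 powr t * (\<Sum>b\<in>\<C>. (real (card (T b)))\<^sup>2 * (2 * snd b) powr (- t))"
    by (simp only: sum_distrib_left)
  also have "(\<Sum>b\<in>\<C>. (real (card (T b)))\<^sup>2 * (2 * snd b) powr (- t)) \<le> (\<Sum>x\<in>B \<times> B. ?h x)"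
  proof -
    have "(\<Sum>b\<in>\<C>. (real (card (T b)))\<^sup>2 * (2 * snd b) powr (- t)) = (\<Sum>b\<in>\<C>. \<Sum>x\<in>T b \<times> T b. (2 * snd b) powr (- t))"
      by (simp add: card_cartesian_product power2_eq_square)
    also have "\<dots> \<le> (\<Sum>b\<in>\<C>. \<Sum>x\<in>T b \<times> T b. ?h x)"
    proof (intro sum_mono)
      fix b x assume b: "b \<in> \<C>" and x: "x \<in> T b \<times> T b"
      have "f (fst x) \<in> ball (fst b) (snd b)" "f (snd x) \<in> ball (fst b) (snd b)" using x i[of "fst x"] i[of "snd x"] by (auto simp: T_def)
      hence "norm (f (fst x) - f (snd x)) \<le> 2 * snd b"
        using dist_triangle3[of "f (fst x)" "f (snd x)" "fst b"] by (simp add: dist_norm)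
      moreover have "\<delta> \<le> 2 * snd b" using C(2)[OF b] rp[OF b] by linarith
      ultimately show "(2 * snd b) powr (- t) \<le> ?h x" using t \<delta> by (intro powr_mono2') auto
    qed
    also have "\<dots> = (\<Sum>x\<in>(\<Union>b\<in>\<C>. T b \<times> T b). ?h x)"
      by (rule sum.UNION_disjoint[symmetric]) (use C fT in \<open>auto simp: T_def\<close>)
    also have "\<dots> \<le> (\<Sum>x\<in>B \<times> B. ?h x)" using B by (intro sum_mono2) (auto simp: T_def)
    finally show ?thesis .
  qed
  finally have "(real (card B))\<^sup>2 \<le> (\<Sum>b\<in>\<C>. snd b powr t) * (2 powr t * (\<Sum>x\<in>B \<times> B. ?h x))"
    unfolding cB by (simp add: mult_left_mono sum_nonneg)
  also have "\<dots> \<le> c * (2 powr t * (\<Sum>x\<in>B \<times> B. ?h x))" using c by (intro mult_right_mono mult_nonneg_nonneg sum_nonneg) auto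
  finally show ?thesis by (simp add: mult_ac)
qed

lemma card_cells_le_measure:
  fixes V :: "real set" and \<delta> :: real
  assumes \<delta>: "\<delta> > 0" and T: "finite T" and sub: "\<And>k. k \<in> T \<Longrightarrow> {of_int k * \<delta>..<of_int (k + 1) * \<delta>} \<subseteq> V"
    and V: "V \<in> sets lebesgue" "emeasure lebesgue V \<le> ennreal \<kappa>" and \<kappa>: "\<kappa> \<ge> 0"
  shows "real (card T) * \<delta> \<le> \<kappa>"
proof -
  define I where "I k = {of_int k * \<delta>..<of_int (k + 1) * \<delta>}" for k :: int
  have disj: "disjoint_family_on I T"
  proof (unfold disjoint_family_on_def, intro ballI impI)
    fix j k :: int assume "j \<noteq> k"
    show "I j \<inter> I k = {}"
    proof (rule ccontr)
      assume "I j \<inter> I k \<noteq> {}"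
      then obtain x where x: "x \<in> I j" "x \<in> I k" by blast
      have "\<lfloor>x / \<delta>\<rfloor> = l" if "x \<in> I l" for l
        using that \<delta> by (intro floor_unique) (auto simp: I_def field_simps)
      thus False using x \<open>j \<noteq> k\<close> by metis
    qed
  qed
  have em: "emeasure lebesgue (I k) = ennreal \<delta>" for k
    using \<delta> by (simp add: I_def algebra_simps emeasure_lborel_Ico)
  have "ennreal (real (card T) * \<delta>) = (\<Sum>k\<in>T. emeasure lebesgue (I k))"
    using \<delta> by (simp add: em ennreal_mult ennreal_of_nat_eq_real_of_nat)
  also have "\<dots> = emeasure lebesgue (\<Union>k\<in>T. I k)"
    by (rule sum_emeasure[OF _ disj T]) (auto simp: I_def)
  also have "\<dots> \<le> emeasure lebesgue V" using sub V(1) by (intro emeasure_mono) (auto simp: I_def)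
  also have "\<dots> \<le> ennreal \<kappa>" by (rule V(2))
  finally show ?thesis using \<kappa> by (simp add: ennreal_le_iff)
qed

text \<open>Suppose the rich slices form a null set F. The cells of a fine grid either lie in a
  small open set V around F, and are few, or have their points covered by balls of small total cost.
  By \<open>card_sq_le_energy\<close> and Cauchy-Schwarz over the cells, each kind holds at most a
  third of the points.\<close>

lemma rich_slices_positive:
  fixes g :: "complex \<Rightarrow> real" and A :: "nat \<Rightarrow> 'i set" and f :: "nat \<Rightarrow> 'i \<Rightarrow> complex" and \<delta> :: "nat \<Rightarrow> real" and t C :: real
  assumes K: "compact K" and g: "continuous_on UNIV g" "\<And>z. \<bar>g z\<bar> \<le> norm z" and t: "t > 0" and C: "C > 0"
    and A: "\<And>n. finite (A n)" "\<And>n. A n \<noteq> {}" and fK: "\<And>n u. u \<in> A n \<Longrightarrow> f n u \<in> K"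
    and \<delta>: "\<And>n. \<delta> n > 0" "\<delta> \<longlonglongrightarrow> 0"
    and energy: "\<And>n. (\<Sum>x\<in>{x \<in> A n \<times> A n. \<bar>g (f n (fst x)) - g (f n (snd x))\<bar> \<le> \<delta> n}.
        max (norm (f n (fst x) - f n (snd x))) (\<delta> n) powr (- t)) \<le> C * (real (card (A n)))\<^sup>2 * \<delta> n"
  shows "\<exists>c>0. emeasure lebesgue (rich_slices g K t c) > 0"
proof -
  obtain r where r: "r \<ge> 1" "\<And>z. z \<in> K \<Longrightarrow> norm z < r"
    using compact_imp_bounded[OF K] unfolding bounded_pos_less by (metis max.cobounded1 max.strict_coboundedI2)
  \<comment> \<open>The values of \<open>c\<close> and \<open>\<kappa>\<close> make both squared
    counts at most a ninth of the squared number of points: 4 r bounds the total length of all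
    cells, \<open>r powr t\<close> the cost of a single ball containing K.\<close>
  define c where "c = 1 / (9 * (4 * r) * 2 powr t * C)"
  have c: "c > 0" using C r by (simp add: c_def)
  define \<kappa> where "\<kappa> = 1 / (9 * 2 powr t * r powr t * C)"
  have \<kappa>: "\<kappa> > 0" using C r by (simp add: \<kappa>_def)
  define F where "F = rich_slices g K t c"
  have gK: "continuous_on K g" using g(1) by (rule continuous_on_subset) simp
  have clF: "closed F" unfolding F_def by (rule closed_rich_slices[OF K gK])
  have "emeasure lebesgue F \<noteq> 0"
  proof
    assume F0: "emeasure lebesgue F = 0"
    have Fl: "F \<in> sets lebesgue" using clF by (simp add: borel_closed)
    obtain V where V: "open V" "F \<subseteq> V" "emeasure lebesgue (V - F) < ennreal \<kappa>"
      using sets_lebesgue_outer_open[OF Fl \<kappa>] by metis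
    have VV: "V \<in> sets lebesgue" using V(1) by simp
    have Vm: "emeasure lebesgue V \<le> ennreal \<kappa>"
    proof -
      have "emeasure lebesgue V \<le> emeasure lebesgue F + emeasure lebesgue (V - F)"
        using emeasure_subadditive[of F lebesgue "V - F"] Fl VV V(2) by (simp add: Un_absorb1 sets.Diff)
      thus ?thesis using V(3) F0 by simp
    qed
    have "\<forall>x. \<exists>\<C>. x \<notin> F \<longrightarrow> finite \<C> \<and> (\<forall>b\<in>\<C>. snd b > 0) \<and> K \<inter> g -` {x} \<subseteq> (\<Union>b\<in>\<C>. ball (fst b) (snd b)) \<and>
       (\<Sum>b\<in>\<C>. snd b powr t) < c"
      unfolding F_def rich_slices_def covered_def by blast
    from choice[OF this] obtain \<C> where \<C>: "\<And>x. x \<notin> F \<Longrightarrow> finite (\<C> x) \<and> (\<forall>b\<in>\<C> x. snd b > 0) \<and>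
        K \<inter> g -` {x} \<subseteq> (\<Union>b\<in>\<C> x. ball (fst b) (snd b)) \<and> (\<Sum>b\<in>\<C> x. snd b powr t) < c" by blast
    define O' where "O' x = (\<Union>b\<in>\<C> x. ball (fst b) (snd b))" for x
    define J where "J x = - g ` (K - O' x)" for x
    have opO: "open (O' x)" for x by (auto simp: O'_def)
    have opJ: "open (J x)" for x
    proof -
      have "compact (g ` (K - O' x))"
        using gK K opO by (intro compact_continuous_image compact_diff) (auto intro: continuous_on_subset)
      thus ?thesis unfolding J_def by (intro open_Compl compact_imp_closed)
    qed
    have xJ: "x \<in> J x" if "x \<notin> F" for x using \<C>[OF that] by (auto simp: J_def O'_def)
    have cg: "compact (g ` K)" using gK K by (rule compact_continuous_image)
    \<comment> \<open>An open cover of the compact projection: V at the index \<open>None\<close>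
      and, for each x outside F, the neighbourhood on which the balls chosen for x still cover the
      slices.\<close>
    define G where "G y = (case y of None \<Rightarrow> V | Some x \<Rightarrow> J x)" for y
    have "g ` K \<subseteq> (\<Union>y\<in>insert None (Some ` (- F)). G y)"
    proof
      fix x assume "x \<in> g ` K"
      show "x \<in> (\<Union>y\<in>insert None (Some ` (- F)). G y)"
        using V(2) xJ[of x] by (cases "x \<in> F") (auto simp: G_def)
    qed
    moreover have "open (G y)" for y using V(1) opJ by (auto simp: G_def split: option.splits)
    ultimately obtain Y where Y: "Y \<subseteq> insert None (Some ` (- F))" "finite Y" "g ` K \<subseteq> (\<Union>y\<in>Y. G y)"
      using compactE_image[OF cg, of "insert None (Some ` (- F))" G] by metis
    obtain e where e: "e > 0" "\<And>x. x \<in> g ` K \<Longrightarrow> \<exists>S\<in>G ` Y. ball x e \<subseteq> S"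
    proof (rule Heine_Borel_lemma[OF cg, of "G ` Y"])
      show "g ` K \<subseteq> \<Union> (G ` Y)" using Y(3) by simp
      show "open S" if "S \<in> G ` Y" for S using that \<open>\<And>y. open (G y)\<close> by auto
    qed blast
    define X where "X = {x. Some x \<in> Y}"
    have fX: "finite X" unfolding X_def using Y(2) by (rule finite_vimageI[of Y Some, unfolded vimage_def]) auto
    have XF: "x \<notin> F" if "x \<in> X" for x using that Y(1) by (auto simp: X_def)
    \<comment> \<open>All radii in use. The mesh will be below each of them and below half the
      Lebesgue number e; the element 1 makes the set nonempty and the mesh at most 1.\<close>
    define rad where "rad = insert 1 (\<Union>x\<in>X. snd ` \<C> x)"
    have frad: "finite rad" unfolding rad_def using fX \<C> XF by auto
    have radp: "Min rad > 0" using frad \<C> XF by (subst Min_gr_iff) (auto simp: rad_def)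
    have "eventually (\<lambda>n. \<delta> n < min (e / 2) (Min rad)) sequentially"
      using \<delta>(2) by (rule order_tendstoD) (use e radp in auto)
    then obtain n where n: "\<delta> n < e / 2" "\<delta> n < Min rad" by (auto simp: eventually_sequentially)
    define d where "d = \<delta> n"
    have d: "d > 0" "d < e / 2" using n \<delta>(1) by (auto simp: d_def)
    have drad: "d \<le> b" if "b \<in> rad" for b using n(2) Min_le[OF frad that] by (simp add: d_def)
    have d1: "d \<le> 1" by (rule drad) (simp add: rad_def)
    let ?A = "A n" and ?f = "f n"
    define cell where "cell u = \<lfloor>g (?f u) / d\<rfloor>" for u
    define T where "T = cell ` ?A"
    have fT: "finite T" using A by (simp add: T_def)
    define B where "B k = {u \<in> ?A. cell u = k}" for k
    have fB: "finite (B k)" for k using A by (simp add: B_def)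
    define En where "En k = (\<Sum>x\<in>B k \<times> B k. max (norm (?f (fst x) - ?f (snd x))) d powr (- t))" for k
    have En0: "En k \<ge> 0" for k by (simp add: En_def sum_nonneg)
    define Nn where "Nn = real (card ?A)"
    have Nn: "Nn > 0" using A by (simp add: Nn_def card_gt_0_iff)
    have cellI: "g (?f u) \<in> {of_int k * d..<of_int (k + 1) * d}" if "u \<in> B k" for u k
    proof -
      have k: "k = \<lfloor>g (?f u) / d\<rfloor>" using that by (simp add: B_def cell_def)
      have "of_int k \<le> g (?f u) / d" "g (?f u) / d < of_int k + 1" unfolding k by linarith+
      thus ?thesis using d by (simp add: field_simps)
    qed
    have EnT: "(\<Sum>k\<in>T. En k) \<le> C * Nn\<^sup>2 * d"
    proof -
      have "(\<Sum>k\<in>T. En k) = (\<Sum>x\<in>(\<Union>k\<in>T. B k \<times> B k). max (norm (?f (fst x) - ?f (snd x))) d powr (- t))"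
        unfolding En_def by (rule sum.UNION_disjoint[symmetric]) (use fT fB in \<open>auto simp: B_def\<close>)
      also have "\<dots> \<le> (\<Sum>x\<in>{x \<in> ?A \<times> ?A. \<bar>g (?f (fst x)) - g (?f (snd x))\<bar> \<le> d}. max (norm (?f (fst x) - ?f (snd x))) d powr (- t))"
      proof (rule sum_mono2)
        show "(\<Union>k\<in>T. B k \<times> B k) \<subseteq> {x \<in> ?A \<times> ?A. \<bar>g (?f (fst x)) - g (?f (snd x))\<bar> \<le> d}"
        proof
          fix x assume "x \<in> (\<Union>k\<in>T. B k \<times> B k)"
          then obtain k where k: "fst x \<in> B k" "snd x \<in> B k" by auto
          have "\<bar>g (?f (fst x)) - g (?f (snd x))\<bar> \<le> d"
            using cellI[OF k(1)] cellI[OF k(2)] by (auto simp: algebra_simps abs_le_iff)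
          moreover have "x \<in> ?A \<times> ?A" using k by (cases x) (auto simp: B_def)
          ultimately show "x \<in> {x \<in> ?A \<times> ?A. \<bar>g (?f (fst x)) - g (?f (snd x))\<bar> \<le> d}" by simp
        qed
      qed (use A in auto)
      also have "\<dots> \<le> C * Nn\<^sup>2 * d" using energy[of n] by (simp add: d_def Nn_def)
      finally show ?thesis .
    qed
    have CS: "(\<Sum>k\<in>S. real (card (B k)))\<^sup>2 \<le> M * 2 powr t * c' * C * Nn\<^sup>2"
      if S: "S \<subseteq> T" "real (card S) * d \<le> M" and c': "c' \<ge> 0" and bd: "\<And>k. k \<in> S \<Longrightarrow> (real (card (B k)))\<^sup>2 \<le> 2 powr t * c' * En k" for S M c'
    proof -
      have "(\<Sum>k\<in>S. 1 * real (card (B k)))\<^sup>2 \<le> (\<Sum>k\<in>S. 1\<^sup>2) * (\<Sum>k\<in>S. (real (card (B k)))\<^sup>2)"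
        by (rule Cauchy_Schwarz_ineq_sum)
      also have "\<dots> \<le> real (card S) * (\<Sum>k\<in>S. 2 powr t * c' * En k)"
        by (simp, intro mult_left_mono sum_mono bd) auto
      also have "\<dots> \<le> real (card S) * (2 powr t * c' * (C * Nn\<^sup>2 * d))"
      proof (intro mult_left_mono)
        have "(\<Sum>k\<in>S. En k) \<le> (\<Sum>k\<in>T. En k)" using S fT En0 by (intro sum_mono2) auto
        hence "(\<Sum>k\<in>S. En k) \<le> C * Nn\<^sup>2 * d" using EnT by linarith
        hence "2 powr t * c' * (\<Sum>k\<in>S. En k) \<le> 2 powr t * c' * (C * Nn\<^sup>2 * d)" using c' by (intro mult_left_mono) auto
        thus "(\<Sum>k\<in>S. 2 powr t * c' * En k) \<le> 2 powr t * c' * (C * Nn\<^sup>2 * d)" by (simp only: sum_distrib_left)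
      qed auto
      also have "\<dots> = (real (card S) * d) * (2 powr t * c' * C * Nn\<^sup>2)" by simp
      also have "\<dots> \<le> M * (2 powr t * c' * C * Nn\<^sup>2)"
        using S c' C by (intro mult_right_mono) auto
      finally show ?thesis by (simp add: mult_ac)
    qed
    define TV where "TV = {k \<in> T. {of_int k * d..<of_int (k + 1) * d} \<subseteq> V}"
    have fTV: "finite TV" using fT by (simp add: TV_def)
    \<comment> \<open>Cells inside V: the gain comes from their number, as one big ball covers the
      points of each.\<close>
    have sV: "(\<Sum>k\<in>TV. real (card (B k)))\<^sup>2 \<le> \<kappa> * 2 powr t * r powr t * C * Nn\<^sup>2"
    proof (rule CS)
      show "TV \<subseteq> T" by (auto simp: TV_def)
      show "real (card TV) * d \<le> \<kappa>"
        using \<kappa> by (intro card_cells_le_measure[OF d(1) fTV _ VV Vm]) (auto simp: TV_def)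
      fix k
      show "(real (card (B k)))\<^sup>2 \<le> 2 powr t * r powr t * En k"
        unfolding En_def
      proof (rule card_sq_le_energy[where \<C>="{(0, r)}"])
        show "\<exists>b\<in>{(0, r)}. ?f u \<in> ball (fst b) (snd b)" if "u \<in> B k" for u
          using r(2)[OF fK[of u n]] that by (simp add: B_def)
      qed (use fB d t r d1 in auto)
    qed simp
    have cardT: "real (card T) * d \<le> 4 * r"
    proof -
      have "T \<subseteq> {\<lfloor>- r / d\<rfloor>..\<lfloor>r / d\<rfloor>}"
      proof
        fix k assume "k \<in> T"
        then obtain u where u: "u \<in> ?A" "k = \<lfloor>g (?f u) / d\<rfloor>" by (auto simp: T_def cell_def)
        have "\<bar>g (?f u)\<bar> \<le> r" using g(2)[of "?f u"] r(2)[OF fK[OF u(1)]] by linarith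
        hence "- r / d \<le> g (?f u) / d" "g (?f u) / d \<le> r / d" using d by (intro divide_right_mono; simp)+
        thus "k \<in> {\<lfloor>- r / d\<rfloor>..\<lfloor>r / d\<rfloor>}" unfolding u(2) atLeastAtMost_iff by (intro conjI floor_mono)
      qed
      hence "card T \<le> card {\<lfloor>- r / d\<rfloor>..\<lfloor>r / d\<rfloor>}" by (intro card_mono) auto
      hence "real (card T) \<le> real (nat (\<lfloor>r / d\<rfloor> - \<lfloor>- r / d\<rfloor> + 1))" by simp
      also have "\<dots> \<le> 2 * (r / d) + 2"
      proof -
        have "0 \<le> r / d" using r d by simp
        thus ?thesis by (simp add: minus_divide_left[symmetric]) linarith
      qed
      finally have "real (card T) * d \<le> (2 * (r / d) + 2) * d" using d by (intro mult_right_mono) auto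
      also have "\<dots> = 2 * r + 2 * d" using d by (simp add: field_simps)
      finally show ?thesis using d1 r(1) by linarith
    qed
    \<comment> \<open>The other cells may be many; here the gain comes from the cost
      \<open>c\<close> of the balls.\<close>
    have sG: "(\<Sum>k\<in>T - TV. real (card (B k)))\<^sup>2 \<le> (4 * r) * 2 powr t * c * C * Nn\<^sup>2"
    proof (rule CS)
      show "T - TV \<subseteq> T" by auto
      have "card (T - TV) \<le> card T" using fT by (intro card_mono) auto
      hence "real (card (T - TV)) * d \<le> real (card T) * d" using d by (intro mult_right_mono) auto
      thus "real (card (T - TV)) * d \<le> 4 * r" using cardT by linarith
      fix k assume k: "k \<in> T - TV"
      then obtain u0 where u0: "u0 \<in> B k" by (auto simp: T_def B_def)
      have gu0: "g (?f u0) \<in> g ` K" using u0 fK by (auto simp: B_def)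
      have ib: "{of_int k * d..<of_int (k + 1) * d} \<subseteq> ball (g (?f u0)) e"
        using cellI[OF u0] d by (auto simp: dist_real_def algebra_simps abs_less_iff)
      obtain y where y: "y \<in> Y" "ball (g (?f u0)) e \<subseteq> G y" using e(2)[OF gu0] by blast
      \<comment> \<open>The cell is not contained in V but in some member of the cover, so that
        member is a \<open>J x\<close>.\<close>
      have "y \<noteq> None" using k ib y(2) by (auto simp: TV_def G_def)
      then obtain x where x: "y = Some x" by blast
      have xX: "x \<in> X" using y x by (simp add: X_def)
      note Cx = \<C>[OF XF[OF xX]]
      show "(real (card (B k)))\<^sup>2 \<le> 2 powr t * c * En k"
        unfolding En_def
      proof (rule card_sq_le_energy[where \<C>="\<C> x"])
        show "finite (\<C> x)" "(\<Sum>b\<in>\<C> x. snd b powr t) \<le> c" using Cx by auto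
        show "d \<le> snd b" if "b \<in> \<C> x" for b using that xX by (intro drad) (auto simp: rad_def)
        fix u assume u: "u \<in> B k"
        have "g (?f u) \<in> J x" using cellI[OF u] ib y(2) x by (auto simp: G_def)
        moreover have "?f u \<in> K" using u fK by (auto simp: B_def)
        ultimately have "?f u \<in> O' x" by (auto simp: J_def)
        thus "\<exists>b\<in>\<C> x. ?f u \<in> ball (fst b) (snd b)" by (auto simp: O'_def)
      qed (use fB d t in auto)
    qed (use c in simp)
    have "\<kappa> * 2 powr t * r powr t * C = 1 / 9" using C r by (simp add: \<kappa>_def)
    hence "\<kappa> * 2 powr t * r powr t * C * Nn\<^sup>2 = (Nn / 3)\<^sup>2" by (simp only: power_divide) simp
    hence "(\<Sum>k\<in>TV. real (card (B k)))\<^sup>2 \<le> (Nn / 3)\<^sup>2" using sV by (simp only:)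
    hence "(\<Sum>k\<in>TV. real (card (B k))) \<le> Nn / 3" by (rule power2_le_imp_le) (use Nn in simp)
    moreover have "(4 * r) * 2 powr t * c * C = 1 / 9" using C r by (simp add: c_def)
    hence "(4 * r) * 2 powr t * c * C * Nn\<^sup>2 = (Nn / 3)\<^sup>2" by (simp only: power_divide) simp
    hence "(\<Sum>k\<in>T - TV. real (card (B k)))\<^sup>2 \<le> (Nn / 3)\<^sup>2" using sG by (simp only:)
    hence "(\<Sum>k\<in>T - TV. real (card (B k))) \<le> Nn / 3" by (rule power2_le_imp_le) (use Nn in simp)
    moreover have "Nn = (\<Sum>k\<in>T. real (card (B k)))"
      using sum.image_gen[of ?A "\<lambda>_. 1::real" cell] A(1) by (simp add: Nn_def T_def B_def)
    moreover have "(\<Sum>k\<in>T. real (card (B k))) = (\<Sum>k\<in>T - TV. real (card (B k))) + (\<Sum>k\<in>TV. real (card (B k)))"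
      by (rule sum.subset_diff) (use fT in \<open>auto simp: TV_def\<close>)
    ultimately show False using Nn by linarith
  qed
  thus ?thesis using c unfolding F_def by (intro exI[of _ c]) (simp add: zero_less_iff_neq_zero)
qed

text \<open>Measurability matters since \<open>emeasure\<close> is 0 on nonmeasurable sets.
  Dimension at least \<sigma> means positive content at a sequence of exponents \<open>tk k\<close>
  increasing to \<sigma>, and positive content means richness for some 1 / (j + 1); this gives a
  countable intersection of countable unions of closed sets.\<close>

lemma dim_slices_measurable:
  fixes g :: "complex \<Rightarrow> real"
  assumes K: "compact K" and g: "continuous_on K g" and \<sigma>: "\<sigma> > 0"
  shows "{x \<in> g ` K. hausdorff_dim (K \<inter> g -` {x}) \<ge> ereal \<sigma>} \<in> sets lebesgue"
    and "\<sigma> \<le> t \<Longrightarrow> c > 0 \<Longrightarrow> rich_slices g K t c \<subseteq> {x \<in> g ` K. hausdorff_dim (K \<inter> g -` {x}) \<ge> ereal \<sigma>}"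
proof -
  define S where "S = {x \<in> g ` K. hausdorff_dim (K \<inter> g -` {x}) \<ge> ereal \<sigma>}"
  define tk where "tk k = \<sigma> * (1 - 1 / (real k + 2))" for k
  have tk: "0 < tk k" "tk k < \<sigma>" for k using \<sigma> by (auto simp: tk_def)
  have dimiff: "hausdorff_dim (K \<inter> g -` {x}) \<ge> ereal \<sigma> \<longleftrightarrow> (\<forall>t. 0 < t \<and> t < \<sigma> \<longrightarrow> hcontent t (K \<inter> g -` {x}) \<noteq> 0)"
    if "x \<in> g ` K" for x
  proof -
    have ne: "K \<inter> g -` {x} \<noteq> {}" using that by auto
    have "hausdorff_dim (K \<inter> g -` {x}) \<ge> ereal \<sigma> \<longleftrightarrow> (\<forall>t. t > 0 \<and> hausdorff_measure t (K \<inter> g -` {x}) = 0 \<longrightarrow> \<sigma> \<le> t)"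
      using ne by (auto simp: hausdorff_dim_def le_Inf_iff)
    also have "\<dots> \<longleftrightarrow> (\<forall>t. 0 < t \<and> t < \<sigma> \<longrightarrow> hcontent t (K \<inter> g -` {x}) \<noteq> 0)"
      using hausdorff_measure_0_iff[of _ "K \<inter> g -` {x}"] by (meson linorder_not_le)
    finally show ?thesis .
  qed
  have cK: "compact (K \<inter> g -` {x})" for x
  proof -
    have "closed (K \<inter> g -` {x})" using g compact_imp_closed[OF K] by (intro continuous_closed_preimage) auto
    hence "compact (K \<inter> (K \<inter> g -` {x}))" using K by (intro compact_Int_closed)
    thus ?thesis by (simp add: Int_assoc[symmetric])
  qed
  have rich: "hcontent t (K \<inter> g -` {x}) \<noteq> 0 \<longleftrightarrow> (\<exists>j. x \<in> rich_slices g K t (1 / real (Suc j)))" if tp: "t > 0" for x t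
  proof
    assume "hcontent t (K \<inter> g -` {x}) \<noteq> 0"
    then obtain c where c: "c > 0" "\<not> covered t c (K \<inter> g -` {x})" using hcontent_0_if_covered[OF tp] by blast
    obtain j where j: "1 / real (Suc j) < c" using c(1) by (metis inverse_eq_divide reals_Archimedean)
    have "\<not> covered t (1 / real (Suc j)) (K \<inter> g -` {x})"
      using c(2) j unfolding covered_def by (meson less_trans)
    thus "\<exists>j. x \<in> rich_slices g K t (1 / real (Suc j))" by (auto simp: rich_slices_def)
  next
    assume "\<exists>j. x \<in> rich_slices g K t (1 / real (Suc j))"
    thus "hcontent t (K \<inter> g -` {x}) \<noteq> 0"
      using covered_if_hcontent_0[OF tp _ cK] by (auto simp: rich_slices_def)
  qed
  have "S = g ` K \<inter> (\<Inter>k. \<Union>j. rich_slices g K (tk k) (1 / real (Suc j)))"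
  proof (rule set_eqI)
    fix x
    have "(\<forall>t. 0 < t \<and> t < \<sigma> \<longrightarrow> hcontent t (K \<inter> g -` {x}) \<noteq> 0) \<longleftrightarrow> (\<forall>k. hcontent (tk k) (K \<inter> g -` {x}) \<noteq> 0)"
    proof
      assume h: "\<forall>k. hcontent (tk k) (K \<inter> g -` {x}) \<noteq> 0"
      show "\<forall>t. 0 < t \<and> t < \<sigma> \<longrightarrow> hcontent t (K \<inter> g -` {x}) \<noteq> 0"
      proof (intro allI impI)
        fix t assume t: "0 < t \<and> t < \<sigma>"
        obtain k :: nat where "real k \<ge> \<sigma> / (\<sigma> - t)" using real_arch_simple by blast
        hence "\<sigma> / (real k + 2) \<le> \<sigma> - t" using t by (simp add: field_simps)
        hence "t \<le> tk k" by (simp add: tk_def algebra_simps)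
        thus "hcontent t (K \<inter> g -` {x}) \<noteq> 0" using h hcontent_0_mono t by blast
      qed
    qed (use tk in blast)
    thus "x \<in> S \<longleftrightarrow> x \<in> g ` K \<inter> (\<Inter>k. \<Union>j. rich_slices g K (tk k) (1 / real (Suc j)))"
      using dimiff[of x] rich[OF tk(1), where x=x] by (auto simp: S_def)
  qed
  moreover have "g ` K \<in> sets lebesgue"
    using compact_imp_closed[OF compact_continuous_image[OF g K]] by (simp add: borel_closed)
  moreover have "rich_slices g K t c \<in> sets lebesgue" for t c
    using closed_rich_slices[OF K g] by (simp add: borel_closed)
  ultimately have "S \<in> sets lebesgue" by auto
  thus "{x \<in> g ` K. hausdorff_dim (K \<inter> g -` {x}) \<ge> ereal \<sigma>} \<in> sets lebesgue" by (simp add: S_def)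
  assume t: "\<sigma> \<le> t" and c: "c > 0"
  show "rich_slices g K t c \<subseteq> {x \<in> g ` K. hausdorff_dim (K \<inter> g -` {x}) \<ge> ereal \<sigma>}"
  proof
    fix x assume x: "x \<in> rich_slices g K t c"
    have xg: "x \<in> g ` K" using rich_slices_subset[OF c] x by blast
    have "hcontent t (K \<inter> g -` {x}) \<noteq> 0"
      using covered_if_hcontent_0[OF _ c cK] x t \<sigma> by (auto simp: rich_slices_def)
    hence "hausdorff_dim (K \<inter> g -` {x}) \<ge> ereal \<sigma>"
      unfolding dimiff[OF xg] using hcontent_0_mono t by (meson less_imp_le order_trans)
    thus "x \<in> {x \<in> g ` K. hausdorff_dim (K \<inter> g -` {x}) \<ge> ereal \<sigma>}" using xg by simp
  qed
qed

section \<open>Proof of the theorem\<close>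

context hom_sys
begin

text \<open>Any \<open>z\<close> in \<open>K\<close> supplies sample points
  \<open>pt \<mu> p + \<mu> ^ n * z\<close> of \<open>K\<close>; the common translation cancels in
  all differences, so \<open>directional_energy\<close> applies to them.\<close>

lemma slices_positive:
  assumes K: "compact K" "K \<noteq> {}"
    and inv: "\<And>n p z. p \<in> words D n \<times> words {0, \<Delta>} n \<Longrightarrow> z \<in> K \<Longrightarrow> pt \<mu> p + \<mu> ^ n * z \<in> K"
    and \<beta>: "\<beta> \<in> {0..<pi} - exc_dirs"
  shows "\<exists>c>0. emeasure lebesgue (rich_slices (proj \<beta>) K \<tau> c) > 0"
proof -
  obtain z where z: "z \<in> K" using K(2) by blast
  obtain C where C: "C > 0" "\<And>n. (\<Sum>x\<in>dirpairs n \<beta>. max (norm (pt \<mu> (fst x) - pt \<mu> (snd x))) (\<rho> ^ n) powr (- \<tau>))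
     \<le> C * N {0, \<Delta>} ^ (2 * n) * \<rho> ^ n"
    using directional_energy[OF \<beta>] by blast
  have pr: "proj \<beta> = inner (cis \<beta>)" by (rule ext) (simp add: proj_def inner_complex_def mult.commute)
  show ?thesis
  proof (rule rich_slices_positive[where A="P {0, \<Delta>}" and f="\<lambda>n p. pt \<mu> p + \<mu> ^ n * z" and \<delta>="\<lambda>n. \<rho> ^ n" and C=C])
    show "continuous_on UNIV (proj \<beta>)" unfolding pr by (intro continuous_intros)
    show "\<bar>proj \<beta> w\<bar> \<le> norm w" for w unfolding pr using Cauchy_Schwarz_ineq2[of "cis \<beta>" w] by simp
    show "finite (P {0, \<Delta>} n)" for n by (rule finP[OF Z2])
    show "P {0, \<Delta>} n \<noteq> {}" for n
    proof
      assume "P {0, \<Delta>} n = {}"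
      hence "N {0, \<Delta>} ^ n = 0" using cardP[OF Z2, of n] by simp
      thus False using N_pos[OF Z2] by simp
    qed
    show "pt \<mu> u + \<mu> ^ n * z \<in> K" if "u \<in> P {0, \<Delta>} n" for n u
      using inv z that by (simp add: P_def)
    show "(\<lambda>n. \<rho> ^ n) \<longlonglongrightarrow> 0" using mu_less by (intro LIMSEQ_power_zero) simp
    show "(\<Sum>x\<in>{x \<in> P {0, \<Delta>} n \<times> P {0, \<Delta>} n. \<bar>proj \<beta> (pt \<mu> (fst x) + \<mu> ^ n * z) - proj \<beta> (pt \<mu> (snd x) + \<mu> ^ n * z)\<bar> \<le> \<rho> ^ n}.
        max (norm (pt \<mu> (fst x) + \<mu> ^ n * z - (pt \<mu> (snd x) + \<mu> ^ n * z))) (\<rho> ^ n) powr - \<tau>)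
        \<le> C * (real (card (P {0, \<Delta>} n)))\<^sup>2 * \<rho> ^ n" for n
      using C(2)[of n] unfolding pr dirpairs_def
      by (simp add: inner_add_right cardP[OF Z2] mult.commute[of 2] power_mult)
  qed (use K mu_pos tau C(1) in simp_all)
qed

end

theorem theorem4p8:
  fixes m :: nat and r \<theta> :: "nat \<Rightarrow> real" and a :: "nat \<Rightarrow> complex"
    and K :: "complex set" and s :: real
  assumes m: "m \<ge> 2"
    and r: "\<forall>i<m. 0 < r i \<and> r i < 1"
    and dense_rot: "closure {cis (\<Sum>i<m. of_int (n i) * \<theta> i) | n :: nat \<Rightarrow> int. True}
                      = sphere 0 1"
    and attractor: "K \<noteq> {}" "compact K"
                   "K = (\<Union>i<m. simil (r i) (\<theta> i) (a i) ` K)"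
    and osc: "\<exists>U. open U \<and> U \<noteq> {} \<and>
                  (\<Union>i<m. simil (r i) (\<theta> i) (a i) ` U) \<subseteq> U \<and>
                  (\<forall>i<m. \<forall>j<m. i \<noteq> j \<longrightarrow>
                     simil (r i) (\<theta> i) (a i) ` U \<inter> simil (r j) (\<theta> j) (a j) ` U = {})"
    and s_eq: "(\<Sum>i<m. r i powr s) = 1"
    and dimK: "hausdorff_dim K = ereal s"
    and s_gt: "s > 1"
  shows "\<exists>E \<subseteq> {0..<pi}. hausdorff_dim E = 0 \<and>
           (\<forall>\<beta> \<in> {0..<pi} - E. \<forall>\<epsilon>. 0 < \<epsilon> \<and> \<epsilon> < s - 1 \<longrightarrow>
              emeasure lebesgue
                {x \<in> proj \<beta> ` K. hausdorff_dim (K \<inter> proj \<beta> -` {x}) \<ge> ereal (s - 1 - \<epsilon>)} > 0)"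
proof -
  define c where "c i = complex_of_real (r i) * cis (\<theta> i)" for i
  have cn: "norm (c i) = r i" if "i < m" for i using r that by (simp add: c_def norm_mult abs_of_pos)
  have sim: "simil (r i) (\<theta> i) (a i) z = a i + c i * z" for i z by (simp add: simil_def c_def)
  interpret ifs m c a by unfold_locales (use r cn in auto)
  obtain U where OU: "open U \<and> U \<noteq> {} \<and> (\<Union>i<m. simil (r i) (\<theta> i) (a i) ` U) \<subseteq> U \<and>
      (\<forall>i<m. \<forall>j<m. i \<noteq> j \<longrightarrow> simil (r i) (\<theta> i) (a i) ` U \<inter> simil (r j) (\<theta> j) (a j) ` U = {})"
    using osc by (rule exE)
  have U: "open U" "U \<noteq> {}" using OU by simp_all
  have U': "a i + c i * z \<in> U" if "i < m" "z \<in> U" for i z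
  proof -
    have "(\<Union>i<m. simil (r i) (\<theta> i) (a i) ` U) \<subseteq> U" using OU by (elim conjE)
    moreover have "simil (r i) (\<theta> i) (a i) z \<in> (\<Union>i<m. simil (r i) (\<theta> i) (a i) ` U)"
      using that by (intro UN_I imageI) auto
    ultimately show ?thesis unfolding sim by (rule subsetD)
  qed
  have disj': "i = j" if "i < m" "j < m" "z \<in> U" "z' \<in> U" "a i + c i * z = a j + c j * z'" for i j z z'
  proof (rule ccontr)
    assume "i \<noteq> j"
    hence "simil (r i) (\<theta> i) (a i) ` U \<inter> simil (r j) (\<theta> j) (a j) ` U = {}" using OU that(1,2) by simp
    moreover have "simil (r i) (\<theta> i) (a i) z \<in> simil (r i) (\<theta> i) (a i) ` U" using that(3) by (rule imageI)
    moreover have "simil (r i) (\<theta> i) (a i) z \<in> simil (r j) (\<theta> j) (a j) ` U"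
      unfolding sim that(5) unfolding sim[symmetric] using that(4) by (rule imageI)
    ultimately show False by (metis IntI empty_iff)
  qed
  have K': "a i + c i * z \<in> K" if "i < m" "z \<in> K" for i z
  proof -
    have "simil (r i) (\<theta> i) (a i) z \<in> (\<Union>i<m. simil (r i) (\<theta> i) (a i) ` K)"
      using that by (intro UN_I imageI) auto
    hence "simil (r i) (\<theta> i) (a i) z \<in> K" by (subst attractor(3))
    thus ?thesis by (simp only: sim)
  qed
  obtain l where l: "l < m" "\<And>k. k > 0 \<Longrightarrow> cis (\<theta> l) ^ k \<noteq> 1"
    using dense_rotations_irrational[OF dense_rot] by blast
  \<comment> \<open>A real number of modulus 1 has square 1, so a real power would give a trivial
    power at twice the exponent.\<close>
  have lr: "Im (c l ^ k) \<noteq> 0" if k: "k > 0" for k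
  proof
    assume h: "Im (c l ^ k) = 0"
    have "c l ^ k = of_real (r l ^ k) * cis (\<theta> l) ^ k" by (simp add: c_def power_mult_distrib)
    hence "Im (cis (\<theta> l) ^ k) = 0" using h r l(1) by (auto simp: Im_complex_of_real)
    moreover have "norm (cis (\<theta> l) ^ k) = 1" by (simp add: norm_power)
    ultimately have "Re (cis (\<theta> l) ^ k) = 1 \<or> Re (cis (\<theta> l) ^ k) = -1" by (auto simp: cmod_def)
    hence "(cis (\<theta> l) ^ k)\<^sup>2 = 1"
      using \<open>Im (cis (\<theta> l) ^ k) = 0\<close> by (auto simp: complex_eq_iff power2_eq_square)
    hence "cis (\<theta> l) ^ (k * 2) = 1" by (simp add: power_mult)
    thus False using l(2)[of "k * 2"] k by simp
  qed
  have s1: "(\<Sum>i<m. norm (c i) powr s) = 1" using s_eq cn by simp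
  have contp: "continuous_on A (proj \<beta>)" for \<beta> A
    unfolding proj_def by (intro continuous_intros)
  \<comment> \<open>Increasing to s - 1. Every value brings its own subsystem and exceptional set;
    their countable union still has zero content in every positive exponent and serves all
    \<open>\<epsilon>\<close>.\<close>
  define \<tau> where "\<tau> j = s - 1 - 1 / real (Suc j)" for j
  have "\<exists>E. (\<forall>t>0. hcontent t E = 0) \<and> E \<subseteq> {0..<pi} \<and>
      (\<tau> j > 0 \<longrightarrow> (\<forall>\<beta>\<in>{0..<pi} - E. \<exists>c>0. emeasure lebesgue (rich_slices (proj \<beta>) K (\<tau> j) c) > 0))" for j
  proof (cases "\<tau> j > 0")
    case True
    have lt: "1 + \<tau> j < s" by (simp add: \<tau>_def)
    have "\<exists>D \<Delta> \<mu> r0. hom_sys D \<Delta> \<mu> r0 (\<tau> j) \<and>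
       (\<forall>n. \<forall>p\<in>words D n \<times> words {0, \<Delta>} n. \<forall>z\<in>K. pt \<mu> p + \<mu> ^ n * z \<in> K)"
    proof (rule homogeneous_subsystem[where U=U, OF m s1 True lt l(1)])
      show "Im (c l ^ k) \<noteq> 0" if "k > 0" for k using that by (rule lr)
      show "open U" "U \<noteq> {}" by (rule U)+
      show "a i + c i * z \<in> U" if "i < m" "z \<in> U" for i z using that by (rule U')
      show "i = j" if "i < m" "j < m" "z \<in> U" "z' \<in> U" "a i + c i * z = a j + c j * z'" for i j z z'
        using that by (rule disj')
      show "a i + c i * z \<in> K" if "i < m" "z \<in> K" for i z using that by (rule K')
    qed
    then obtain D \<Delta> \<mu> r0 where H: "hom_sys D \<Delta> \<mu> r0 (\<tau> j)"
      and inv: "\<And>n p z. p \<in> words D n \<times> words {0, \<Delta>} n \<Longrightarrow> z \<in> K \<Longrightarrow> pt \<mu> p + \<mu> ^ n * z \<in> K" by metis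
    interpret hom_sys D \<Delta> \<mu> r0 "\<tau> j" by (rule H)
    show ?thesis
      using hcontent_exc_dirs slices_positive[OF attractor(2,1) inv]
      by (intro exI[of _ exc_dirs]) (auto simp: exc_dirs_def)
  next
    case False
    have "hcontent t ({}::real set) = 0" if "t > 0" for t
      using hcontent_mono[of "{}" "{0::real}" t] hcontent_singleton[OF that, of "0::real"] by simp
    thus ?thesis using False by (intro exI[of _ "{}"]) auto
  qed
  then obtain E where E: "\<And>j t. t > 0 \<Longrightarrow> hcontent t (E j) = 0" "\<And>j. E j \<subseteq> {0..<pi}"
    "\<And>j \<beta>. \<tau> j > 0 \<Longrightarrow> \<beta> \<in> {0..<pi} - E j \<Longrightarrow> \<exists>c>0. emeasure lebesgue (rich_slices (proj \<beta>) K (\<tau> j) c) > 0"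
    by metis
  \<comment> \<open>The point 0 is added because the empty set has dimension \<open>-\<infinity>\<close>.\<close>
  define E' where "E' = (\<Union>j. case j of 0 \<Rightarrow> {0} | Suc j \<Rightarrow> E j)"
  have "0 \<in> E'" unfolding E'_def by (rule UN_I[of 0]) auto
  hence "hausdorff_dim E' = 0"
  proof (intro hausdorff_dim_eq_0)
    fix t :: real assume "t > 0"
    thus "hcontent t E' = 0" unfolding E'_def
      using E(1) hcontent_singleton by (intro hcontent_0_UN) (auto split: nat.split)
  qed auto
  moreover have "E' \<subseteq> {0..<pi}" unfolding E'_def by (intro UN_least) (simp add: E(2) split: nat.split)
  moreover have "emeasure lebesgue {x \<in> proj \<beta> ` K. hausdorff_dim (K \<inter> proj \<beta> -` {x}) \<ge> ereal (s - 1 - \<epsilon>)} > 0"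
    if \<beta>: "\<beta> \<in> {0..<pi} - E'" and \<epsilon>: "0 < \<epsilon>" "\<epsilon> < s - 1" for \<beta> \<epsilon>
  proof -
    obtain j where j: "1 / real (Suc j) < \<epsilon>" using \<epsilon>(1) by (metis inverse_eq_divide reals_Archimedean)
    have tj: "\<tau> j > 0" "s - 1 - \<epsilon> \<le> \<tau> j" using j \<epsilon> by (auto simp: \<tau>_def)
    have "E j \<subseteq> E'" unfolding E'_def by (rule SUP_upper2[of "Suc j"]) auto
    then obtain c where c: "c > 0" "emeasure lebesgue (rich_slices (proj \<beta>) K (\<tau> j) c) > 0"
      using E(3)[OF tj(1), of \<beta>] \<beta> by blast
    have pos: "s - 1 - \<epsilon> > 0" using \<epsilon> by simp
    note M = dim_slices_measurable[OF attractor(2) contp pos]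
    have "emeasure lebesgue (rich_slices (proj \<beta>) K (\<tau> j) c) \<le>
        emeasure lebesgue {x \<in> proj \<beta> ` K. hausdorff_dim (K \<inter> proj \<beta> -` {x}) \<ge> ereal (s - 1 - \<epsilon>)}"
      by (rule emeasure_mono[OF M(2)[OF tj(2) c(1)] M(1)])
    thus ?thesis using c(2) by (meson less_le_trans)
  qed
  ultimately show ?thesis by blast
qed

end
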